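(* Let $N\in\mathbb{N}^\star$, $a>0$, $x>0$, $t\ge0$, let $p=(p_1,\dots,p_N)\in\mathbb{R}^N$ with $p_i\neq p_j$ for $i\neq j$, let $D=\mathrm{diag}[p_1,\ldots,p_N]$, and let $c\in\mathbb{R}^N$ be a vector with positive entries. Let $E(a):=D^2+a^2\,c\otimes c$ and write $E(a)=UR^2U^{-1}$ with $R$ a diagonal matrix and $U$ an orthogonal matrix. Let $W$ be an $N$-dimensional Wiener process and let $\xi_p$ be the $\mathbb{R}^N$-valued Ornstein--Uhlenbeck process solving $d\xi_p(s)=dW(s)+D\xi_p(s)\,ds$, $\xi_p(0)=0$; set $X_{p,c}(s):=\langle c,\xi_p(s)\rangle$. For $z\in\mathbb{R}$ let $\zeta(z,t):=zR+tR^3$, $$\phi_a(z,t):=U\{\cosh(\zeta(z,t))-\sinh(\zeta(z,t))R^{-1}U^{-1}DU\}U^{-1},$$ and $\beta_{a,x,t}(y):=-((\partial_z\phi_a)\phi_a^{-1})(x-y,t)$. Define $$I_{p,c,a}(x,t):=\mathbb{E}\left[\exp\left(-\frac{a^2}{2}\int_0^xX_{p,c}(y)^2dy+\frac{1}{2}\langle(\beta_{a,x,t}(x)-D)\xi_p(x),\xi_p(x)\rangle\right)\right].$$ Let $\Delta:=[0,x]\times\{1,\ldots,N\}$ with the measure $\mu=\lambda\otimes\nu$, $\lambda$ the Lebesgue measure on $[0,x]$ and $\nu$ the counting measure on $\{1,\dots,N\}$. Let $\mathcal{C}$ be the integral operator on $L^2(\Delta,\mu)$ given by $\mathcal{C}\psi(\cdot):=\int_\Delta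 f_2(\cdot,\eta)\psi(\eta)\,d\mu(\eta)$, where $$f_2((v,j),(u,i)):=a^2\frac{c_ic_j}{p_i+p_j}\left(e^{(p_i+p_j)x}-e^{(p_i+p_j)(u\vee v)}\right)e^{-p_iu}e^{-p_jv}-(\beta_{a,x,t}(x)-D)_{i,j}\,e^{(p_i+p_j)x-up_i-vp_j},$$ with $u\vee v=\max(u,v)$. Then $$I_{p,c,a}(x,t)=\left(\det(I+\mathcal{C})\right)^{-1/2},$$ where $\det$ denotes the Fredholm determinant.
   Context: Here $\cosh$ and $\sinh$ of the diagonal matrix $\zeta(z,t)$ are taken entrywise on the diagonal, and $\phi_a(z,t)$ is assumed invertible as implicit in the definition of $\beta_{a,x,t}$. For a trace-class operator $\mathcal{A}$ with eigenvalues $\lambda_n(\mathcal{A})$, the Fredholm determinant is $\det(I+\mathcal{A})=\prod_n(1+\lambda_n(\mathcal{A}))$. *)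

theory Defs
  imports "HOL-Probability.Probability"
begin

definition diag :: "real^'n \<Rightarrow> real^'n^'n" where
  "diag v = (\<chi> i j. if i = j then v$i else 0)"

definition wiener_process :: "'w measure \<Rightarrow> (real \<Rightarrow> 'w \<Rightarrow> real^'n) \<Rightarrow> bool" where
  "wiener_process M W \<longleftrightarrow>
     prob_space M \<and>
     (\<forall>s\<ge>0. W s \<in> borel_measurable M) \<and>
     (\<forall>\<omega>\<in>space M. W 0 \<omega> = 0 \<and> continuous_on {0..} (\<lambda>s. W s \<omega>)) \<and>
     (\<forall>s t. 0 \<le> s \<and> s < t \<longrightarrow>
        prob_space.indep_vars M (\<lambda>_. borel) (\<lambda>i \<omega>. (W t \<omega> - W s \<omega>) $ i) UNIV \<and>
        (\<forall>i. distributed M lborel (\<lambda>\<omega>. (W t \<omega> - W s \<omega>) $ i)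
               (\<lambda>y. ennreal (normal_density 0 (sqrt (t - s)) y)))) \<and>
     (\<forall>ts::real list. sorted_wrt (<) ts \<and> (\<forall>t\<in>set ts. 0 \<le> t) \<longrightarrow>
        prob_space.indep_vars M (\<lambda>_. borel)
          (\<lambda>k \<omega>. W (ts ! Suc k) \<omega> - W (ts ! k) \<omega>) {..<length ts - 1})"

definition L2 :: "'b measure \<Rightarrow> ('b \<Rightarrow> complex) set" where
  "L2 \<mu> = {\<psi>. \<psi> \<in> borel_measurable \<mu> \<and> integrable \<mu> (\<lambda>\<eta>. (cmod (\<psi> \<eta>))^2)}"

definition int_op :: "'b measure \<Rightarrow> ('b \<Rightarrow> 'b \<Rightarrow> real) \<Rightarrow> ('b \<Rightarrow> complex) \<Rightarrow> 'b \<Rightarrow> complex" where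
  "int_op \<mu> K \<psi> = (\<lambda>\<xi>. \<integral>\<eta>. complex_of_real (K \<xi> \<eta>) * \<psi> \<eta> \<partial>\<mu>)"

definition gen_eigenspace :: "'b measure \<Rightarrow> ('b \<Rightarrow> 'b \<Rightarrow> real) \<Rightarrow> complex \<Rightarrow> ('b \<Rightarrow> complex) set" where
  "gen_eigenspace \<mu> K z = {\<psi> \<in> L2 \<mu>. \<exists>k::nat.
      AE \<eta> in \<mu>. (((\<lambda>\<phi> \<xi>. int_op \<mu> K \<phi> \<xi> - z * \<phi> \<xi>) ^^ k) \<psi>) \<eta> = 0}"

definition ae_lin_indep :: "'b measure \<Rightarrow> nat \<Rightarrow> (nat \<Rightarrow> 'b \<Rightarrow> complex) \<Rightarrow> bool" where
  "ae_lin_indep \<mu> m \<phi> \<longleftrightarrow>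
     (\<forall>cf::nat \<Rightarrow> complex. (AE \<eta> in \<mu>. (\<Sum>i<m. cf i * \<phi> i \<eta>) = 0) \<longrightarrow> (\<forall>i<m. cf i = 0))"

definition alg_mult :: "'b measure \<Rightarrow> ('b \<Rightarrow> 'b \<Rightarrow> real) \<Rightarrow> complex \<Rightarrow> nat" where
  "alg_mult \<mu> K z = Sup {m. \<exists>\<phi>. (\<forall>i<m. \<phi> i \<in> gen_eigenspace \<mu> K z) \<and> ae_lin_indep \<mu> m \<phi>}"

text \<open>lam enumerates the nonzero eigenvalues, repeated according to algebraic multiplicity,
  all remaining entries being 0.\<close>
definition eigen_enum :: "'b measure \<Rightarrow> ('b \<Rightarrow> 'b \<Rightarrow> real) \<Rightarrow> (nat \<Rightarrow> complex) \<Rightarrow> bool" where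
  "eigen_enum \<mu> K lam \<longleftrightarrow>
     (\<forall>z. z \<noteq> 0 \<longrightarrow> finite {n. lam n = z} \<and> card {n. lam n = z} = alg_mult \<mu> K z)"

definition fredholm_det :: "'b measure \<Rightarrow> ('b \<Rightarrow> 'b \<Rightarrow> real) \<Rightarrow> complex" where
  "fredholm_det \<mu> K = (THE d. \<exists>lam. eigen_enum \<mu> K lam \<and> (\<lambda>n. 1 + lam n) has_prod d)"

definition zeta :: "real^'n \<Rightarrow> real \<Rightarrow> real \<Rightarrow> real^'n" where
  "zeta r z t = (\<chi> k. z * r$k + t * (r$k)^3)"

definition phi_a :: "real^'n^'n \<Rightarrow> real^'n \<Rightarrow> real^'n \<Rightarrow> real \<Rightarrow> real \<Rightarrow> real^'n^'n" where
  "phi_a U r p z t = U ** (diag (\<chi> k. cosh (zeta r z t $ k))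
      - diag (\<chi> k. sinh (zeta r z t $ k)) ** matrix_inv (diag r) ** matrix_inv U ** diag p ** U)
      ** matrix_inv U"

definition beta :: "real^'n^'n \<Rightarrow> real^'n \<Rightarrow> real^'n \<Rightarrow> real \<Rightarrow> real \<Rightarrow> real \<Rightarrow> real^'n^'n" where
  "beta U r p x t y = - (vector_derivative (\<lambda>z. phi_a U r p z t) (at (x - y))
                         ** matrix_inv (phi_a U r p (x - y) t))"

text \<open>(e^{s x} - e^{s m}) / s, extended continuously by x - m when s = 0.\<close>
definition dexp :: "real \<Rightarrow> real \<Rightarrow> real \<Rightarrow> real" where
  "dexp s x m = (if s = 0 then x - m else (exp (s * x) - exp (s * m)) / s)"

definition f2 :: "real \<Rightarrow> real^'n \<Rightarrow> real^'n \<Rightarrow> real^'n^'n \<Rightarrow> real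
                   \<Rightarrow> real \<times> 'n \<Rightarrow> real \<times> 'n \<Rightarrow> real" where
  "f2 a c p B x = (\<lambda>(v, j) (u, i).
      a^2 * c$i * c$j * dexp (p$i + p$j) x (max u v) * exp (- p$i * u) * exp (- p$j * v)
      - (B - diag p) $ i $ j * exp ((p$i + p$j) * x - u * p$i - v * p$j))"

definition Delta_measure :: "real \<Rightarrow> (real \<times> 'n) measure" where
  "Delta_measure x = restrict_space lborel {0..x} \<Otimes>\<^sub>M count_space UNIV"

end

theory Submission
  imports Defs "HOL-Complex_Analysis.Great_Picard" "HOL-Library.Function_Algebras"
begin

text \<open>Let \<open>\<xi>' = D \<xi> + f\<close>, \<open>\<xi> 0 = 0\<close>. The operator of the theorem satisfies
  \<open>\<langle>C f, f\<rangle> = a\<^sup>2 \<integral> \<langle>c, \<xi>\<rangle>\<^sup>2 - \<langle>(\<beta>(x) - D) \<xi>(x), \<xi>(x)\<rangle>\<close>, so formally the random variable in the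
  exponent is \<open>- \<langle>C dW, dW\<rangle> / 2\<close>. Since \<open>C\<close> factors through \<open>f \<mapsto> (\<langle>c, \<xi>\<rangle>, \<xi>(x))\<close>, it is compact, symmetric
  and, by Bessel's inequality, trace class: it has an orthonormal family of eigenfunctions \<open>e\<^sub>k\<close> with
  summable eigenvalues \<open>l\<^sub>k\<close>. The pairings \<open>g\<^sub>k = \<langle>e\<^sub>k, dW\<rangle>\<close> are independent standard normal variables
  and the exponent is \<open>- \<Sum> l\<^sub>k g\<^sub>k\<^sup>2 / 2\<close>, which gives the expectation \<open>\<Prod> (1 + l\<^sub>k)\<^sup>-\<^sup>1\<^sup>/\<^sup>2\<close> once \<open>1 + l\<^sub>k > 0\<close>.
  The last inequality holds because \<open>\<beta>\<close> solves \<open>\<beta>' = D\<^sup>2 + a\<^sup>2 c \<otimes> c - \<beta>\<^sup>2\<close> on \<open>[0, x]\<close>, whence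
  \<open>\<langle>f, f\<rangle> + \<langle>C f, f\<rangle> = \<integral> |f - (\<beta> - D) \<xi>|\<^sup>2\<close>. To avoid stochastic integrals, \<open>dW\<close> is replaced by step functions
  and \<open>g\<^sub>k\<close> is read off from \<open>\<xi>\<close>, on which everything depends continuously: \<open>l\<^sub>k g\<^sub>k\<close> is the polarised form
  of \<open>C\<close> at \<open>e\<^sub>k\<close> and \<open>dW\<close>.\<close>

section \<open>Compact symmetric operators on a semi-inner product space\<close>

text \<open>\<open>fredholm_det\<close> is a definite description over all enumerations of the
  nonzero eigenvalues of a complex operator, counted by the dimension of generalized eigenspaces. So
  symmetry must exclude nonreal eigenvalues and Jordan chains, each multiplicity must be matched
  with the number of its occurrences in the real sequence \<open>l\<close>, and the infinite product
  must be independent of the order; there the summability of \<open>l\<close> enters a second time.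
  All vectors are honest functions, not classes modulo null sets. Hence semi-inner products, and an
  operator that maps null functions exactly to 0. The bound \<open>1 + l k > 0\<close> rests on the
  invertibility of \<open>phi_a\<close> on the whole of \<open>[0, x]\<close>, which keeps the
  Riccati solution finite there. It makes the Gaussian integrals finite and the product nonzero.
  Gaussianity is carried as a formula for joint exponential moments at complex arguments: a square
  with \<open>l k > 0\<close> calls for an imaginary argument, one with \<open>l k < 0\<close> for a
  real one. This form also passes to limits without any separate treatment of independence.\<close>

locale semi_ip =
  fixes V :: "'v::real_vector set" and ip :: "'v \<Rightarrow> 'v \<Rightarrow> real"
  assumes subspace_V: "subspace V"
    and ip_add_left: "\<And>f g h. f \<in> V \<Longrightarrow> g \<in> V \<Longrightarrow> h \<in> V \<Longrightarrow> ip (f + g) h = ip f h + ip g h"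
    and ip_scale_left: "\<And>r f g. f \<in> V \<Longrightarrow> g \<in> V \<Longrightarrow> ip (r *\<^sub>R f) g = r * ip f g"
    and ip_commute: "\<And>f g. f \<in> V \<Longrightarrow> g \<in> V \<Longrightarrow> ip f g = ip g f"
    and ip_nonneg: "\<And>f. f \<in> V \<Longrightarrow> 0 \<le> ip f f"
begin

lemma V_closed [simp, intro]:
  "0 \<in> V"
  "f \<in> V \<Longrightarrow> g \<in> V \<Longrightarrow> f + g \<in> V"
  "f \<in> V \<Longrightarrow> r *\<^sub>R f \<in> V"
  "f \<in> V \<Longrightarrow> g \<in> V \<Longrightarrow> f - g \<in> V"
  using subspace_V by (auto simp: subspace_0 subspace_add subspace_scale subspace_diff)

lemma V_sum [simp, intro]: "(\<And>i. i \<in> A \<Longrightarrow> e i \<in> V) \<Longrightarrow> sum e A \<in> V"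
  using subspace_V by (auto intro: subspace_sum)

lemma ip_zero [simp]: "f \<in> V \<Longrightarrow> ip 0 f = 0" "f \<in> V \<Longrightarrow> ip f 0 = 0"
  using ip_scale_left[of 0 f 0] ip_commute[of f 0] by auto

lemma ip_add_right: "f \<in> V \<Longrightarrow> g \<in> V \<Longrightarrow> h \<in> V \<Longrightarrow> ip h (f + g) = ip h f + ip h g"
  using ip_add_left[of f g h] ip_commute[of h f] ip_commute[of h g] ip_commute[of h "f + g"] by auto

lemma ip_scale_right: "f \<in> V \<Longrightarrow> g \<in> V \<Longrightarrow> ip f (r *\<^sub>R g) = r * ip f g"
  using ip_scale_left[of g f r] ip_commute[of f "r *\<^sub>R g"] ip_commute[of f g] by auto

lemma ip_diff_left: "f \<in> V \<Longrightarrow> g \<in> V \<Longrightarrow> h \<in> V \<Longrightarrow> ip (f - g) h = ip f h - ip g h"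
  using ip_add_left[of "f - g" g h] by auto

lemma ip_diff_right: "f \<in> V \<Longrightarrow> g \<in> V \<Longrightarrow> h \<in> V \<Longrightarrow> ip h (f - g) = ip h f - ip h g"
  using ip_add_right[of "f - g" g h] by auto

lemma ip_sum_left:
  "(\<And>i. i \<in> A \<Longrightarrow> e i \<in> V) \<Longrightarrow> f \<in> V \<Longrightarrow> ip (sum e A) f = (\<Sum>i\<in>A. ip (e i) f)"
proof (induction A rule: infinite_finite_induct)
  case (insert x A)
  then show ?case by (auto simp: ip_add_left)
qed auto

lemma ip_sum_right:
  "(\<And>i. i \<in> A \<Longrightarrow> e i \<in> V) \<Longrightarrow> f \<in> V \<Longrightarrow> ip f (sum e A) = (\<Sum>i\<in>A. ip f (e i))"
  using ip_sum_left[of A e f] by (simp add: ip_commute)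

lemma CS_ip:
  assumes f: "f \<in> V" and g: "g \<in> V"
  shows "(ip f g)\<^sup>2 \<le> ip f f * ip g g"
proof -
  have "0 \<le> ip f f + 2 * s * ip f g + s\<^sup>2 * ip g g" for s
    using ip_nonneg[of "f + s *\<^sub>R g"] f g
    by (simp add: ip_add_left ip_add_right ip_scale_left ip_scale_right ip_commute[of g f]
        power2_eq_square algebra_simps)
  note q = this
  show ?thesis
  proof (cases "ip g g = 0")
    case True
    have "ip f g = 0"
    proof (rule ccontr)
      assume "ip f g \<noteq> 0"
      \<comment> \<open>When \<open>ip g g = 0\<close> the quadratic is affine in \<open>s\<close>,
        and this choice of \<open>s\<close> gives it the value -1.\<close>
      then show False using q[of "- (ip f f + 1) / (2 * ip f g)"] True by (simp add: field_simps)
    qed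
    then show ?thesis using True by simp
  next
    case False
    then have "0 < ip g g" using ip_nonneg[OF g] by linarith
    then show ?thesis using q[of "- ip f g / ip g g"]
      by (simp add: field_simps power2_eq_square)
  qed
qed

text \<open>This stands in for the passage to the quotient by null vectors.\<close>

lemma ip_null: "f \<in> V \<Longrightarrow> g \<in> V \<Longrightarrow> ip f f = 0 \<Longrightarrow> ip f g = 0"
  using CS_ip[of f g] by simp

lemma bessel:
  assumes "finite F" and e: "\<And>i. i \<in> F \<Longrightarrow> e i \<in> V"
    and on: "\<And>i j. i \<in> F \<Longrightarrow> j \<in> F \<Longrightarrow> ip (e i) (e j) = (if i = j then 1 else 0)"
    and f: "f \<in> V"
  shows "(\<Sum>i\<in>F. (ip (e i) f)\<^sup>2) \<le> ip f f"
proof -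
  define p where "p = (\<Sum>i\<in>F. ip (e i) f *\<^sub>R e i)"
  have p: "p \<in> V" using e by (auto simp: p_def)
  have ep: "ip (e i) p = ip (e i) f" if "i \<in> F" for i
    using that e assms(1) unfolding p_def
    by (simp add: ip_sum_right ip_scale_right on if_distrib cong: if_cong)
  have pf: "ip p f = (\<Sum>i\<in>F. (ip (e i) f)\<^sup>2)"
    using e f unfolding p_def by (simp add: ip_sum_left ip_scale_left power2_eq_square)
  have pp: "ip p p = (\<Sum>i\<in>F. (ip (e i) f)\<^sup>2)"
    using e p ep unfolding p_def[of] by (subst ip_sum_left) (auto simp: ip_scale_left power2_eq_square p_def[symmetric])
  have "0 \<le> ip (f - p) (f - p)" using f p by (intro ip_nonneg) auto
  also have "\<dots> = ip f f - 2 * ip p f + ip p p"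
    using f p by (simp add: ip_diff_left ip_diff_right ip_commute[of f p])
  finally show ?thesis using pf pp by simp
qed

text \<open>Cauchy-Schwarz turns convergence in the seminorm into weak convergence, which is enough
  to identify limits up to null vectors.\<close>

lemma ip_tendsto_left:
  assumes "\<And>n. f n \<in> V" "g \<in> V" "h \<in> V" "(\<lambda>n. ip (f n - g) (f n - g)) \<longlonglongrightarrow> 0"
  shows "(\<lambda>n. ip (f n) h) \<longlonglongrightarrow> ip g h"
proof -
  have "(\<lambda>n. (ip (f n - g) h)\<^sup>2) \<longlonglongrightarrow> 0"
  proof (rule Lim_null_comparison)
    show "\<forall>\<^sub>F n in sequentially. norm ((ip (f n - g) h)\<^sup>2) \<le> ip (f n - g) (f n - g) * ip h h"
      using assms by (auto intro!: always_eventually CS_ip)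
    show "(\<lambda>n. ip (f n - g) (f n - g) * ip h h) \<longlonglongrightarrow> 0"
      using tendsto_mult_left_zero[OF assms(4)] by simp
  qed
  then have "(\<lambda>n. \<bar>ip (f n - g) h\<bar>) \<longlonglongrightarrow> 0"
    using tendsto_real_sqrt[of "\<lambda>n. (ip (f n - g) h)\<^sup>2" 0] by simp
  then have "(\<lambda>n. ip (f n - g) h) \<longlonglongrightarrow> 0" using tendsto_rabs_zero_iff by blast
  then have "(\<lambda>n. ip (f n) h - ip g h) \<longlonglongrightarrow> 0" using assms by (simp add: ip_diff_left)
  then show ?thesis using LIM_zero_iff by blast
qed

end

text \<open>\<open>T_null\<close> demands equality with 0, not just a null value: an integral
  operator sees only classes, and this is what later upgrades an approximate eigenvector to an exact
  one. \<open>T_trace\<close> encodes the trace class property through diagonal sums over finite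
  orthonormal families, the form in which Bessel's inequality delivers it and in which it bounds the
  sum of the eigenvalues.\<close>

locale compact_symmetric = semi_ip V ip
  for V :: "'v::real_vector set" and ip +
  fixes T :: "'v \<Rightarrow> 'v"
  assumes T_in: "\<And>f. f \<in> V \<Longrightarrow> T f \<in> V"
    and T_add: "\<And>f g. f \<in> V \<Longrightarrow> g \<in> V \<Longrightarrow> T (f + g) = T f + T g"
    and T_scale: "\<And>r f. f \<in> V \<Longrightarrow> T (r *\<^sub>R f) = r *\<^sub>R T f"
    and T_symmetric: "\<And>f g. f \<in> V \<Longrightarrow> g \<in> V \<Longrightarrow> ip (T f) g = ip f (T g)"
    and T_null: "\<And>f. f \<in> V \<Longrightarrow> ip f f = 0 \<Longrightarrow> T f = 0"
    and T_bounded: "\<exists>B. \<forall>f\<in>V. ip (T f) (T f) \<le> B * ip f f"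
    and T_compact: "\<And>f. (\<And>n. f n \<in> V) \<Longrightarrow> (\<And>n. ip (f n) (f n) \<le> 1) \<Longrightarrow>
      \<exists>g\<in>V. \<exists>r::nat \<Rightarrow> nat. strict_mono r \<and> (\<lambda>n. ip (T (f (r n)) - g) (T (f (r n)) - g)) \<longlonglongrightarrow> 0"
    and T_trace: "\<exists>C. \<forall>F::nat set. \<forall>e. finite F \<longrightarrow> (\<forall>i\<in>F. e i \<in> V) \<longrightarrow>
      (\<forall>i\<in>F. \<forall>j\<in>F. ip (e i) (e j) = (if i = j then 1 else 0)) \<longrightarrow>
      (\<Sum>i\<in>F. \<bar>ip (T (e i)) (e i)\<bar>) \<le> C"
begin

declare T_in [simp, intro]

lemma T_diff: "f \<in> V \<Longrightarrow> g \<in> V \<Longrightarrow> T (f - g) = T f - T g"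
  using T_add[of f "(-1) *\<^sub>R g"] T_scale[of g "-1"] V_closed(3)[of g "-1"] by simp

lemma T_zero [simp]: "T 0 = 0"
  using T_scale[of 0 0] by auto

lemma T_sum: "(\<And>i. i \<in> A \<Longrightarrow> e i \<in> V) \<Longrightarrow> T (sum e A) = (\<Sum>i\<in>A. T (e i))"
proof (induction A rule: infinite_finite_induct)
  case (insert x A)
  then show ?case by (auto simp: T_add)
qed auto

text \<open>Variational principle on the orthogonal complement \<open>W\<close> of the eigenvectors
  found so far, which \<open>T\<close> leaves invariant: a maximising sequence for the absolute
  value of the quadratic form is an approximate eigensequence, and compactness supplies the limit.
  If the form vanishes on \<open>W\<close>, the pair with \<open>e = 0\<close>, \<open>l = 0\<close>
  is returned, so that the choice never gets stuck.\<close>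

lemma exists_extremal_eigenvector:
  assumes S: "S \<subseteq> V" and eig: "\<And>s. s \<in> S \<Longrightarrow> \<exists>z. T s = z *\<^sub>R s"
  shows "\<exists>e l. e \<in> V \<and> (\<forall>s\<in>S. ip s e = 0) \<and> T e = l *\<^sub>R e \<and>
    (if l = 0 then e = 0 else ip e e = 1) \<and>
    (\<forall>f\<in>V. (\<forall>s\<in>S. ip s f = 0) \<longrightarrow> \<bar>ip (T f) f\<bar> \<le> \<bar>l\<bar> * ip f f)"
proof -
  define W where "W = {f \<in> V. \<forall>s\<in>S. ip s f = 0}"
  have WV: "W \<subseteq> V" by (auto simp: W_def)
  have W_add: "f + g \<in> W" if "f \<in> W" "g \<in> W" for f g
    using that S by (auto simp: W_def ip_add_right subset_iff)
  have W_scale: "r *\<^sub>R f \<in> W" if "f \<in> W" for f r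
    using that S by (auto simp: W_def ip_scale_right subset_iff)
  have W_T: "T f \<in> W" if "f \<in> W" for f
  proof -
    have "ip s (T f) = 0" if s: "s \<in> S" for s
    proof -
      obtain z where "T s = z *\<^sub>R s" using eig[OF s] by blast
      then show ?thesis using \<open>f \<in> W\<close> s S T_symmetric[of s f]
        by (auto simp: W_def ip_scale_left subset_iff)
    qed
    then show ?thesis using that by (auto simp: W_def)
  qed
  have W_diff: "f - g \<in> W" if "f \<in> W" "g \<in> W" for f g
    using W_add[OF that(1) W_scale[OF that(2), of "-1"]] by simp
  obtain B where B: "\<And>f. f \<in> V \<Longrightarrow> ip (T f) (T f) \<le> B * ip f f" using T_bounded by blast
  define Q where "Q = {\<bar>ip (T f) f\<bar> |f. f \<in> W \<and> ip f f \<le> 1}"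
  define m where "m = Sup Q"
  have Q0: "0 \<in> Q" unfolding Q_def W_def using S by (auto intro!: exI[of _ 0])
  have Qbd: "bdd_above Q"
  proof
    fix y assume "y \<in> Q"
    then obtain f where f: "y = \<bar>ip (T f) f\<bar>" "f \<in> V" "ip f f \<le> 1" by (auto simp: Q_def W_def)
    have "(ip (T f) f)\<^sup>2 \<le> ip (T f) (T f) * ip f f" using f by (intro CS_ip) auto
    also have "\<dots> \<le> ip (T f) (T f) * 1" using f ip_nonneg[of "T f"] by (intro mult_left_mono) auto
    also have "\<dots> \<le> B * ip f f" using B f by simp
    also have "\<dots> \<le> \<bar>B\<bar> * 1" using f ip_nonneg[of f] by (intro mult_mono) auto
    finally have "(ip (T f) f)\<^sup>2 \<le> \<bar>B\<bar>" by simp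
    then show "y \<le> sqrt \<bar>B\<bar>" using f(1) real_le_rsqrt[of "\<bar>ip (T f) f\<bar>"] by simp
  qed
  have m0: "0 \<le> m" unfolding m_def using Q0 Qbd by (rule cSup_upper)
  have mbound: "\<bar>ip (T f) f\<bar> \<le> m * ip f f" if "f \<in> W" for f
  proof (cases "ip f f = 0")
    case True
    then show ?thesis using that T_null[of f] WV by auto
  next
    case False
    have fV: "f \<in> V" using that WV by auto
    then have pos: "0 < ip f f" using False ip_nonneg[of f] by simp
    define s where "s = 1 / sqrt (ip f f)"
    have s2: "s * s = 1 / ip f f" using pos by (simp add: s_def)
    have "\<bar>ip (T (s *\<^sub>R f)) (s *\<^sub>R f)\<bar> \<in> Q"
      unfolding Q_def using W_scale[OF that, of s] fV s2 pos
      by (auto intro!: exI[of _ "s *\<^sub>R f"] simp: ip_scale_left ip_scale_right mult.assoc[symmetric])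
    then have "\<bar>ip (T (s *\<^sub>R f)) (s *\<^sub>R f)\<bar> \<le> m" unfolding m_def using Qbd by (rule cSup_upper)
    then have "\<bar>ip (T f) f\<bar> / ip f f \<le> m"
      using fV s2 pos by (simp add: T_scale ip_scale_left ip_scale_right mult.assoc[symmetric] abs_mult)
    then show ?thesis using pos by (simp add: field_simps)
  qed
  \<comment> \<open>For a symmetric operator the bound \<open>m\<close> on the quadratic form also
    bounds the operator norm, by polarisation.\<close>
  have Tnorm: "ip (T f) (T f) \<le> m\<^sup>2 * ip f f" if "f \<in> W" for f
  proof (cases "ip (T f) (T f) = 0 \<or> ip f f = 0")
    case True
    then show ?thesis using that m0 T_null[of f] ip_nonneg[of f] WV by auto
  next
    case False
    have fV: "f \<in> V" using that WV by auto
    define a where "a = sqrt (ip f f)"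
    define b where "b = sqrt (ip (T f) (T f))"
    have a: "0 < a" "a * a = ip f f" and b: "0 < b" "b * b = ip (T f) (T f)"
      using False ip_nonneg[of f] ip_nonneg[of "T f"] fV by (auto simp: a_def b_def)
    \<comment> \<open>Scaling \<open>T f\<close> to the length of \<open>f\<close> makes the
      polarised inequality read \<open>a * b \<le> m * a^2\<close>, which is the claim.\<close>
    define h where "h = (a / b) *\<^sub>R T f"
    have hW: "h \<in> W" and hV: "h \<in> V" using W_scale W_T that WV by (auto simp: h_def)
    have hh: "ip h h = a * a"
      using b(1) fV by (simp add: h_def ip_scale_left ip_scale_right flip: b(2))
    have Tfh: "ip (T f) h = a * b" using a b fV
      by (simp add: h_def ip_scale_right flip: b(2))
    have "4 * ip (T f) h = ip (T (f + h)) (f + h) - ip (T (f - h)) (f - h)"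
      using fV hV T_symmetric[of h f] ip_commute[of h "T f"]
      by (simp add: T_add T_diff ip_add_left ip_add_right ip_diff_left ip_diff_right)
    also have "\<dots> \<le> m * ip (f + h) (f + h) + m * ip (f - h) (f - h)"
      using mbound[OF W_add[OF that hW]] mbound[OF W_diff[OF that hW]] by linarith
    also have "\<dots> = 2 * m * (ip f f + ip h h)"
      using fV hV by (simp add: ip_add_left ip_add_right ip_diff_left ip_diff_right algebra_simps)
    finally have "a * b \<le> m * (a * a)" using hh Tfh a(2) by simp
    then have "a * b \<le> a * (m * a)" by (simp add: ac_simps)
    then have "b \<le> m * a" using a(1) by simp
    then have "b * b \<le> (m * a) * (m * a)" using b by (intro mult_mono) auto
    then have "b * b \<le> m\<^sup>2 * (a * a)" by (simp add: power2_eq_square ac_simps)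
    then show ?thesis unfolding a(2) b(2) .
  qed
  show ?thesis
  proof (cases "m = 0")
    case True
    have "\<bar>ip (T f) f\<bar> \<le> \<bar>0\<bar> * ip f f" if "f \<in> V" "\<forall>s\<in>S. ip s f = 0" for f
      using mbound[of f] that True by (auto simp: W_def)
    then show ?thesis using S by (intro exI[of _ 0]) (auto simp: subset_iff)
  next
    case False
    then have m: "0 < m" using m0 by simp
    have "\<exists>f. f \<in> W \<and> ip f f \<le> 1 \<and> m - 1 / Suc n < \<bar>ip (T f) f\<bar>" for n
    proof -
      have "\<exists>y\<in>Q. m - 1 / Suc n < y"
        unfolding m_def using Q0 Qbd by (subst less_cSup_iff[symmetric]) auto
      then show ?thesis by (auto simp: Q_def)
    qed
    then obtain f where f: "\<And>n. f n \<in> W" "\<And>n. ip (f n) (f n) \<le> 1"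
        "\<And>n. m - 1 / Suc n < \<bar>ip (T (f n)) (f n)\<bar>" by metis
    have fV: "f n \<in> V" for n using f WV by auto
    have "(\<exists>\<^sub>\<infinity>n. ip (T (f n)) (f n) \<ge> 0) \<or> (\<exists>\<^sub>\<infinity>n. ip (T (f n)) (f n) \<le> 0)"
      unfolding INFM_disj_distrib[symmetric] by (auto simp: INFM_nat)
    \<comment> \<open>Only the absolute value of the form is known to approach \<open>m\<close>. One
      sign occurs infinitely often, and it becomes the sign of the eigenvalue
      \<open>l\<close>.\<close>
    then have "\<exists>\<sigma>\<in>{-1,1}. infinite {n. \<sigma> * ip (T (f n)) (f n) = \<bar>ip (T (f n)) (f n)\<bar>}"
    proof
      assume "\<exists>\<^sub>\<infinity>n. ip (T (f n)) (f n) \<ge> 0"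
      then show ?thesis by (intro bexI[of _ 1])
          (auto simp: frequently_cofinite elim!: contrapos_nn rev_finite_subset)
    next
      assume "\<exists>\<^sub>\<infinity>n. ip (T (f n)) (f n) \<le> 0"
      then show ?thesis by (intro bexI[of _ "-1"])
          (auto simp: frequently_cofinite elim!: contrapos_nn rev_finite_subset)
    qed
    then obtain \<sigma> :: real where \<sigma>: "\<sigma> \<in> {-1, 1}"
      "infinite {n. \<sigma> * ip (T (f n)) (f n) = \<bar>ip (T (f n)) (f n)\<bar>}" by blast
    obtain r0 :: "nat \<Rightarrow> nat" where r0: "strict_mono r0"
      "\<And>n. \<sigma> * ip (T (f (r0 n))) (f (r0 n)) = \<bar>ip (T (f (r0 n))) (f (r0 n))\<bar>"
      using infinite_enumerate[OF \<sigma>(2)] by auto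
    define l where "l = \<sigma> * m"
    have l: "\<bar>l\<bar> = m" "l * l = m * m" "l \<noteq> 0" using \<sigma>(1) m by (auto simp: l_def abs_mult)
    have "\<exists>g\<in>V. \<exists>r::nat \<Rightarrow> nat. strict_mono r \<and>
        (\<lambda>n. ip (T (f (r0 (r n))) - g) (T (f (r0 (r n))) - g)) \<longlonglongrightarrow> 0"
      using T_compact[of "\<lambda>n. f (r0 n)"] fV f(2) by simp
    then obtain g and r :: "nat \<Rightarrow> nat" where g: "g \<in> V" and r: "strict_mono r" and
      lim: "(\<lambda>n. ip (T (f (r0 (r n))) - g) (T (f (r0 (r n))) - g)) \<longlonglongrightarrow> 0" by blast
    define u where "u n = f (r0 (r n))" for n
    have uV: "u n \<in> V" and uW: "u n \<in> W" and u1: "ip (u n) (u n) \<le> 1" for n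
      using f fV by (auto simp: u_def)
    have lim': "(\<lambda>n. ip (T (u n) - g) (T (u n) - g)) \<longlonglongrightarrow> 0" using lim by (simp add: u_def)
    have mono: "n \<le> r0 (r n)" for n
      using r r0(1) by (meson le_trans seq_suble)
    have near: "\<sigma> * ip (T (u n)) (u n) > m - 1 / Suc n" for n
    proof -
      have "m - 1 / Suc n \<le> m - 1 / Suc (r0 (r n))" using mono[of n] by (simp add: frac_le)
      then show ?thesis using f(3)[of "r0 (r n)"] r0(2)[of "r n"] by (simp add: u_def)
    qed
    have "(\<lambda>n. ip (T (u n) - l *\<^sub>R u n) (T (u n) - l *\<^sub>R u n)) \<longlonglongrightarrow> 0"
    \<comment> \<open>Expanding the square gives at most
      \<open>m^2 - 2 m (m - 1/(n+1)) + m^2\<close>, because \<open>Tnorm\<close> bounds the first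
      term and near-maximality the middle one.\<close>
    proof (rule tendsto_sandwich[OF _ _ tendsto_const])
      show "\<forall>\<^sub>F n in sequentially. 0 \<le> ip (T (u n) - l *\<^sub>R u n) (T (u n) - l *\<^sub>R u n)"
        using uV by (auto intro!: always_eventually ip_nonneg)
      have "ip (T (u n) - l *\<^sub>R u n) (T (u n) - l *\<^sub>R u n) \<le> 2 * m * (1 / Suc n)" for n
      proof -
        have "ip (T (u n) - l *\<^sub>R u n) (T (u n) - l *\<^sub>R u n)
          = ip (T (u n)) (T (u n)) - 2 * l * ip (T (u n)) (u n) + (l * l) * ip (u n) (u n)"
          using uV T_in[OF uV] ip_commute[OF uV T_in[OF uV], of n n]
          by (simp add: ip_diff_left ip_diff_right ip_scale_left ip_scale_right algebra_simps)
        also have "\<dots> = ip (T (u n)) (T (u n)) - 2 * m * (\<sigma> * ip (T (u n)) (u n)) + m * m * ip (u n) (u n)"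
          unfolding l(2) by (simp add: l_def)
        also have "\<dots> \<le> m * m * 1 - 2 * m * (m - 1 / Suc n) + m * m * 1"
        proof -
          have "ip (T (u n)) (T (u n)) \<le> m * m * 1"
            using Tnorm[OF uW[of n]] mult_left_mono[OF u1[of n], of "m * m"] by (simp add: power2_eq_square)
          then show ?thesis
            using near[of n] m u1[of n] by (intro add_mono diff_mono mult_left_mono) auto
        qed
        finally show ?thesis by (simp add: algebra_simps)
      qed
      then show "\<forall>\<^sub>F n in sequentially. ip (T (u n) - l *\<^sub>R u n) (T (u n) - l *\<^sub>R u n) \<le> 2 * m * (1 / Suc n)"
        by (auto intro: always_eventually)
      show "(\<lambda>n. 2 * m * (1 / Suc n)) \<longlonglongrightarrow> 0"
        by (rule tendsto_mult_right_zero) (use LIMSEQ_inverse_real_of_nat in \<open>simp add: inverse_eq_divide\<close>)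
    qed
    note near0 = this
    have weak: "(\<lambda>n. ip (T (u n)) h) \<longlonglongrightarrow> ip g h" if "h \<in> V" for h
      using that g uV lim' by (intro ip_tendsto_left) auto
    have weak2: "(\<lambda>n. ip (T (u n) - l *\<^sub>R u n) h) \<longlonglongrightarrow> 0" if "h \<in> V" for h
      using ip_tendsto_left[of "\<lambda>n. T (u n) - l *\<^sub>R u n" 0 h] uV near0 that by auto
    have weak3: "(\<lambda>n. l * ip (u n) h) \<longlonglongrightarrow> ip g h" if "h \<in> V" for h
      using tendsto_diff[OF weak[OF that] weak2[OF that]] that uV
      by (simp add: ip_diff_left ip_scale_left)
    have gW: "g \<in> W"
    proof -
      have "ip s g = 0" if "s \<in> S" for s
      proof -
        have sV: "s \<in> V" using S that by auto
        have "ip (T (u n)) s = 0" for n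
          using W_T[OF uW[of n]] that sV by (auto simp: W_def ip_commute)
        then have "ip g s = 0" using weak[OF sV] by (simp add: LIMSEQ_const_iff)
        then show ?thesis using g sV by (simp add: ip_commute)
      qed
      then show ?thesis using g by (simp add: W_def)
    qed
    \<comment> \<open>Tested against a fixed \<open>h\<close>, \<open>l * ip (u n) (T h)\<close> has
      two limits: one from \<open>weak3\<close> at \<open>T h\<close>, the other after moving
      \<open>T\<close> back by symmetry.\<close>
    have eigg: "ip (T g - l *\<^sub>R g) (T g - l *\<^sub>R g) = 0"
    proof -
      have "ip (T g) h = l * ip g h" if h: "h \<in> V" for h
      proof (rule LIMSEQ_unique)
        show "(\<lambda>n. l * ip (u n) (T h)) \<longlonglongrightarrow> ip (T g) h"
          using weak3[of "T h"] h g by (simp add: T_symmetric)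
        have "(\<lambda>n. l * ip (T (u n)) h) \<longlonglongrightarrow> l * ip g h" by (intro tendsto_mult_left weak h)
        then show "(\<lambda>n. l * ip (u n) (T h)) \<longlonglongrightarrow> l * ip g h"
          using h uV by (simp add: T_symmetric)
      qed
      then show ?thesis using g by (simp add: ip_diff_left ip_scale_left)
    qed
    \<comment> \<open>A null limit would force \<open>T (u n)\<close> to tend to 0 in seminorm,
      although the form at the \<open>u n\<close> stays close to \<open>m > 0\<close> in absolute
      value.\<close>
    have gg: "ip g g \<noteq> 0"
    proof
      assume "ip g g = 0"
      then have "T g = 0" using T_null g by auto
      have lim0: "(\<lambda>n. ip (T (u n)) (T (u n))) \<longlonglongrightarrow> 0"
      proof -
        have "ip (T (u n) - g) (T (u n) - g) = ip (T (u n)) (T (u n))" for n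
          using g uV[of n] \<open>ip g g = 0\<close> ip_null[of g "T (u n)"] ip_commute[of g "T (u n)"]
          by (simp add: ip_diff_left ip_diff_right)
        then show ?thesis using lim' by simp
      qed
      have le: "(\<sigma> * ip (T (u n)) (u n))\<^sup>2 \<le> ip (T (u n)) (T (u n))" for n
      proof -
        have "(\<sigma> * ip (T (u n)) (u n))\<^sup>2 = (ip (T (u n)) (u n))\<^sup>2" using \<sigma>(1) by (auto simp: power_mult_distrib)
        also have "\<dots> \<le> ip (T (u n)) (T (u n)) * ip (u n) (u n)" using uV by (intro CS_ip) auto
        also have "\<dots> \<le> ip (T (u n)) (T (u n)) * 1" using u1[of n] uV by (intro mult_left_mono ip_nonneg) auto
        finally show ?thesis by simp
      qed
      have "(\<lambda>n. (\<sigma> * ip (T (u n)) (u n))\<^sup>2) \<longlonglongrightarrow> 0"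
        by (rule Lim_null_comparison[OF always_eventually lim0]) (simp only: real_norm_def abs_power2 le simp_thms)
      then have "(\<lambda>n. sqrt ((\<sigma> * ip (T (u n)) (u n))\<^sup>2)) \<longlonglongrightarrow> sqrt 0"
        by (rule tendsto_real_sqrt)
      then have s: "(\<lambda>n. \<bar>\<sigma> * ip (T (u n)) (u n)\<bar>) \<longlonglongrightarrow> 0" by simp
      have "(\<lambda>n. m - 1 / Suc n) \<longlonglongrightarrow> m - 0"
        by (intro tendsto_diff tendsto_const) (use LIMSEQ_inverse_real_of_nat in \<open>simp add: inverse_eq_divide\<close>)
      then have "m - 0 \<le> 0"
      proof (rule LIMSEQ_le[OF _ s])
        show "\<exists>N. \<forall>n\<ge>N. m - 1 / Suc n \<le> \<bar>\<sigma> * ip (T (u n)) (u n)\<bar>"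
          using near by (meson abs_ge_self less_imp_le order_trans)
      qed
      then show False using m by simp
    qed
    then have gpos: "0 < ip g g" using ip_nonneg[OF g] by simp
    \<comment> \<open>\<open>g\<close> satisfies the eigenvector equation only up to a null vector.
      By \<open>T_null\<close>, one application of \<open>T\<close> removes the defect, and dividing
      by \<open>l\<close> keeps the norm.\<close>
    define g' where "g' = (1 / l) *\<^sub>R T g"
    have g'W: "g' \<in> W" using gW W_T W_scale by (auto simp: g'_def)
    then have g'V: "g' \<in> V" using WV by auto
    have "T (T g - l *\<^sub>R g) = 0" using eigg g by (intro T_null) auto
    then have Tg': "T g' = l *\<^sub>R g'" using g l by (simp add: g'_def T_diff T_scale)
    have same: "ip g' g' = ip g g"
    proof -
      have dV: "T g - l *\<^sub>R g \<in> V" using g by auto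
      have "ip (T g) h = l * ip g h" if "h \<in> V" for h
        using ip_null[OF dV that eigg] g that by (simp add: ip_diff_left ip_scale_left)
      note eq = this
      have "ip (T g) (T g) = l * (l * ip g g)"
        using eq[of "T g"] eq[of g] g ip_commute[of g "T g"] by simp
      then show ?thesis using g l by (simp add: g'_def ip_scale_left ip_scale_right)
    qed
    define e where "e = (1 / sqrt (ip g g)) *\<^sub>R g'"
    have "e \<in> W" using W_scale g'W by (simp add: e_def)
    moreover have "T e = l *\<^sub>R e" using Tg' g'V by (simp add: e_def T_scale)
    moreover have "ip e e = 1" using g'V gpos same
      by (simp add: e_def ip_scale_left ip_scale_right)
    moreover have "\<bar>ip (T h) h\<bar> \<le> \<bar>l\<bar> * ip h h" if "h \<in> V" "\<forall>s\<in>S. ip s h = 0" for h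
      using mbound[of h] that l by (auto simp: W_def)
    ultimately show ?thesis using l(3) by (intro exI[of _ e] exI[of _ l]) (auto simp: W_def)
  qed
qed

text \<open>Extremality of the n-th choice bounds the form of the part of \<open>f\<close>
  orthogonal to the first n eigenvectors by \<open>\<bar>l n\<bar> * ip f f\<close>, and the trace
  bound sends \<open>l n\<close> to 0; this yields the expansion. Completeness of the family is
  neither claimed nor true, as the kernel of \<open>T\<close> is left out. Entries with
  \<open>l k = 0\<close> are padding with \<open>e k = 0\<close>, hence the proviso in the
  orthonormality relation.\<close>

theorem spectral:
  obtains e :: "nat \<Rightarrow> 'v" and l :: "nat \<Rightarrow> real"
  where "\<And>k. e k \<in> V" and "\<And>k. T (e k) = l k *\<^sub>R e k"
    and "\<And>j k. ip (e j) (e k) = (if j = k \<and> l j \<noteq> 0 then 1 else 0)"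
    and "summable (\<lambda>k. \<bar>l k\<bar>)"
    and "\<And>f. f \<in> V \<Longrightarrow> (\<lambda>k. l k * (ip (e k) f)\<^sup>2) sums ip (T f) f"
proof -
  define P where "P w n x \<longleftrightarrow> fst x \<in> V \<and> (\<forall>i<n. ip (fst (w i)) (fst x) = 0) \<and>
      T (fst x) = snd x *\<^sub>R fst x \<and> (if snd x = 0 then fst x = 0 else ip (fst x) (fst x) = 1) \<and>
      (\<forall>f\<in>V. (\<forall>i<n. ip (fst (w i)) f = 0) \<longrightarrow> \<bar>ip (T f) f\<bar> \<le> \<bar>snd x\<bar> * ip f f)"
    for w :: "nat \<Rightarrow> 'v \<times> real" and n x
  have "\<exists>w. \<forall>n. P w n (w n)"
  proof (rule dependent_wellorder_choice)
    fix r :: "'v \<times> real" and f g :: "nat \<Rightarrow> 'v \<times> real" and x :: nat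
    assume "\<And>y. y < x \<Longrightarrow> f y = g y"
    then show "P f x r = P g x r" by (auto simp: P_def)
  next
    fix n w assume IH: "\<And>i. i < n \<Longrightarrow> P w i (w i)"
    let ?S = "(\<lambda>i. fst (w i)) ` {..<n}"
    have "fst (w i) \<in> V" "T (fst (w i)) = snd (w i) *\<^sub>R fst (w i)" if "i < n" for i
      using IH[OF that] by (simp_all add: P_def)
    then have S: "?S \<subseteq> V" and eig: "\<And>s. s \<in> ?S \<Longrightarrow> \<exists>z. T s = z *\<^sub>R s"
      by auto
    obtain e l where "e \<in> V" "\<forall>s\<in>?S. ip s e = 0" "T e = l *\<^sub>R e"
      "if l = 0 then e = 0 else ip e e = 1"
      "\<forall>f\<in>V. (\<forall>s\<in>?S. ip s f = 0) \<longrightarrow> \<bar>ip (T f) f\<bar> \<le> \<bar>l\<bar> * ip f f"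
      using exists_extremal_eigenvector[OF S eig] by blast
    then show "\<exists>x. P w n x" unfolding P_def by (intro exI[of _ "(e, l)"]) simp
  qed
  then obtain w where w: "\<And>n. P w n (w n)" by blast
  define e l where "e n = fst (w n)" and "l n = snd (w n)" for n
  have eV: "e n \<in> V" and Te: "T (e n) = l n *\<^sub>R e n" and l0: "l n = 0 \<Longrightarrow> e n = 0"
    and l1: "l n \<noteq> 0 \<Longrightarrow> ip (e n) (e n) = 1"
    and ext: "\<And>f. f \<in> V \<Longrightarrow> \<forall>i<n. ip (e i) f = 0 \<Longrightarrow> \<bar>ip (T f) f\<bar> \<le> \<bar>l n\<bar> * ip f f" for n
    using w[of n] by (auto simp: P_def e_def l_def split: if_splits)
  have orth: "ip (e i) (e n) = 0" if "i < n" for i n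
    using w[of n] that by (auto simp: P_def e_def)
  have on: "ip (e j) (e k) = (if j = k \<and> l j \<noteq> 0 then 1 else 0)" for j k
    using orth[of j k] orth[of k j] ip_commute[OF eV eV, of j k] l0 l1 eV
    by (cases j k rule: linorder_cases) auto
  obtain C where C: "\<And>F::nat set. finite F \<Longrightarrow> \<forall>i\<in>F. \<forall>j\<in>F. ip (e i) (e j) = (if i = j then 1 else 0) \<Longrightarrow>
      (\<Sum>i\<in>F. \<bar>ip (T (e i)) (e i)\<bar>) \<le> C"
  proof -
    obtain C where *: "\<forall>F::nat set. \<forall>e. finite F \<longrightarrow> (\<forall>i\<in>F. e i \<in> V) \<longrightarrow>
      (\<forall>i\<in>F. \<forall>j\<in>F. ip (e i) (e j) = (if i = j then 1 else 0)) \<longrightarrow>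
      (\<Sum>i\<in>F. \<bar>ip (T (e i)) (e i)\<bar>) \<le> C" using T_trace by blast
    show thesis by (rule that[of C]) (use *[rule_format, of _ e] eV in auto)
  qed
  \<comment> \<open>The padding is discarded before the trace bound is applied, since zero vectors
    are not normalised.\<close>
  have "(\<Sum>i<n. \<bar>l i\<bar>) \<le> C" for n
  proof -
    have "(\<Sum>i<n. \<bar>l i\<bar>) = (\<Sum>i\<in>{i. i < n \<and> l i \<noteq> 0}. \<bar>l i\<bar>)"
      by (rule sum.mono_neutral_right) auto
    also have "\<dots> = (\<Sum>i\<in>{i. i < n \<and> l i \<noteq> 0}. \<bar>ip (T (e i)) (e i)\<bar>)"
      by (rule sum.cong) (auto simp: Te ip_scale_left eV on)
    also have "\<dots> \<le> C" by (rule C) (auto simp: on)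
    finally show ?thesis .
  qed
  then have sm: "summable (\<lambda>k. \<bar>l k\<bar>)" by (intro summableI_nonneg_bounded[where x = C]) auto
  have "(\<lambda>k. l k * (ip (e k) f)\<^sup>2) sums ip (T f) f" if f: "f \<in> V" for f
  proof -
    define c where "c i = ip (e i) f" for i
    define p where "p n = (\<Sum>i<n. c i *\<^sub>R e i)" for n
    have pV: "p n \<in> V" for n using eV by (auto simp: p_def)
    have c0: "c i = 0" if "l i = 0" for i using l0[OF that] f by (simp add: c_def)
    have ep: "ip (e i) (p n) = c i" if "i < n" for i n
      using that eV unfolding p_def
      by (simp add: ip_sum_right ip_scale_right on if_distrib c0 cong: if_cong)
         (cases "l i = 0", simp_all add: c0 if_distrib cong: if_cong)
    have pT: "T (p n) = (\<Sum>i<n. (c i * l i) *\<^sub>R e i)" for n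
      using eV by (simp add: p_def T_sum T_scale Te)
    \<comment> \<open>\<open>T (p n)\<close> is a combination of the first \<open>n\<close>
      eigenvectors, hence orthogonal to \<open>f - p n\<close>; so the form splits into the partial
      sum and the form of the remainder.\<close>
    have bound: "\<bar>ip (T f) f - (\<Sum>i<n. l i * (c i)\<^sup>2)\<bar> \<le> \<bar>l n\<bar> * ip f f" for n
    proof -
      have d: "f - p n \<in> V" using f pV by auto
      have ed: "ip (e i) (f - p n) = 0" if "i < n" for i
        using that f pV eV ep by (simp add: ip_diff_right c_def)
      have pd: "ip (p n) (f - p n) = 0"
        using d eV ed unfolding p_def[of n] by (subst ip_sum_left) (auto simp: ip_scale_left p_def)
      have "ip (f - p n) (f - p n) = ip f f - ip (p n) f - 0"
        using f pV pd d by (simp add: ip_diff_left ip_diff_right ip_commute)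
      also have "ip (p n) f = (\<Sum>i<n. (c i)\<^sup>2)"
        using eV f by (simp add: p_def ip_sum_left ip_scale_left c_def power2_eq_square)
      finally have n1: "ip (f - p n) (f - p n) \<le> ip f f" by (simp add: sum_nonneg)
      have "ip (T (p n)) (f - p n) = 0"
        using d eV ed by (simp add: pT ip_sum_left ip_scale_left)
      then have "ip (T (f - p n)) (f - p n) = ip (T f) (f - p n)"
        using f pV d by (simp add: T_diff ip_diff_left)
      also have "\<dots> = ip (T f) f - ip (p n) (T f)"
        using f pV d by (simp add: ip_diff_right ip_commute)
      also have "ip (p n) (T f) = ip (T (p n)) f" using f pV T_symmetric by auto
      also have "ip (T (p n)) f = (\<Sum>i<n. l i * (c i)\<^sup>2)"
        using eV f by (simp add: pT ip_sum_left ip_scale_left c_def power2_eq_square algebra_simps)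
      finally have n2: "ip (T (f - p n)) (f - p n) = ip (T f) f - (\<Sum>i<n. l i * (c i)\<^sup>2)" .
      have "\<bar>ip (T (f - p n)) (f - p n)\<bar> \<le> \<bar>l n\<bar> * ip (f - p n) (f - p n)"
        using ext[OF d] ed by blast
      also have "\<dots> \<le> \<bar>l n\<bar> * ip f f" using n1 by (intro mult_left_mono) auto
      finally show ?thesis using n2 by simp
    qed
    have "(\<lambda>n. \<bar>l n\<bar> * ip f f) \<longlonglongrightarrow> 0"
      using tendsto_mult_left_zero[OF summable_LIMSEQ_zero[OF sm]] by simp
    then have "(\<lambda>n. ip (T f) f - (\<Sum>i<n. l i * (c i)\<^sup>2)) \<longlonglongrightarrow> 0"
      by (rule Lim_null_comparison[rotated]) (use bound in auto)
    then have "(\<lambda>n. (\<Sum>i<n. l i * (c i)\<^sup>2)) \<longlonglongrightarrow> ip (T f) f"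
      using tendsto_diff[OF tendsto_const[of "ip (T f) f"]] by fastforce
    then show ?thesis by (simp add: sums_def c_def)
  qed
  then show ?thesis using that[of e l] eV Te on sm by blast
qed

end

section \<open>Square integrable functions and factored kernels\<close>

text \<open>Pointwise scaling makes plain functions the vectors of the abstract theory, matching the
  eigenspace definitions, which evaluate functions at points.\<close>

instantiation "fun" :: (type, real_vector) real_vector
begin

definition scaleR_fun :: "real \<Rightarrow> ('a \<Rightarrow> 'b) \<Rightarrow> 'a \<Rightarrow> 'b" where
  "scaleR_fun r f = (\<lambda>x. r *\<^sub>R f x)"

instance
  by standard (auto simp: scaleR_fun_def fun_eq_iff scaleR_add_left scaleR_add_right)

end

lemma scaleR_fun_apply [simp]: "(r *\<^sub>R f) x = r *\<^sub>R f x"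
  by (simp add: scaleR_fun_def)

lemma sum_fun_apply [simp]: "(sum f A) x = (\<Sum>i\<in>A. f i x)"
  by (induction A rule: infinite_finite_induct) auto

definition real_L2 :: "'b measure \<Rightarrow> ('b \<Rightarrow> real) set" where
  "real_L2 \<mu> = {f. f \<in> borel_measurable \<mu> \<and> integrable \<mu> (\<lambda>\<eta>. (f \<eta>)\<^sup>2)}"

definition real_ip :: "'b measure \<Rightarrow> ('b \<Rightarrow> real) \<Rightarrow> ('b \<Rightarrow> real) \<Rightarrow> real" where
  "real_ip \<mu> f g = (\<integral>\<eta>. f \<eta> * g \<eta> \<partial>\<mu>)"

lemma real_L2_measurable [measurable_dest]: "f \<in> real_L2 \<mu> \<Longrightarrow> f \<in> borel_measurable \<mu>"
  by (simp add: real_L2_def)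

lemma abs_mult_le_squares: "\<bar>u * v\<bar> \<le> u\<^sup>2 + v\<^sup>2" for u v :: real
proof -
  have "0 \<le> (\<bar>u\<bar> - \<bar>v\<bar>)\<^sup>2" by simp
  then have "2 * (\<bar>u\<bar> * \<bar>v\<bar>) \<le> u\<^sup>2 + v\<^sup>2" by (simp add: power2_diff)
  moreover have "0 \<le> \<bar>u\<bar> * \<bar>v\<bar>" by simp
  ultimately show ?thesis unfolding abs_mult by linarith
qed

lemma integrable_mult_real_L2:
  assumes "f \<in> real_L2 \<mu>" "g \<in> real_L2 \<mu>"
  shows "integrable \<mu> (\<lambda>\<eta>. f \<eta> * g \<eta>)"
proof (rule Bochner_Integration.integrable_bound[of _ "\<lambda>\<eta>. (f \<eta>)\<^sup>2 + (g \<eta>)\<^sup>2"])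
  show "integrable \<mu> (\<lambda>\<eta>. (f \<eta>)\<^sup>2 + (g \<eta>)\<^sup>2)" using assms by (auto simp: real_L2_def)
  show "(\<lambda>\<eta>. f \<eta> * g \<eta>) \<in> borel_measurable \<mu>" using assms by measurable
  show "AE \<eta> in \<mu>. norm (f \<eta> * g \<eta>) \<le> norm ((f \<eta>)\<^sup>2 + (g \<eta>)\<^sup>2)"
    using abs_mult_le_squares by simp
qed

lemma subspace_real_L2: "subspace (real_L2 \<mu>)"
proof -
  have "f + g \<in> real_L2 \<mu>" if "f \<in> real_L2 \<mu>" "g \<in> real_L2 \<mu>" for f g
  proof -
    have "integrable \<mu> (\<lambda>\<eta>. (f \<eta>)\<^sup>2 + 2 * (f \<eta> * g \<eta>) + (g \<eta>)\<^sup>2)"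
      using that integrable_mult_real_L2[OF that] by (auto simp: real_L2_def)
    moreover have "(\<lambda>\<eta>. f \<eta> + g \<eta>) \<in> borel_measurable \<mu>" using that by measurable
    ultimately show ?thesis
      by (simp add: real_L2_def plus_fun_def power2_sum mult.assoc add.assoc add.commute[of "(g _)\<^sup>2"])
  qed
  moreover have "r *\<^sub>R f \<in> real_L2 \<mu>" if "f \<in> real_L2 \<mu>" for r f
    using that by (auto simp: real_L2_def scaleR_fun_def power_mult_distrib)
  moreover have "0 \<in> real_L2 \<mu>" by (auto simp: real_L2_def zero_fun_def)
  ultimately show ?thesis by (auto simp: subspace_def)
qed

lemma semi_ip_real_L2: "semi_ip (real_L2 \<mu>) (real_ip \<mu>)"
proof
  show "subspace (real_L2 \<mu>)" by (rule subspace_real_L2)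
  show "real_ip \<mu> (f + g) h = real_ip \<mu> f h + real_ip \<mu> g h"
    if "f \<in> real_L2 \<mu>" "g \<in> real_L2 \<mu>" "h \<in> real_L2 \<mu>" for f g h
    using that by (simp add: real_ip_def distrib_right integrable_mult_real_L2)
  show "real_ip \<mu> (r *\<^sub>R f) g = r * real_ip \<mu> f g" for r f g
    by (simp add: real_ip_def mult.assoc)
  show "real_ip \<mu> f g = real_ip \<mu> g f" for f g by (simp add: real_ip_def mult.commute)
  show "0 \<le> real_ip \<mu> f f" for f by (simp add: real_ip_def)
qed

lemma bounded_in_real_L2:
  assumes "finite_measure \<mu>" "f \<in> borel_measurable \<mu>" "\<And>\<eta>. \<eta> \<in> space \<mu> \<Longrightarrow> \<bar>f \<eta>\<bar> \<le> B"
  shows "f \<in> real_L2 \<mu>"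
proof -
  have "(f \<eta>)\<^sup>2 \<le> B\<^sup>2" if "\<eta> \<in> space \<mu>" for \<eta>
    using assms(3)[OF that] by (simp add: abs_le_square_iff[symmetric])
  then have "integrable \<mu> (\<lambda>\<eta>. (f \<eta>)\<^sup>2)"
    using assms by (intro finite_measure.integrable_const_bound[of _ _ "B\<^sup>2"]) auto
  then show ?thesis using assms by (simp add: real_L2_def)
qed

lemma real_ip_le_bound:
  assumes "finite_measure \<mu>" "f \<in> borel_measurable \<mu>" "\<And>\<eta>. \<eta> \<in> space \<mu> \<Longrightarrow> \<bar>f \<eta>\<bar> \<le> B"
  shows "real_ip \<mu> f f \<le> B\<^sup>2 * measure \<mu> (space \<mu>)"
proof -
  have "(f \<eta>)\<^sup>2 \<le> B\<^sup>2" if "\<eta> \<in> space \<mu>" for \<eta>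
    using assms(3)[OF that] by (simp add: abs_le_square_iff[symmetric])
  then have "(\<integral>\<eta>. (f \<eta>)\<^sup>2 \<partial>\<mu>) \<le> (\<integral>\<eta>. B\<^sup>2 \<partial>\<mu>)"
    using bounded_in_real_L2[OF assms] assms(1)
    by (intro integral_mono) (auto simp: real_L2_def finite_measure.integrable_const)
  then show ?thesis by (simp add: real_ip_def power2_eq_square mult.commute)
qed

text \<open>The integrand is dominated by a multiple of \<open>u y * f \<eta>\<close>, which is
  integrable on the product. The exchange is what makes \<open>adj\<close> adjoint to
  \<open>obs\<close>.\<close>

lemma Fubini_bounded_kernel:
  fixes H :: "'y \<Rightarrow> 'b \<Rightarrow> real"
  assumes \<nu>: "finite_measure \<nu>" and \<mu>: "finite_measure \<mu>"
    and H: "case_prod H \<in> borel_measurable (\<nu> \<Otimes>\<^sub>M \<mu>)"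
    and bound: "\<And>y \<eta>. y \<in> space \<nu> \<Longrightarrow> \<eta> \<in> space \<mu> \<Longrightarrow> \<bar>H y \<eta>\<bar> \<le> B"
    and u: "integrable \<nu> u" and f: "integrable \<mu> f"
  shows "(\<integral>y. u y * (\<integral>\<eta>. H y \<eta> * f \<eta> \<partial>\<mu>) \<partial>\<nu>) = (\<integral>\<eta>. f \<eta> * (\<integral>y. H y \<eta> * u y \<partial>\<nu>) \<partial>\<mu>)"
proof -
  interpret \<nu>: finite_measure \<nu> by fact
  interpret \<mu>: finite_measure \<mu> by fact
  interpret pair_sigma_finite \<nu> \<mu> ..
  note [measurable] = H borel_measurable_integrable[OF u] borel_measurable_integrable[OF f]
  have uf: "integrable (\<nu> \<Otimes>\<^sub>M \<mu>) (\<lambda>(y, \<eta>). u y * f \<eta>)"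
  proof (rule Fubini_integrable)
    show "integrable \<nu> (\<lambda>y. \<integral>\<eta>. norm (case (y, \<eta>) of (y, \<eta>) \<Rightarrow> u y * f \<eta>) \<partial>\<mu>)"
      using u by (simp add: abs_mult)
    show "AE y in \<nu>. integrable \<mu> (\<lambda>\<eta>. case (y, \<eta>) of (y, \<eta>) \<Rightarrow> u y * f \<eta>)"
      using f by simp
  qed measurable
  have int: "integrable (\<nu> \<Otimes>\<^sub>M \<mu>) (\<lambda>(y, \<eta>). u y * (H y \<eta> * f \<eta>))"
  proof (rule Bochner_Integration.integrable_bound[of _ "\<lambda>z. B * (case z of (y, \<eta>) \<Rightarrow> u y * f \<eta>)"])
    show "integrable (\<nu> \<Otimes>\<^sub>M \<mu>) (\<lambda>z. B * (case z of (y, \<eta>) \<Rightarrow> u y * f \<eta>))"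
      using uf by simp
    have "norm (u y * (H y \<eta> * f \<eta>)) \<le> norm (B * (u y * f \<eta>))"
      if "y \<in> space \<nu>" "\<eta> \<in> space \<mu>" for y \<eta>
    proof -
      have "\<bar>H y \<eta>\<bar> \<le> \<bar>B\<bar>" using bound[OF that] by simp
      then have "\<bar>H y \<eta>\<bar> * \<bar>u y * f \<eta>\<bar> \<le> \<bar>B\<bar> * \<bar>u y * f \<eta>\<bar>" by (rule mult_right_mono) simp
      then show ?thesis by (simp add: abs_mult ac_simps)
    qed
    then show "AE z in \<nu> \<Otimes>\<^sub>M \<mu>. norm (case z of (y, \<eta>) \<Rightarrow> u y * (H y \<eta> * f \<eta>))
      \<le> norm (B * (case z of (y, \<eta>) \<Rightarrow> u y * f \<eta>))"
      by (auto simp: space_pair_measure)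
  qed measurable
  have "(\<integral>y. u y * (\<integral>\<eta>. H y \<eta> * f \<eta> \<partial>\<mu>) \<partial>\<nu>) = (\<integral>y. (\<integral>\<eta>. u y * (H y \<eta> * f \<eta>) \<partial>\<mu>) \<partial>\<nu>)"
    by simp
  also have "\<dots> = (\<integral>\<eta>. (\<integral>y. u y * (H y \<eta> * f \<eta>) \<partial>\<nu>) \<partial>\<mu>)"
    using Fubini_integral[OF int] by simp
  also have "\<dots> = (\<integral>\<eta>. f \<eta> * (\<integral>y. H y \<eta> * u y \<partial>\<nu>) \<partial>\<mu>)"
    by (simp flip: integral_mult_right_zero add: ac_simps)
  finally show ?thesis .
qed

text \<open>Kernels of the form \<open>\<integral> h y \<xi> h y \<eta> dy - \<langle>G k(\<xi>), k(\<eta>)\<rangle>\<close>: the factor through \<open>y\<close> makes the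
  integral operator trace class, by Bessel's inequality for each \<open>h y\<close>.\<close>

locale factored_kernel =
  fixes \<mu> :: "'b measure" and x :: real and h :: "real \<Rightarrow> 'b \<Rightarrow> real"
    and k :: "'n::finite \<Rightarrow> 'b \<Rightarrow> real" and G :: "real^'n^'n" and B :: real
  assumes finite_mu: "finite_measure \<mu>" and x_nonneg: "0 \<le> x"
    and h_measurable: "case_prod h \<in> borel_measurable (restrict_space lborel {0..x} \<Otimes>\<^sub>M \<mu>)"
    and h_bound: "\<And>y \<eta>. y \<in> {0..x} \<Longrightarrow> \<eta> \<in> space \<mu> \<Longrightarrow> \<bar>h y \<eta>\<bar> \<le> B"
    and k_measurable [measurable]: "\<And>i. k i \<in> borel_measurable \<mu>"
    and k_bound: "\<And>i \<eta>. \<eta> \<in> space \<mu> \<Longrightarrow> \<bar>k i \<eta>\<bar> \<le> B"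
    and G_symmetric: "\<And>i j. G $ i $ j = G $ j $ i"
    and h_continuous: "\<And>y e. y \<in> {0..x} \<Longrightarrow> 0 < e \<Longrightarrow>
      \<exists>d>0. \<forall>z\<in>{0..x}. \<bar>y - z\<bar> < d \<longrightarrow> real_ip \<mu> (h y - h z) (h y - h z) < e"
begin

abbreviation \<nu> :: "real measure" where "\<nu> \<equiv> restrict_space lborel {0..x}"

lemma space_nu [simp]: "space \<nu> = {0..x}"
  by (simp add: space_restrict_space)

lemma finite_nu: "finite_measure \<nu>"
  by (rule finite_measureI) (simp add: emeasure_restrict_space space_restrict_space emeasure_lborel_Icc_eq)

sublocale semi_ip "real_L2 \<mu>" "real_ip \<mu>"
  by (rule semi_ip_real_L2)

sublocale \<mu>: finite_measure \<mu> by (rule finite_mu)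
sublocale \<nu>: finite_measure \<nu> by (rule finite_nu)

definition obs :: "('b \<Rightarrow> real) \<Rightarrow> real \<Rightarrow> real" where "obs f y = real_ip \<mu> (h y) f"

definition obs_end :: "('b \<Rightarrow> real) \<Rightarrow> 'n \<Rightarrow> real" where "obs_end f i = real_ip \<mu> (k i) f"

text \<open>Up to the weight \<open>G\<close> on the end values, this is the adjoint of
  \<open>f \<mapsto> (obs f, obs_end f)\<close>. The value 0 off the space of the measure, where
  nothing is known about \<open>h\<close> and \<open>k\<close>, lets linearity and
  \<open>T f = 0\<close> hold as equalities of functions.\<close>

definition adj :: "(real \<Rightarrow> real) \<Rightarrow> ('n \<Rightarrow> real) \<Rightarrow> 'b \<Rightarrow> real" where
  "adj u w \<xi> = (if \<xi> \<in> space \<mu>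
     then (\<integral>y. h y \<xi> * u y \<partial>\<nu>) - (\<Sum>i\<in>UNIV. \<Sum>j\<in>UNIV. G $ i $ j * k i \<xi> * w j) else 0)"

definition T :: "('b \<Rightarrow> real) \<Rightarrow> 'b \<Rightarrow> real" where "T f = adj (obs f) (obs_end f)"

definition D :: real where "D = B\<^sup>2 * measure \<mu> (space \<mu>)"

lemma h_section [measurable]: "y \<in> {0..x} \<Longrightarrow> h y \<in> borel_measurable \<mu>"
  using measurable_Pair2[OF h_measurable, of y] by simp

lemma h_section' [measurable]: "\<xi> \<in> space \<mu> \<Longrightarrow> (\<lambda>y. h y \<xi>) \<in> borel_measurable \<nu>"
  using measurable_Pair1[OF h_measurable, of \<xi>] by simp

lemma h_in [simp, intro]: "y \<in> {0..x} \<Longrightarrow> h y \<in> real_L2 \<mu>"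
  using h_bound by (intro bounded_in_real_L2[OF finite_mu]) auto

lemma k_in [simp, intro]: "k i \<in> real_L2 \<mu>"
  using k_bound by (intro bounded_in_real_L2[OF finite_mu]) auto

lemma h_norm: "y \<in> {0..x} \<Longrightarrow> real_ip \<mu> (h y) (h y) \<le> D"
  using h_bound unfolding D_def by (intro real_ip_le_bound[OF finite_mu]) auto

lemma k_norm: "real_ip \<mu> (k i) (k i) \<le> D"
  using k_bound unfolding D_def by (intro real_ip_le_bound[OF finite_mu]) auto

lemma D_nonneg: "0 \<le> D" by (simp add: D_def)

lemma integrable_real_L2: "f \<in> real_L2 \<mu> \<Longrightarrow> integrable \<mu> f"
  using integrable_mult_real_L2[of f \<mu> "\<lambda>_. 1"] by (simp add: real_L2_def)

lemma obs_measurable: "f \<in> real_L2 \<mu> \<Longrightarrow> obs f \<in> borel_measurable \<nu>"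
proof -
  assume f: "f \<in> real_L2 \<mu>"
  note [measurable] = real_L2_measurable[OF f] h_measurable
  show ?thesis unfolding obs_def real_ip_def by measurable
qed

lemma obs_bound:
  assumes "f \<in> real_L2 \<mu>" "y \<in> {0..x}"
  shows "(obs f y)\<^sup>2 \<le> D * real_ip \<mu> f f"
  using CS_ip[of "h y" f] h_norm[of y] assms mult_right_mono[OF h_norm[of y], of "real_ip \<mu> f f"] ip_nonneg
  by (force simp: obs_def)

lemma obs_end_bound:
  assumes "f \<in> real_L2 \<mu>"
  shows "(obs_end f i)\<^sup>2 \<le> D * real_ip \<mu> f f"
  using CS_ip[of "k i" f] k_norm[of i] assms mult_right_mono[OF k_norm[of i], of "real_ip \<mu> f f"] ip_nonneg
  by (force simp: obs_end_def)

lemma obs_abs_bound: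
  assumes "f \<in> real_L2 \<mu>" "y \<in> {0..x}"
  shows "\<bar>obs f y\<bar> \<le> sqrt (D * real_ip \<mu> f f)"
  using obs_bound[OF assms] by (simp add: real_le_rsqrt)

lemma obs_end_abs_bound:
  assumes "f \<in> real_L2 \<mu>"
  shows "\<bar>obs_end f i\<bar> \<le> sqrt (D * real_ip \<mu> f f)"
  using obs_end_bound[OF assms] by (simp add: real_le_rsqrt)

lemma integrable_obs: "f \<in> real_L2 \<mu> \<Longrightarrow> integrable \<nu> (obs f)"
  using obs_measurable obs_abs_bound
  by (intro \<nu>.integrable_const_bound[of _ "sqrt (D * real_ip \<mu> f f)"]) auto

lemma integrable_h_mult:
  assumes "\<xi> \<in> space \<mu>" "integrable \<nu> u"
  shows "integrable \<nu> (\<lambda>y. h y \<xi> * u y)"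
proof (rule Bochner_Integration.integrable_bound[of _ "\<lambda>y. B * u y"])
  show "integrable \<nu> (\<lambda>y. B * u y)" using assms by simp
  show "(\<lambda>y. h y \<xi> * u y) \<in> borel_measurable \<nu>"
    using assms h_section' borel_measurable_integrable by (intro borel_measurable_times) auto
  have "norm (h y \<xi> * u y) \<le> norm (B * u y)" if "y \<in> {0..x}" for y
    using h_bound[OF that assms(1)] by (simp add: abs_mult mult_right_mono)
  then show "AE y in \<nu>. norm (h y \<xi> * u y) \<le> norm (B * u y)" by (auto intro!: AE_I2)
qed

lemma adj_measurable: "integrable \<nu> u \<Longrightarrow> adj u w \<in> borel_measurable \<mu>"
proof -
  assume u: "integrable \<nu> u"
  note [measurable] = borel_measurable_integrable[OF u]
  have [measurable]: "(\<lambda>(\<xi>, y). h y \<xi>) \<in> borel_measurable (\<mu> \<Otimes>\<^sub>M \<nu>)"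
    using measurable_compose[OF measurable_pair_swap' h_measurable] by (simp add: split_beta')
  have "(\<lambda>\<xi>. (\<integral>y. h y \<xi> * u y \<partial>\<nu>) - (\<Sum>i\<in>UNIV. \<Sum>j\<in>UNIV. G $ i $ j * k i \<xi> * w j)) \<in> borel_measurable \<mu>"
    by measurable
  then show ?thesis by (rule measurable_cong[THEN iffD1, rotated]) (simp add: adj_def)
qed

definition Gsum :: real where "Gsum = (\<Sum>i\<in>UNIV. \<Sum>j\<in>UNIV. \<bar>G $ i $ j\<bar>)"

text \<open>A supremum bound is the right one: the observations of an \<open>L2\<close> function are
  bounded pointwise, and those of a bounded sequence will converge uniformly. Finiteness of the
  measure then passes the bound to the seminorm.\<close>

lemma adj_bound:
  assumes u: "integrable \<nu> u" and ub: "\<And>y. y \<in> {0..x} \<Longrightarrow> \<bar>u y\<bar> \<le> e" and w: "\<And>j. \<bar>w j\<bar> \<le> e"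
  shows "\<bar>adj u w \<xi>\<bar> \<le> \<bar>B\<bar> * (x + Gsum) * e"
proof (cases "\<xi> \<in> space \<mu>")
  case True
  have e: "0 \<le> e" using ub[of 0] x_nonneg by auto
  have "\<bar>\<integral>y. h y \<xi> * u y \<partial>\<nu>\<bar> \<le> (\<integral>y. \<bar>B\<bar> * e \<partial>\<nu>)"
  proof (rule integral_abs_bound_integral)
    show "integrable \<nu> (\<lambda>y. h y \<xi> * u y)" using integrable_h_mult True u by blast
    show "\<bar>h y \<xi> * u y\<bar> \<le> \<bar>B\<bar> * e" if "y \<in> space \<nu>" for y
      using h_bound[of y \<xi>] ub[of y] that True unfolding abs_mult by (intro mult_mono) auto
  qed simp
  also have "\<dots> = \<bar>B\<bar> * x * e"
    using x_nonneg by (simp add: measure_restrict_space)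
  finally have 1: "\<bar>\<integral>y. h y \<xi> * u y \<partial>\<nu>\<bar> \<le> \<bar>B\<bar> * x * e" .
  have "\<bar>\<Sum>i\<in>UNIV. \<Sum>j\<in>UNIV. G $ i $ j * k i \<xi> * w j\<bar> \<le> (\<Sum>i\<in>UNIV. \<Sum>j\<in>UNIV. \<bar>G $ i $ j * k i \<xi> * w j\<bar>)"
    by (rule order_trans[OF sum_abs sum_mono[OF sum_abs]])
  also have "\<dots> \<le> (\<Sum>i\<in>UNIV. \<Sum>j\<in>UNIV. \<bar>G $ i $ j\<bar> * \<bar>B\<bar> * e)"
    unfolding abs_mult using k_bound[OF True] w e
    by (intro sum_mono mult_mono mult_left_mono) (auto intro: order_trans[OF _ abs_ge_self])
  also have "\<dots> = \<bar>B\<bar> * Gsum * e"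
    by (simp add: Gsum_def sum_distrib_right sum_distrib_left ac_simps)
  finally show ?thesis using 1 True by (simp add: adj_def algebra_simps)
next
  case False
  have e: "0 \<le> e" using ub[of 0] x_nonneg by auto
  then show ?thesis using False x_nonneg by (simp add: adj_def Gsum_def sum_nonneg)
qed

lemma adj_in:
  assumes u: "integrable \<nu> u" and ub: "\<And>y. y \<in> {0..x} \<Longrightarrow> \<bar>u y\<bar> \<le> e"
  shows "adj u w \<in> real_L2 \<mu>"
proof -
  define e' where "e' = max e (\<Sum>j\<in>UNIV. \<bar>w j\<bar>)"
  have "\<bar>w j\<bar> \<le> e'" for j
    using member_le_sum[of j UNIV "\<lambda>j. \<bar>w j\<bar>"] unfolding e'_def by auto
  moreover have "\<bar>u y\<bar> \<le> e'" if "y \<in> {0..x}" for y using ub[OF that] by (simp add: e'_def)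
  ultimately show ?thesis
    using adj_bound[OF u, of e' w] by (intro bounded_in_real_L2[OF finite_mu adj_measurable[OF u]]) auto
qed

lemma T_in_L2 [simp, intro]: "f \<in> real_L2 \<mu> \<Longrightarrow> T f \<in> real_L2 \<mu>"
  unfolding T_def using integrable_obs obs_abs_bound by (intro adj_in) auto

lemma adj_diff:
  assumes "integrable \<nu> u" "integrable \<nu> u'"
  shows "adj u w - adj u' w' = adj (\<lambda>y. u y - u' y) (\<lambda>j. w j - w' j)"
  using integrable_h_mult[OF _ assms(1)] integrable_h_mult[OF _ assms(2)]
  by (auto simp: fun_eq_iff adj_def right_diff_distrib sum_subtractf)

lemma ip_adj:
  assumes u: "integrable \<nu> u" and ub: "\<And>y. y \<in> {0..x} \<Longrightarrow> \<bar>u y\<bar> \<le> e" and f: "f \<in> real_L2 \<mu>"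
  shows "real_ip \<mu> (adj u w) f = (\<integral>y. u y * obs f y \<partial>\<nu>) - (\<Sum>i\<in>UNIV. \<Sum>j\<in>UNIV. G $ i $ j * obs_end f i * w j)"
proof -
  have [simp]: "integrable \<mu> (\<lambda>\<xi>. k i \<xi> * f \<xi>)" for i
    using f by (intro integrable_mult_real_L2) auto
  have ii: "integrable \<mu> (\<lambda>\<xi>. f \<xi> * (\<integral>y. h y \<xi> * u y \<partial>\<nu>))"
  proof -
    have "adj u (\<lambda>_. 0) \<in> real_L2 \<mu>" using adj_in u ub by blast
    then have "integrable \<mu> (\<lambda>\<xi>. f \<xi> * adj u (\<lambda>_. 0) \<xi>)" using f by (intro integrable_mult_real_L2)
    then show ?thesis by (rule Bochner_Integration.integrable_cong[THEN iffD1, rotated 2]) (auto simp: adj_def)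
  qed
  have "real_ip \<mu> (adj u w) f = (\<integral>\<xi>. f \<xi> * (\<integral>y. h y \<xi> * u y \<partial>\<nu>) - (\<Sum>i\<in>UNIV. \<Sum>j\<in>UNIV. (G $ i $ j * w j) * (k i \<xi> * f \<xi>)) \<partial>\<mu>)"
    unfolding real_ip_def
    by (rule Bochner_Integration.integral_cong)
      (auto simp: adj_def algebra_simps sum_distrib_left)
  also have "\<dots> = (\<integral>\<xi>. f \<xi> * (\<integral>y. h y \<xi> * u y \<partial>\<nu>) \<partial>\<mu>) - (\<Sum>i\<in>UNIV. \<Sum>j\<in>UNIV. (G $ i $ j * w j) * obs_end f i)"
    using ii by (simp add: obs_end_def real_ip_def)
  also have "(\<integral>\<xi>. f \<xi> * (\<integral>y. h y \<xi> * u y \<partial>\<nu>) \<partial>\<mu>) = (\<integral>y. u y * obs f y \<partial>\<nu>)"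
    unfolding obs_def real_ip_def
    using Fubini_bounded_kernel[OF finite_nu finite_mu h_measurable, of B u f] h_bound u integrable_real_L2[OF f]
    by simp
  finally show ?thesis by (simp add: ac_simps)
qed

text \<open>The right side is symmetric in \<open>f\<close> and \<open>g\<close> because
  \<open>G\<close> is; this is the form of the operator as a quadratic functional of the
  observations.\<close>

lemma ip_T:
  assumes "f \<in> real_L2 \<mu>" "g \<in> real_L2 \<mu>"
  shows "real_ip \<mu> (T f) g = (\<integral>y. obs f y * obs g y \<partial>\<nu>) - (\<Sum>i\<in>UNIV. \<Sum>j\<in>UNIV. G $ i $ j * obs_end f i * obs_end g j)"
proof -
  have "real_ip \<mu> (T f) g = (\<integral>y. obs f y * obs g y \<partial>\<nu>) - (\<Sum>i\<in>UNIV. \<Sum>j\<in>UNIV. G $ i $ j * obs_end g i * obs_end f j)"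
    unfolding T_def using assms integrable_obs obs_abs_bound by (intro ip_adj) auto
  also have "(\<Sum>i\<in>UNIV. \<Sum>j\<in>UNIV. G $ i $ j * obs_end g i * obs_end f j) = (\<Sum>i\<in>UNIV. \<Sum>j\<in>UNIV. G $ i $ j * obs_end f i * obs_end g j)"
    by (subst sum.swap) (simp add: G_symmetric[of _ _] ac_simps)
  finally show ?thesis .
qed

sublocale compact_symmetric "real_L2 \<mu>" "real_ip \<mu>" T
proof
  fix f g assume f: "f \<in> real_L2 \<mu>" and g: "g \<in> real_L2 \<mu>"
  have 1: "obs (f + g) y = obs f y + obs g y" if "y \<in> {0..x}" for y
    using f g that by (simp add: obs_def ip_add_right)
  have 2: "obs_end (f + g) i = obs_end f i + obs_end g i" for i
    using f g by (simp add: obs_end_def ip_add_right)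
  have "(\<integral>y. h y \<xi> * obs (f + g) y \<partial>\<nu>) = (\<integral>y. h y \<xi> * obs f y \<partial>\<nu>) + (\<integral>y. h y \<xi> * obs g y \<partial>\<nu>)"
    if "\<xi> \<in> space \<mu>" for \<xi>
  proof -
    have "(\<integral>y. h y \<xi> * obs (f + g) y \<partial>\<nu>) = (\<integral>y. h y \<xi> * obs f y + h y \<xi> * obs g y \<partial>\<nu>)"
      by (rule Bochner_Integration.integral_cong) (auto simp: 1 distrib_left)
    then show ?thesis using integrable_h_mult that f g integrable_obs by simp
  qed
  then show "T (f + g) = T f + T g"
    by (auto simp: fun_eq_iff T_def adj_def 2 distrib_left sum.distrib)
next
  fix r f assume f: "f \<in> real_L2 \<mu>"
  have 1: "obs (r *\<^sub>R f) y = r * obs f y" if "y \<in> {0..x}" for y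
    using f that by (simp add: obs_def ip_scale_right)
  have 2: "obs_end (r *\<^sub>R f) i = r * obs_end f i" for i
    using f by (simp add: obs_end_def ip_scale_right)
  have "(\<integral>y. h y \<xi> * obs (r *\<^sub>R f) y \<partial>\<nu>) = r * (\<integral>y. h y \<xi> * obs f y \<partial>\<nu>)" for \<xi>
  proof -
    have "(\<integral>y. h y \<xi> * obs (r *\<^sub>R f) y \<partial>\<nu>) = (\<integral>y. r * (h y \<xi> * obs f y) \<partial>\<nu>)"
      by (rule Bochner_Integration.integral_cong) (auto simp: 1)
    then show ?thesis by simp
  qed
  then show "T (r *\<^sub>R f) = r *\<^sub>R T f"
    by (auto simp: fun_eq_iff T_def adj_def 2 right_diff_distrib sum_distrib_left ac_simps)
next
  fix f g assume "f \<in> real_L2 \<mu>" and "g \<in> real_L2 \<mu>"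
  then show "real_ip \<mu> (T f) g = real_ip \<mu> f (T g)"
    using ip_T[of f g] ip_T[of g f] ip_commute[of f "T g"] sum.swap[of "\<lambda>i j. G $ i $ j * obs_end f i * obs_end g j"]
    by (simp add: ac_simps G_symmetric[of _ _])
next
  fix f assume f: "f \<in> real_L2 \<mu>" and 0: "real_ip \<mu> f f = 0"
  have "obs f y = 0" if "y \<in> {0..x}" for y using obs_bound[OF f that] 0 by simp
  moreover have "obs_end f i = 0" for i using obs_end_bound[OF f] 0 by simp
  moreover have "(\<integral>y. h y \<xi> * obs f y \<partial>\<nu>) = (\<integral>y. 0 \<partial>\<nu>)" for \<xi>
    by (rule Bochner_Integration.integral_cong) (auto simp: calculation)
  ultimately show "T f = 0" by (auto simp: T_def adj_def fun_eq_iff)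
next
  define C where "C = \<bar>B\<bar> * (x + Gsum)"
  show "\<exists>C. \<forall>f\<in>real_L2 \<mu>. real_ip \<mu> (T f) (T f) \<le> C * real_ip \<mu> f f"
  proof (intro exI ballI)
    fix f assume f: "f \<in> real_L2 \<mu>"
    have "\<bar>T f \<xi>\<bar> \<le> C * sqrt (D * real_ip \<mu> f f)" for \<xi>
      unfolding T_def C_def using f obs_abs_bound obs_end_abs_bound integrable_obs by (intro adj_bound) auto
    then have "real_ip \<mu> (T f) (T f) \<le> (C * sqrt (D * real_ip \<mu> f f))\<^sup>2 * measure \<mu> (space \<mu>)"
      using real_L2_measurable[OF T_in_L2[OF f]] by (intro real_ip_le_bound[OF finite_mu]) auto
    also have "\<dots> = (C\<^sup>2 * D * measure \<mu> (space \<mu>)) * real_ip \<mu> f f"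
      using D_nonneg ip_nonneg[OF f] by (simp add: power_mult_distrib)
    finally show "real_ip \<mu> (T f) (T f) \<le> (C\<^sup>2 * D * measure \<mu> (space \<mu>)) * real_ip \<mu> f f" .
  qed
next
  fix f :: "nat \<Rightarrow> 'b \<Rightarrow> real"
  assume fV: "\<And>n. f n \<in> real_L2 \<mu>" and f1: "\<And>n. real_ip \<mu> (f n) (f n) \<le> 1"
  \<comment> \<open>Both kinds of observation are bundled, the second one being constant in
    \<open>y\<close>, so that a single use of Arzela-Ascoli extracts a common subsequence.\<close>
  define F where "F n y = (obs (f n) y, \<chi> j. obs_end (f n) j)" for n y
  have sq: "sqrt (D * real_ip \<mu> (f n) (f n)) \<le> sqrt D" for n
    using mult_left_mono[OF f1 D_nonneg, of n] by simp
  have o1: "\<bar>obs (f n) y\<bar> \<le> sqrt D" if "y \<in> {0..x}" for n y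
    using obs_abs_bound[OF fV that, of n] sq[of n] by linarith
  have o2: "\<bar>obs_end (f n) j\<bar> \<le> sqrt D" for n j
    using obs_end_abs_bound[OF fV, of n j] sq[of n] by linarith
  have Fb: "norm (F n y) \<le> sqrt D + CARD('n) * sqrt D" if "y \<in> {0..x}" for n y
  proof -
    have "norm (F n y) \<le> norm (obs (f n) y) + norm (\<chi> j. obs_end (f n) j)"
      unfolding F_def by (rule norm_Pair_le)
    also have "norm (\<chi> j. obs_end (f n) j) \<le> (\<Sum>j\<in>UNIV. \<bar>obs_end (f n) j\<bar>)"
      using norm_le_l1_cart[of "\<chi> j. obs_end (f n) j"] by simp
    also have "\<dots> \<le> (\<Sum>j\<in>(UNIV::'n set). sqrt D)" by (intro sum_mono o2)
    finally show ?thesis using o1[OF that, of n] by simp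
  qed
  \<comment> \<open>Equicontinuity: Cauchy-Schwarz bounds the increment of \<open>obs (f n)\<close>
    by the distance of \<open>h y\<close> and \<open>h z\<close>, uniformly over the unit
    ball.\<close>
  have eq: "\<exists>d>0. \<forall>n z. z \<in> {0..x} \<and> norm (y - z) < d \<longrightarrow> norm (F n y - F n z) < e"
    if y: "y \<in> {0..x}" and e: "0 < e" for y e
  proof -
    obtain d where d: "d > 0" "\<And>z. z \<in> {0..x} \<Longrightarrow> \<bar>y - z\<bar> < d \<Longrightarrow> real_ip \<mu> (h y - h z) (h y - h z) < e\<^sup>2"
      using h_continuous[OF y, of "e\<^sup>2"] e by auto
    have "norm (F n y - F n z) < e" if z: "z \<in> {0..x}" "\<bar>y - z\<bar> < d" for n z
    proof -
      have hz: "h y - h z \<in> real_L2 \<mu>" using y z by auto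
      have "F n y - F n z = (real_ip \<mu> (h y - h z) (f n), 0)"
        using y z fV by (simp add: F_def obs_def ip_diff_left)
      then have "norm (F n y - F n z) = \<bar>real_ip \<mu> (h y - h z) (f n)\<bar>" by (simp add: norm_Pair)
      also have "\<dots>\<^sup>2 \<le> real_ip \<mu> (h y - h z) (h y - h z) * real_ip \<mu> (f n) (f n)"
        using CS_ip[OF hz fV] by simp
      also have "\<dots> \<le> real_ip \<mu> (h y - h z) (h y - h z) * 1"
        using f1 ip_nonneg[OF hz] by (intro mult_left_mono) auto
      also have "\<dots> < e\<^sup>2" using d(2)[OF z] by simp
      finally show ?thesis using e by (simp add: power2_less_imp_less)
    qed
    then show ?thesis using d(1) by (auto intro!: exI[of _ d])
  qed
  obtain g and r :: "nat \<Rightarrow> nat" where g: "continuous_on {0..x} g" and r: "strict_mono r" and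
    conv: "\<And>e. 0 < e \<Longrightarrow> \<exists>N. \<forall>n y. n \<ge> N \<and> y \<in> {0..x} \<longrightarrow> norm (F (r n) y - g y) < e"
    by (rule Arzela_Ascoli[OF compact_Icc Fb eq], assumption+, rule that)
  define u where "u y = fst (g y)" for y
  \<comment> \<open>The second component of every \<open>F n\<close> is constant in
    \<open>y\<close>, so its limit may be read off at 0.\<close>
  define w where "w j = snd (g 0) $ j" for j
  have uc: "continuous_on {0..x} u" unfolding u_def by (intro continuous_intros g)
  obtain ub where "\<forall>y\<in>{0..x}. \<bar>u y\<bar> \<le> ub"
    using compact_imp_bounded[OF compact_continuous_image[OF uc]] by (auto simp: bounded_iff)
  then have ub: "\<And>y. y \<in> {0..x} \<Longrightarrow> \<bar>u y\<bar> \<le> ub" by blast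
  have um: "u \<in> borel_measurable \<nu>"
    using borel_measurable_continuous_on_restrict[OF uc] by (simp cong: measurable_cong_sets)
  have ui: "integrable \<nu> u"
    using um ub by (intro \<nu>.integrable_const_bound[of _ ub]) auto
  define C where "C = \<bar>B\<bar> * (x + Gsum)"
  have C0: "0 \<le> C" using x_nonneg by (auto simp: C_def Gsum_def intro!: mult_nonneg_nonneg add_nonneg_nonneg sum_nonneg)
  have small: "\<exists>N. \<forall>n\<ge>N. real_ip \<mu> (T (f (r n)) - adj u w) (T (f (r n)) - adj u w) \<le> (C * e)\<^sup>2 * measure \<mu> (space \<mu>)"
    if e: "0 < e" for e
  proof -
    obtain N where N: "\<And>n y. n \<ge> N \<Longrightarrow> y \<in> {0..x} \<Longrightarrow> norm (F (r n) y - g y) < e" using conv[OF e] by blast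
    show ?thesis
    proof (intro exI[of _ N] allI impI)
      fix n assume n: "n \<ge> N"
      have "T (f (r n)) - adj u w = adj (\<lambda>y. obs (f (r n)) y - u y) (\<lambda>j. obs_end (f (r n)) j - w j)"
        unfolding T_def using fV integrable_obs ui by (intro adj_diff) auto
      moreover have "\<bar>adj (\<lambda>y. obs (f (r n)) y - u y) (\<lambda>j. obs_end (f (r n)) j - w j) \<xi>\<bar> \<le> C * e" for \<xi>
        unfolding C_def
      proof (rule adj_bound)
        show "integrable \<nu> (\<lambda>y. obs (f (r n)) y - u y)" using fV integrable_obs ui by auto
        show "\<bar>obs (f (r n)) y - u y\<bar> \<le> e" if "y \<in> {0..x}" for y
        proof -
          have "norm (fst (F (r n) y - g y)) \<le> norm (F (r n) y - g y)" by (metis norm_fst_le prod.collapse)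
          also have "\<dots> < e" using N[OF n that] .
          finally show ?thesis by (simp add: F_def u_def)
        qed
        show "\<bar>obs_end (f (r n)) j - w j\<bar> \<le> e" for j
        proof -
          have "\<bar>snd (F (r n) 0 - g 0) $ j\<bar> \<le> norm (snd (F (r n) 0 - g 0))" by (rule component_le_norm_cart)
          also have "\<dots> \<le> norm (F (r n) 0 - g 0)" by (metis norm_snd_le prod.collapse)
          also have "\<dots> < e" using N[OF n, of 0] x_nonneg by simp
          finally show ?thesis by (simp add: F_def w_def)
        qed
      qed
      moreover have "T (f (r n)) - adj u w \<in> real_L2 \<mu>" using fV adj_in[OF ui ub] by auto
      ultimately show "real_ip \<mu> (T (f (r n)) - adj u w) (T (f (r n)) - adj u w) \<le> (C * e)\<^sup>2 * measure \<mu> (space \<mu>)"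
        using real_L2_measurable by (intro real_ip_le_bound[OF finite_mu]) auto
    qed
  qed
  have "(\<lambda>n. real_ip \<mu> (T (f (r n)) - adj u w) (T (f (r n)) - adj u w)) \<longlonglongrightarrow> 0"
  proof (rule LIMSEQ_I)
    fix \<epsilon> :: real assume \<epsilon>: "0 < \<epsilon>"
    define m where "m = measure \<mu> (space \<mu>)"
    \<comment> \<open>Chosen to make the error at most half of the tolerance; the summand 1 keeps
      the denominator positive when \<open>C\<close> or the total mass is 0.\<close>
    define e where "e = sqrt (\<epsilon> / (2 * (C\<^sup>2 * m + 1)))"
    have den: "0 < C\<^sup>2 * m + 1" by (simp add: m_def add_nonneg_pos)
    have e: "0 < e" using \<epsilon> den by (simp add: e_def)
    have "(C * e)\<^sup>2 * m = \<epsilon> / 2 * ((C\<^sup>2 * m) / (C\<^sup>2 * m + 1))"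
      using \<epsilon> den by (simp add: e_def power_mult_distrib)
    also have "\<dots> \<le> \<epsilon> / 2 * 1" using \<epsilon> den by (intro mult_left_mono) (auto simp: m_def)
    finally have lt: "(C * e)\<^sup>2 * m < \<epsilon>" using \<epsilon> by simp
    obtain N where N: "\<And>n. n \<ge> N \<Longrightarrow> real_ip \<mu> (T (f (r n)) - adj u w) (T (f (r n)) - adj u w) \<le> (C * e)\<^sup>2 * m"
      using small[OF e] by (auto simp: m_def)
    show "\<exists>N. \<forall>n\<ge>N. norm (real_ip \<mu> (T (f (r n)) - adj u w) (T (f (r n)) - adj u w) - 0) < \<epsilon>"
      using N lt fV adj_in[OF ui ub] ip_nonneg
      by (intro exI[of _ N]) (auto intro: le_less_trans)
  qed
  then show "\<exists>g\<in>real_L2 \<mu>. \<exists>r::nat \<Rightarrow> nat. strict_mono r \<and> (\<lambda>n. real_ip \<mu> (T (f (r n)) - g) (T (f (r n)) - g)) \<longlonglongrightarrow> 0"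
    using adj_in[OF ui ub] r by blast
next
  show "\<exists>C. \<forall>F::nat set. \<forall>e. finite F \<longrightarrow> (\<forall>i\<in>F. e i \<in> real_L2 \<mu>) \<longrightarrow>
      (\<forall>i\<in>F. \<forall>j\<in>F. real_ip \<mu> (e i) (e j) = (if i = j then 1 else 0)) \<longrightarrow>
      (\<Sum>i\<in>F. \<bar>real_ip \<mu> (T (e i)) (e i)\<bar>) \<le> C"
  proof (intro exI allI impI)
    fix F :: "nat set" and e
    assume F: "finite F" and eV: "\<forall>i\<in>F. e i \<in> real_L2 \<mu>"
      and on: "\<forall>i\<in>F. \<forall>j\<in>F. real_ip \<mu> (e i) (e j) = (if i = j then 1 else 0)"
    have b: "(\<Sum>i\<in>F. (real_ip \<mu> (e i) f)\<^sup>2) \<le> real_ip \<mu> f f" if "f \<in> real_L2 \<mu>" for f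
      using F eV on that by (intro bessel) auto
    have b1: "(\<Sum>i\<in>F. (obs (e i) y)\<^sup>2) \<le> D" if "y \<in> {0..x}" for y
      using b[of "h y"] h_norm[OF that] that eV by (simp add: obs_def ip_commute cong: sum.cong)
    have b2: "(\<Sum>i\<in>F. (obs_end (e i) j)\<^sup>2) \<le> D" for j
      using b[of "k j"] k_norm[of j] eV by (simp add: obs_end_def ip_commute cong: sum.cong)
    have io: "integrable \<nu> (\<lambda>y. (obs (e i) y)\<^sup>2)" if "i \<in> F" for i
      using that eV obs_bound obs_measurable
      by (intro \<nu>.integrable_const_bound[of _ "D * real_ip \<mu> (e i) (e i)"]) auto
    have "(\<Sum>i\<in>F. \<bar>real_ip \<mu> (T (e i)) (e i)\<bar>) \<le> (\<Sum>i\<in>F. (\<integral>y. (obs (e i) y)\<^sup>2 \<partial>\<nu>) +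
        (\<Sum>a\<in>UNIV. \<Sum>b\<in>UNIV. \<bar>G $ a $ b\<bar> * ((obs_end (e i) a)\<^sup>2 + (obs_end (e i) b)\<^sup>2)))"
    proof (rule sum_mono)
      fix i assume i: "i \<in> F"
      have "\<bar>real_ip \<mu> (T (e i)) (e i)\<bar> \<le> \<bar>\<integral>y. (obs (e i) y)\<^sup>2 \<partial>\<nu>\<bar> + \<bar>\<Sum>a\<in>UNIV. \<Sum>b\<in>UNIV. G $ a $ b * obs_end (e i) a * obs_end (e i) b\<bar>"
      proof -
        have "real_ip \<mu> (T (e i)) (e i) = (\<integral>y. (obs (e i) y)\<^sup>2 \<partial>\<nu>) - (\<Sum>a\<in>UNIV. \<Sum>b\<in>UNIV. G $ a $ b * obs_end (e i) a * obs_end (e i) b)"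
          using i eV by (simp add: ip_T power2_eq_square)
        then show ?thesis by (simp only: abs_triangle_ineq4)
      qed
      also have "\<bar>\<integral>y. (obs (e i) y)\<^sup>2 \<partial>\<nu>\<bar> = (\<integral>y. (obs (e i) y)\<^sup>2 \<partial>\<nu>)" by simp
      also have "\<bar>\<Sum>a\<in>UNIV. \<Sum>b\<in>UNIV. G $ a $ b * obs_end (e i) a * obs_end (e i) b\<bar>
        \<le> (\<Sum>a\<in>UNIV. \<Sum>b\<in>UNIV. \<bar>G $ a $ b * obs_end (e i) a * obs_end (e i) b\<bar>)"
        by (rule order_trans[OF sum_abs sum_mono[OF sum_abs]])
      \<comment> \<open>Products of two different end observations are split into squares, to each
        of which Bessel's inequality applies.\<close>
      also have "\<dots> \<le> (\<Sum>a\<in>UNIV. \<Sum>b\<in>UNIV. \<bar>G $ a $ b\<bar> * ((obs_end (e i) a)\<^sup>2 + (obs_end (e i) b)\<^sup>2))"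
      proof (intro sum_mono)
        fix a b
        show "\<bar>G $ a $ b * obs_end (e i) a * obs_end (e i) b\<bar> \<le> \<bar>G $ a $ b\<bar> * ((obs_end (e i) a)\<^sup>2 + (obs_end (e i) b)\<^sup>2)"
          using abs_mult_le_squares
          by (simp add: abs_mult[of "G $ a $ b"] mult.assoc mult_left_mono)
      qed
      finally show "\<bar>real_ip \<mu> (T (e i)) (e i)\<bar> \<le> (\<integral>y. (obs (e i) y)\<^sup>2 \<partial>\<nu>) +
        (\<Sum>a\<in>UNIV. \<Sum>b\<in>UNIV. \<bar>G $ a $ b\<bar> * ((obs_end (e i) a)\<^sup>2 + (obs_end (e i) b)\<^sup>2))" by simp
    qed
    also have "\<dots> = (\<integral>y. (\<Sum>i\<in>F. (obs (e i) y)\<^sup>2) \<partial>\<nu>) +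
        (\<Sum>a\<in>UNIV. \<Sum>b\<in>UNIV. \<bar>G $ a $ b\<bar> * ((\<Sum>i\<in>F. (obs_end (e i) a)\<^sup>2) + (\<Sum>i\<in>F. (obs_end (e i) b)\<^sup>2)))"
    proof -
      have "(\<Sum>i\<in>F. \<Sum>a\<in>UNIV. \<Sum>b\<in>UNIV. \<bar>G $ a $ b\<bar> * ((obs_end (e i) a)\<^sup>2 + (obs_end (e i) b)\<^sup>2))
        = (\<Sum>a\<in>UNIV. \<Sum>i\<in>F. \<Sum>b\<in>UNIV. \<bar>G $ a $ b\<bar> * ((obs_end (e i) a)\<^sup>2 + (obs_end (e i) b)\<^sup>2))"
        by (rule sum.swap)
      also have "\<dots> = (\<Sum>a\<in>UNIV. \<Sum>b\<in>UNIV. \<Sum>i\<in>F. \<bar>G $ a $ b\<bar> * ((obs_end (e i) a)\<^sup>2 + (obs_end (e i) b)\<^sup>2))"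
        by (rule sum.cong[OF refl sum.swap])
      finally show ?thesis using io by (simp add: sum.distrib distrib_left sum_distrib_left)
    qed
    also have "\<dots> \<le> (\<integral>y. D \<partial>\<nu>) + (\<Sum>a\<in>UNIV. \<Sum>b\<in>UNIV. \<bar>G $ a $ b\<bar> * (D + D))"
      using io b1 b2 by (intro add_mono integral_mono sum_mono mult_left_mono) auto
    finally show "(\<Sum>i\<in>F. \<bar>real_ip \<mu> (T (e i)) (e i)\<bar>) \<le> (\<integral>y. D \<partial>\<nu>) + (\<Sum>a\<in>UNIV. \<Sum>b\<in>UNIV. \<bar>G $ a $ b\<bar> * (D + D))" .
  qed
qed auto

text \<open>The section of the kernel at \<open>\<xi>\<close> is itself an \<open>adj\<close> of
  bounded data, hence square integrable, and \<open>ip_adj\<close> evaluates its pairing with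
  \<open>f\<close>.\<close>

lemma T_eq_integral:
  assumes f: "f \<in> real_L2 \<mu>" and \<xi>: "\<xi> \<in> space \<mu>"
    and K: "\<And>\<eta>. \<eta> \<in> space \<mu> \<Longrightarrow> K \<eta> = (\<integral>y. h y \<xi> * h y \<eta> \<partial>\<nu>) - (\<Sum>i\<in>UNIV. \<Sum>j\<in>UNIV. G $ i $ j * k i \<xi> * k j \<eta>)"
  shows "integrable \<mu> (\<lambda>\<eta>. K \<eta> * f \<eta>)" and "(\<integral>\<eta>. K \<eta> * f \<eta> \<partial>\<mu>) = T f \<xi>"
proof -
  have hi: "integrable \<nu> (\<lambda>y. h y \<xi>)" using h_bound \<xi>
    by (intro \<nu>.integrable_const_bound[of _ B]) auto
  have hb: "\<bar>h y \<xi>\<bar> \<le> B" if "y \<in> {0..x}" for y using h_bound \<xi> that by auto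
  have K': "K \<eta> = adj (\<lambda>y. h y \<xi>) (\<lambda>i. k i \<xi>) \<eta>" if "\<eta> \<in> space \<mu>" for \<eta>
    using K[OF that] that sum.swap[of "\<lambda>i j. G $ i $ j * k i \<xi> * k j \<eta>" UNIV UNIV]
    by (simp add: adj_def ac_simps G_symmetric[of _ _])
  have "integrable \<mu> (\<lambda>\<eta>. adj (\<lambda>y. h y \<xi>) (\<lambda>i. k i \<xi>) \<eta> * f \<eta>)"
    using adj_in[OF hi hb] f by (intro integrable_mult_real_L2)
  then show "integrable \<mu> (\<lambda>\<eta>. K \<eta> * f \<eta>)"
    by (rule Bochner_Integration.integrable_cong[THEN iffD1, rotated 2]) (auto simp: K')
  have "(\<integral>\<eta>. K \<eta> * f \<eta> \<partial>\<mu>) = real_ip \<mu> (adj (\<lambda>y. h y \<xi>) (\<lambda>i. k i \<xi>)) f"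
    unfolding real_ip_def by (rule Bochner_Integration.integral_cong) (auto simp: K')
  also have "\<dots> = (\<integral>y. h y \<xi> * obs f y \<partial>\<nu>) - (\<Sum>i\<in>UNIV. \<Sum>j\<in>UNIV. G $ i $ j * obs_end f i * k j \<xi>)"
    using ip_adj[OF hi hb f] by simp
  also have "\<dots> = T f \<xi>"
    using \<xi> sum.swap[of "\<lambda>i j. G $ i $ j * obs_end f i * k j \<xi>" UNIV UNIV]
    by (simp add: T_def adj_def ac_simps G_symmetric[of _ _])
  finally show "(\<integral>\<eta>. K \<eta> * f \<eta> \<partial>\<mu>) = T f \<xi>" .
qed

end

section \<open>Eigenvalues and the Fredholm determinant\<close>

text \<open>Gaussian elimination: an equation with a nonzero coefficient eliminates the unknown
  \<open>p\<close>, and the induction hypothesis solves the remaining system.\<close>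

lemma exists_nontrivial_combination:
  fixes C :: "'i \<Rightarrow> 'j \<Rightarrow> complex"
  assumes "finite S" "finite I" "card S < card I"
  shows "\<exists>cf. (\<exists>i\<in>I. cf i \<noteq> 0) \<and> (\<forall>k\<in>S. (\<Sum>i\<in>I. cf i * C i k) = 0)"
  using assms
proof (induction S arbitrary: I C rule: finite_induct)
  case empty
  then obtain i where "i \<in> I" by fastforce
  then show ?case by (intro exI[of _ "\<lambda>_. 1"]) auto
next
  case (insert s S)
  show ?case
  proof (cases "\<forall>i\<in>I. C i s = 0")
    case True
    have "card S < card I" using insert by simp
    then obtain cf where "\<exists>i\<in>I. cf i \<noteq> 0" "\<forall>k\<in>S. (\<Sum>i\<in>I. cf i * C i k) = 0"
      using insert.IH[of I C] insert.prems by blast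
    then show ?thesis using True by (intro exI[of _ cf]) auto
  next
    case False
    then obtain p where p: "p \<in> I" "C p s \<noteq> 0" by blast
    have "card S < card (I - {p})" using insert p by simp
    then obtain cf where cf: "\<exists>i\<in>I - {p}. cf i \<noteq> 0"
      "\<forall>k\<in>S. (\<Sum>i\<in>I - {p}. cf i * (C i k - C i s / C p s * C p k)) = 0"
      using insert.IH[of "I - {p}" "\<lambda>i k. C i k - C i s / C p s * C p k"] insert.prems by blast
    \<comment> \<open>The value of the eliminated unknown that satisfies the pivot equation
      \<open>s\<close>.\<close>
    define t where "t = - (\<Sum>i\<in>I - {p}. cf i * C i s) / C p s"
    have split: "(\<Sum>i\<in>I. (cf(p := t)) i * C i k) = t * C p k + (\<Sum>i\<in>I - {p}. cf i * C i k)" for k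
    proof -
      have "(\<Sum>i\<in>I - {p}. (cf(p := t)) i * C i k) = (\<Sum>i\<in>I - {p}. cf i * C i k)"
        by (rule sum.cong) auto
      then show ?thesis using insert.prems p by (simp add: sum.remove[of I p])
    qed
    have "(\<Sum>i\<in>I. (cf(p := t)) i * C i k) = 0" if "k \<in> insert s S" for k
    proof (cases "k = s")
      case True
      then show ?thesis unfolding split using p by (simp add: t_def)
    next
      case False
      then have "(\<Sum>i\<in>I - {p}. cf i * (C i k - C i s / C p s * C p k)) = 0" using that cf by auto
      moreover have "(\<Sum>i\<in>I - {p}. cf i * (C i k - C i s / C p s * C p k))
        = (\<Sum>i\<in>I - {p}. cf i * C i k) - (\<Sum>i\<in>I - {p}. cf i * C i s) / C p s * C p k"
        by (simp add: right_diff_distrib sum_subtractf sum_distrib_right sum_divide_distrib mult.assoc)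
      ultimately show ?thesis unfolding split by (simp add: t_def)
    qed
    moreover have "\<exists>i\<in>I. (cf(p := t)) i \<noteq> 0" using cf(1) by auto
    ultimately show ?thesis by blast
  qed
qed

text \<open>The logarithm differs from its argument by at most \<open>2 * (l k)^2\<close>, which is
  below \<open>\<bar>l k\<bar>\<close> once \<open>\<bar>l k\<bar> < 1/2\<close>. Only a tail is
  estimated, so no sign condition on \<open>l\<close> appears.\<close>

lemma ln_one_plus_abs_summable:
  fixes l :: "nat \<Rightarrow> real"
  assumes "summable (\<lambda>k. \<bar>l k\<bar>)"
  shows "summable (\<lambda>k. \<bar>ln (1 + l k)\<bar>)"
proof (rule summable_comparison_test_ev)
  have "(\<lambda>k. \<bar>l k\<bar>) \<longlonglongrightarrow> 0" using assms by (rule summable_LIMSEQ_zero)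
  then have "\<forall>\<^sub>F k in sequentially. \<bar>l k\<bar> < 1/2" by (rule order_tendstoD) simp
  then show "\<forall>\<^sub>F k in sequentially. norm \<bar>ln (1 + l k)\<bar> \<le> 2 * \<bar>l k\<bar>"
  proof eventually_elim
    case (elim k)
    have "\<bar>ln (1 + l k) - l k\<bar> \<le> 2 * (l k)\<^sup>2" using elim by (intro abs_ln_one_plus_x_minus_x_bound) auto
    also have "(l k)\<^sup>2 \<le> \<bar>l k\<bar> * (1/2)"
      using elim mult_left_mono[of "\<bar>l k\<bar>" "1/2" "\<bar>l k\<bar>"] by (simp add: power2_eq_square flip: abs_mult)
    finally show ?case by simp
  qed
  show "summable (\<lambda>k. 2 * \<bar>l k\<bar>)" using assms by simp
qed

text \<open>A nonzero value of \<open>has_prod\<close> means that the partial products converge to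
  it; writing them as exponentials of partial sums makes the limit visibly nonzero.\<close>

lemma has_prod_one_plus:
  fixes l :: "nat \<Rightarrow> real"
  assumes "\<And>n. - 1 < l n" "(\<lambda>n. ln (1 + l n)) sums s"
  shows "(\<lambda>n. 1 + complex_of_real (l n)) has_prod complex_of_real (exp s)"
proof -
  have "(\<Prod>i\<le>n. 1 + complex_of_real (l i)) = complex_of_real (exp (\<Sum>i\<le>n. ln (1 + l i)))" for n
  proof -
    have "exp (\<Sum>i\<le>n. ln (1 + l i)) = (\<Prod>i\<le>n. 1 + l i)"
      using assms(1) by (simp add: exp_sum, intro prod.cong) (auto simp: minus_less_iff add_pos_pos intro!: exp_ln, smt (verit) assms(1))
    then show ?thesis by simp
  qed
  moreover have "(\<lambda>n. complex_of_real (exp (\<Sum>i\<le>n. ln (1 + l i)))) \<longlonglongrightarrow> complex_of_real (exp s)"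
    using assms(2) by (intro tendsto_of_real tendsto_exp) (simp add: sums_def_le)
  ultimately show ?thesis by (simp add: has_prod_def raw_has_prod_def)
qed

locale spectral_family = compact_symmetric "real_L2 \<mu>" "real_ip \<mu>" T
  for \<mu> :: "'b measure" and T +
  fixes K :: "'b \<Rightarrow> 'b \<Rightarrow> real" and e :: "nat \<Rightarrow> 'b \<Rightarrow> real" and l :: "nat \<Rightarrow> real"
  assumes kernel: "\<And>f \<xi>. f \<in> real_L2 \<mu> \<Longrightarrow> \<xi> \<in> space \<mu> \<Longrightarrow> integrable \<mu> (\<lambda>\<eta>. K \<xi> \<eta> * f \<eta>)"
    "\<And>f \<xi>. f \<in> real_L2 \<mu> \<Longrightarrow> \<xi> \<in> space \<mu> \<Longrightarrow> (\<integral>\<eta>. K \<xi> \<eta> * f \<eta> \<partial>\<mu>) = T f \<xi>"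
    and e_in [simp, intro]: "\<And>k. e k \<in> real_L2 \<mu>"
    and T_e: "\<And>k. T (e k) = l k *\<^sub>R e k"
    and orthonormal: "\<And>j k. real_ip \<mu> (e j) (e k) = (if j = k \<and> l j \<noteq> 0 then 1 else 0)"
    and summable_l: "summable (\<lambda>k. \<bar>l k\<bar>)"
    and expansion: "\<And>f. f \<in> real_L2 \<mu> \<Longrightarrow> (\<lambda>k. l k * (real_ip \<mu> (e k) f)\<^sup>2) sums real_ip \<mu> (T f) f"
begin

section \<open>Complex generalized eigenfunctions reduced to real eigenfunctions\<close>

definition null :: "('b \<Rightarrow> real) \<Rightarrow> bool" where "null f \<longleftrightarrow> f \<in> real_L2 \<mu> \<and> real_ip \<mu> f f = 0"

lemma null_iff_AE: "f \<in> real_L2 \<mu> \<Longrightarrow> null f \<longleftrightarrow> (AE \<eta> in \<mu>. f \<eta> = 0)"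
  unfolding null_def real_ip_def using integral_nonneg_eq_0_iff_AE[of \<mu> "\<lambda>\<eta>. f \<eta> * f \<eta>"]
  by (simp add: integrable_mult_real_L2)

lemma null_ip: "null f \<Longrightarrow> g \<in> real_L2 \<mu> \<Longrightarrow> real_ip \<mu> f g = 0" "null f \<Longrightarrow> g \<in> real_L2 \<mu> \<Longrightarrow> real_ip \<mu> g f = 0"
  using ip_null[of f g] ip_commute[of f g] by (auto simp: null_def)

lemma null_I: "f \<in> real_L2 \<mu> \<Longrightarrow> (\<And>g. g \<in> real_L2 \<mu> \<Longrightarrow> real_ip \<mu> f g = 0) \<Longrightarrow> null f"
  by (simp add: null_def)

definition shift :: "complex \<Rightarrow> ('b \<Rightarrow> complex) \<Rightarrow> 'b \<Rightarrow> complex" where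
  "shift z \<psi> = (\<lambda>\<xi>. int_op \<mu> K \<psi> \<xi> - z * \<psi> \<xi>)"

text \<open>Real and imaginary parts bring complex functions within reach of the real spectral
  theorem. Agreement is asked only on the space of the measure, where \<open>kernel\<close> controls
  the operator.\<close>

definition rep :: "('b \<Rightarrow> complex) \<Rightarrow> ('b \<Rightarrow> real) \<Rightarrow> ('b \<Rightarrow> real) \<Rightarrow> bool" where
  "rep \<psi> f g \<longleftrightarrow> f \<in> real_L2 \<mu> \<and> g \<in> real_L2 \<mu> \<and> (\<forall>\<xi>\<in>space \<mu>. \<psi> \<xi> = Complex (f \<xi>) (g \<xi>))"

lemma rep_L2: "\<psi> \<in> L2 \<mu> \<Longrightarrow> rep \<psi> (\<lambda>\<xi>. Re (\<psi> \<xi>)) (\<lambda>\<xi>. Im (\<psi> \<xi>))"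
proof -
  assume *: "\<psi> \<in> L2 \<mu>"
  then have [measurable]: "\<psi> \<in> borel_measurable \<mu>" by (simp add: L2_def)
  have i: "integrable \<mu> (\<lambda>\<eta>. (cmod (\<psi> \<eta>))\<^sup>2)" using * by (simp add: L2_def)
  have "integrable \<mu> (\<lambda>\<xi>. (Re (\<psi> \<xi>))\<^sup>2)" "integrable \<mu> (\<lambda>\<xi>. (Im (\<psi> \<xi>))\<^sup>2)"
    by (rule Bochner_Integration.integrable_bound[OF i]; simp add: cmod_power2)+
  then show ?thesis by (simp add: rep_def real_L2_def)
qed

lemma rep_AE: "rep \<psi> f g \<Longrightarrow> (AE \<eta> in \<mu>. \<psi> \<eta> = 0) \<longleftrightarrow> null f \<and> null g"
proof -
  assume r: "rep \<psi> f g"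
  then have "(AE \<eta> in \<mu>. \<psi> \<eta> = 0) \<longleftrightarrow> (AE \<eta> in \<mu>. f \<eta> = 0 \<and> g \<eta> = 0)"
    by (intro AE_cong) (simp add: rep_def complex_eq_iff)
  then show ?thesis using r null_iff_AE by (simp add: rep_def)
qed

lemma rep_shift:
  assumes "rep \<psi> f g"
  shows "rep (shift z \<psi>) (T f - Re z *\<^sub>R f + Im z *\<^sub>R g) (T g - Re z *\<^sub>R g - Im z *\<^sub>R f)"
proof -
  have f: "f \<in> real_L2 \<mu>" and g: "g \<in> real_L2 \<mu>" using assms by (auto simp: rep_def)
  have "int_op \<mu> K \<psi> \<xi> = Complex (T f \<xi>) (T g \<xi>)" if \<xi>: "\<xi> \<in> space \<mu>" for \<xi>
  proof -
    have "int_op \<mu> K \<psi> \<xi> = (\<integral>\<eta>. complex_of_real (K \<xi> \<eta> * f \<eta>) + \<i> * complex_of_real (K \<xi> \<eta> * g \<eta>) \<partial>\<mu>)"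
      unfolding int_op_def using assms
      by (intro Bochner_Integration.integral_cong) (auto simp: rep_def complex_eq_iff)
    also have "\<dots> = (\<integral>\<eta>. complex_of_real (K \<xi> \<eta> * f \<eta>) \<partial>\<mu>) + (\<integral>\<eta>. \<i> * complex_of_real (K \<xi> \<eta> * g \<eta>) \<partial>\<mu>)"
      using kernel(1)[OF f \<xi>] kernel(1)[OF g \<xi>]
      by (intro Bochner_Integration.integral_add integrable_mult_right integrable_of_real) auto
    also have "\<dots> = complex_of_real (T f \<xi>) + \<i> * complex_of_real (T g \<xi>)"
      using kernel(2)[OF f \<xi>] kernel(2)[OF g \<xi>] by (simp only: integral_mult_right_zero integral_complex_of_real)
    finally show ?thesis by (simp add: complex_eq_iff)
  qed
  then show ?thesis using assms f g by (auto simp: rep_def shift_def complex_eq_iff)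
qed

lemma null_shift:
  assumes "null f" "null g"
  shows "null (T f - a *\<^sub>R f + b *\<^sub>R g)"
proof -
  have f: "f \<in> real_L2 \<mu>" "T f = 0" and g: "g \<in> real_L2 \<mu>" using assms T_null by (auto simp: null_def)
  show ?thesis
    by (rule null_I) (use f g assms null_ip in \<open>auto simp: ip_add_left ip_diff_left ip_scale_left\<close>)
qed

text \<open>A symmetric operator has no nonreal eigenvalues: pair the first function with
  \<open>g\<close>, the second with \<open>f\<close>, and subtract. The terms with \<open>T\<close>
  cancel and \<open>b\<close> times the sum of the two squared norms remains.\<close>

lemma nonreal_shift_null:
  assumes f: "f \<in> real_L2 \<mu>" and g: "g \<in> real_L2 \<mu>" and b: "b \<noteq> 0"
    and 1: "null (T f - a *\<^sub>R f + b *\<^sub>R g)" and 2: "null (T g - a *\<^sub>R g - b *\<^sub>R f)"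
  shows "null f \<and> null g"
proof -
  have "real_ip \<mu> (T f - a *\<^sub>R f + b *\<^sub>R g) g = 0" "real_ip \<mu> (T g - a *\<^sub>R g - b *\<^sub>R f) f = 0"
    using null_ip 1 2 f g by auto
  then have "b * (real_ip \<mu> g g + real_ip \<mu> f f) = 0"
    using f g T_symmetric[OF f g] ip_commute[OF f g] ip_commute[OF f T_in[OF g]]
    by (simp add: ip_add_left ip_diff_left ip_scale_left algebra_simps)
  then have "real_ip \<mu> g g + real_ip \<mu> f f = 0" using b by simp
  then show ?thesis using f g ip_nonneg[OF f] ip_nonneg[OF g] by (simp add: null_def)
qed

text \<open>By symmetry the squared norm of \<open>(T - a) f\<close> is the pairing of
  \<open>(T - a)^2 f\<close> with \<open>f\<close>, so there are no Jordan chains.\<close>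

lemma real_shift_null:
  assumes f: "f \<in> real_L2 \<mu>"
    and 1: "null (T (T f - a *\<^sub>R f) - a *\<^sub>R (T f - a *\<^sub>R f))"
  shows "null (T f - a *\<^sub>R f)"
proof -
  let ?u = "T f - a *\<^sub>R f"
  have u: "?u \<in> real_L2 \<mu>" using f by auto
  have "real_ip \<mu> ?u ?u = real_ip \<mu> (T ?u - a *\<^sub>R ?u) f"
    using f u T_symmetric[OF u f]
    by (simp only: ip_diff_left ip_diff_right ip_scale_left ip_scale_right T_in V_closed)
  also have "\<dots> = 0" using null_ip 1 f by auto
  finally show ?thesis using u by (simp add: null_def)
qed

text \<open>Descends from power \<open>k\<close> to power 1 by removing one factor at a time, with
  separate reasons for real and nonreal \<open>z\<close>. For \<open>k = 0\<close> the function is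
  itself null and so is its shift.\<close>

lemma shift_funpow_null:
  assumes "rep \<psi> f g" and "AE \<eta> in \<mu>. ((shift z ^^ k) \<psi>) \<eta> = 0"
  shows "AE \<eta> in \<mu>. shift z \<psi> \<eta> = 0"
  using assms
proof (induction k arbitrary: \<psi> f g)
  case 0
  then have "null f" "null g" using rep_AE[OF 0(1)] by auto
  then have "null (T f - Re z *\<^sub>R f + Im z *\<^sub>R g)" "null (T g - Re z *\<^sub>R g + (- Im z) *\<^sub>R f)"
    using null_shift by blast+
  then show ?case using rep_AE[OF rep_shift[OF 0(1), of z]] by simp
next
  case (Suc k)
  note r = rep_shift[OF Suc.prems(1), of z]
  have "(shift z ^^ k) (shift z \<psi>) = (shift z ^^ Suc k) \<psi>" by (simp add: funpow_swap1)
  then have "AE \<eta> in \<mu>. ((shift z ^^ k) (shift z \<psi>)) \<eta> = 0" using Suc.prems(2) by simp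
  then have *: "AE \<eta> in \<mu>. shift z (shift z \<psi>) \<eta> = 0" using Suc.IH[OF r] by blast
  let ?f = "T f - Re z *\<^sub>R f + Im z *\<^sub>R g" and ?g = "T g - Re z *\<^sub>R g - Im z *\<^sub>R f"
  have f: "f \<in> real_L2 \<mu>" and g: "g \<in> real_L2 \<mu>" using Suc.prems by (auto simp: rep_def)
  have n: "null (T ?f - Re z *\<^sub>R ?f + Im z *\<^sub>R ?g)" "null (T ?g - Re z *\<^sub>R ?g - Im z *\<^sub>R ?f)"
    using * rep_AE[OF rep_shift[OF r, of z]] by auto
  have "null ?f \<and> null ?g"
  proof (cases "Im z = 0")
    case True
    then show ?thesis using n real_shift_null[OF f, of "Re z"] real_shift_null[OF g, of "Re z"] by simp
  next
    case False
    then show ?thesis using nonreal_shift_null[OF _ _ False n] f g by auto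
  qed
  then show ?case using rep_AE[OF r] by simp
qed

section \<open>Algebraic multiplicities as fibres of the eigenvalue sequence\<close>

definition idx :: "complex \<Rightarrow> nat set" where "idx z = {k. complex_of_real (l k) = z}"

lemma finite_idx: "z \<noteq> 0 \<Longrightarrow> finite (idx z)"
proof (rule ccontr)
  assume z: "z \<noteq> 0" and inf: "infinite (idx z)"
  have "(\<lambda>k. \<bar>l k\<bar>) \<longlonglongrightarrow> 0" using summable_l by (rule summable_LIMSEQ_zero)
  then have "\<forall>\<^sub>F k in sequentially. \<bar>l k\<bar> < cmod z" by (rule order_tendstoD) (use z in simp)
  then obtain N where N: "\<And>k. k \<ge> N \<Longrightarrow> \<bar>l k\<bar> < cmod z" by (auto simp: eventually_sequentially)
  obtain k where "k \<ge> N" "k \<in> idx z" using inf by (meson infinite_nat_iff_unbounded_le)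
  then show False using N[of k] by (auto simp: idx_def)
qed

text \<open>The remainder \<open>g\<close> is orthogonal to every \<open>e k\<close>: by subtraction
  if \<open>l k = a\<close>, by distinctness of eigenvalues otherwise. Then \<open>expansion\<close>
  makes its form 0, while the eigenvalue equation makes it \<open>a\<close> times its squared
  norm.\<close>

lemma real_eigenfunction_expansion:
  assumes f: "f \<in> real_L2 \<mu>" and a: "a \<noteq> 0" and ev: "null (T f - a *\<^sub>R f)"
  shows "null (f - (\<Sum>k\<in>idx (complex_of_real a). real_ip \<mu> (e k) f *\<^sub>R e k))"
proof -
  let ?S = "idx (complex_of_real a)"
  have S: "finite ?S" "\<And>k. k \<in> ?S \<longleftrightarrow> l k = a" using finite_idx[of a] a by (auto simp: idx_def)
  define p where "p = (\<Sum>k\<in>?S. real_ip \<mu> (e k) f *\<^sub>R e k)"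
  have p: "p \<in> real_L2 \<mu>" by (auto simp: p_def)
  have Tp: "T p = a *\<^sub>R p"
    unfolding p_def scaleR_sum_right
    by (subst T_sum, simp) (intro sum.cong, auto simp: T_scale T_e S(2))
  define g where "g = f - p"
  have g: "g \<in> real_L2 \<mu>" using f p by (auto simp: g_def)
  have "T g - a *\<^sub>R g = T f - a *\<^sub>R f"
    using f p Tp by (simp add: g_def T_diff algebra_simps)
  then have ng: "null (T g - a *\<^sub>R g)" using ev by simp
  have "real_ip \<mu> (e k) g = 0" for k
  proof (cases "k \<in> ?S")
    case True
    then have "real_ip \<mu> (e k) p = real_ip \<mu> (e k) f"
      unfolding p_def using S a
      by (simp add: ip_sum_right ip_scale_right orthonormal if_distrib cong: if_cong)
    then show ?thesis using f p by (simp add: g_def ip_diff_right)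
  next
    case False
    have "real_ip \<mu> (e k) (T g - a *\<^sub>R g) = 0" using null_ip ng by auto
    then have "real_ip \<mu> (e k) (T g) = a * real_ip \<mu> (e k) g"
      using g by (simp add: ip_diff_right ip_scale_right)
    moreover have "real_ip \<mu> (e k) (T g) = l k * real_ip \<mu> (e k) g"
      using T_symmetric[of "e k" g] g by (simp add: T_e ip_scale_left)
    ultimately show ?thesis using False S(2) by auto
  qed
  then have "real_ip \<mu> (T g) g = 0" using expansion[OF g] by (simp add: sums_iff)
  moreover have "real_ip \<mu> (T g - a *\<^sub>R g) g = 0" using null_ip ng g by auto
  ultimately have "a * real_ip \<mu> g g = 0" using g by (simp add: ip_diff_left ip_scale_left)
  then show ?thesis using a g by (simp add: null_def g_def p_def)
qed

lemma gen_eigenspace_expansion: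
  assumes z: "z \<noteq> 0" and \<psi>: "\<psi> \<in> gen_eigenspace \<mu> K z"
  shows "\<exists>c. AE \<eta> in \<mu>. \<psi> \<eta> = (\<Sum>k\<in>idx z. c k * complex_of_real (e k \<eta>))"
proof -
  obtain k where L: "\<psi> \<in> L2 \<mu>" and k: "AE \<eta> in \<mu>. ((shift z ^^ k) \<psi>) \<eta> = 0"
    using \<psi> by (auto simp: gen_eigenspace_def shift_def[abs_def])
  define f g where "f = (\<lambda>\<xi>. Re (\<psi> \<xi>))" and "g = (\<lambda>\<xi>. Im (\<psi> \<xi>))"
  have r: "rep \<psi> f g" using rep_L2[OF L] by (simp add: f_def g_def)
  then have f: "f \<in> real_L2 \<mu>" and g: "g \<in> real_L2 \<mu>" by (auto simp: rep_def)
  have n: "null (T f - Re z *\<^sub>R f + Im z *\<^sub>R g)" "null (T g - Re z *\<^sub>R g - Im z *\<^sub>R f)"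
    using shift_funpow_null[OF r k] rep_AE[OF rep_shift[OF r, of z]] by auto
  show ?thesis
  proof (cases "Im z = 0")
    case True
    define a where "a = Re z"
    have za: "z = complex_of_real a" and a: "a \<noteq> 0" using True z by (auto simp: a_def complex_eq_iff)
    define c where "c k = Complex (real_ip \<mu> (e k) f) (real_ip \<mu> (e k) g)" for k
    have "null (f - (\<Sum>k\<in>idx z. real_ip \<mu> (e k) f *\<^sub>R e k))" "null (g - (\<Sum>k\<in>idx z. real_ip \<mu> (e k) g *\<^sub>R e k))"
      using real_eigenfunction_expansion[OF f a] real_eigenfunction_expansion[OF g a] n True
      by (auto simp: za)
    then have "AE \<eta> in \<mu>. (f - (\<Sum>k\<in>idx z. real_ip \<mu> (e k) f *\<^sub>R e k)) \<eta> = 0"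
      "AE \<eta> in \<mu>. (g - (\<Sum>k\<in>idx z. real_ip \<mu> (e k) g *\<^sub>R e k)) \<eta> = 0"
      using null_iff_AE by (auto simp: null_def)
    then have "AE \<eta> in \<mu>. \<psi> \<eta> = (\<Sum>k\<in>idx z. c k * complex_of_real (e k \<eta>))"
      by eventually_elim (auto simp: complex_eq_iff c_def f_def g_def)
    then show ?thesis by blast
  next
    case False
    then have "null f \<and> null g" using nonreal_shift_null[OF f g False n] by blast
    then have "AE \<eta> in \<mu>. \<psi> \<eta> = 0" using rep_AE[OF r] by blast
    moreover have "idx z = {}" using False by (auto simp: idx_def)
    ultimately show ?thesis by simp
  qed
qed

lemma e_in_gen_eigenspace: "k \<in> idx z \<Longrightarrow> (\<lambda>\<xi>. complex_of_real (e k \<xi>)) \<in> gen_eigenspace \<mu> K z"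
proof -
  assume k: "k \<in> idx z"
  let ?\<psi> = "\<lambda>\<xi>. complex_of_real (e k \<xi>)"
  have "rep ?\<psi> (e k) 0" by (auto simp: rep_def complex_eq_iff)
  from rep_AE[OF rep_shift[OF this, of z]] have "AE \<eta> in \<mu>. shift z ?\<psi> \<eta> = 0"
    using k by (auto simp: T_e idx_def null_def)
  then have "\<exists>n. AE \<eta> in \<mu>. ((shift z ^^ n) ?\<psi>) \<eta> = 0" by (intro exI[of _ 1]) simp
  moreover have "?\<psi> \<in> L2 \<mu>" using e_in[of k] by (auto simp: L2_def real_L2_def)
  ultimately show ?thesis by (simp add: gen_eigenspace_def shift_def[abs_def])
qed

text \<open>The supremum is attained. The eigenfunctions in the fibre are independent, and any
  larger family has more members than coefficients per member, hence a nontrivial combination that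
  vanishes almost everywhere.\<close>

lemma alg_mult_eq_card:
  assumes z: "z \<noteq> 0"
  shows "alg_mult \<mu> K z = card (idx z)"
  unfolding alg_mult_def
proof (rule cSup_eq_maximum)
  let ?S = "idx z"
  have S: "finite ?S" using finite_idx[OF z] .
  obtain b where b: "bij_betw b {..<card ?S} ?S" using ex_bij_betw_nat_finite[OF S] by (auto simp: atLeast0LessThan)
  have "ae_lin_indep \<mu> (card ?S) (\<lambda>i \<xi>. complex_of_real (e (b i) \<xi>))"
    unfolding ae_lin_indep_def
  proof (intro allI impI)
    fix cf :: "nat \<Rightarrow> complex" and j
    assume ae: "AE \<eta> in \<mu>. (\<Sum>i<card ?S. cf i * complex_of_real (e (b i) \<eta>)) = 0" and j: "j < card ?S"
    have bj: "l (b j) \<noteq> 0" using z j bij_betwE[OF b] by (auto simp: idx_def)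
    have inj: "b i = b j \<longleftrightarrow> i = j" if "i < card ?S" for i
      using b j that by (auto simp: bij_betw_def inj_on_def)
    \<comment> \<open>Pairing with \<open>e (b j)\<close> isolates one coefficient. This is done for
      real coefficients and then used on real and imaginary parts separately.\<close>
    have *: "d j = 0" if "AE \<eta> in \<mu>. (\<Sum>i<card ?S. d i * e (b i) \<eta>) = 0" for d :: "nat \<Rightarrow> real"
    proof -
      let ?p = "\<Sum>i<card ?S. d i *\<^sub>R e (b i)"
      have "null ?p" using that by (subst null_iff_AE) auto
      then have "real_ip \<mu> ?p (e (b j)) = 0" using null_ip by auto
      then have "(\<Sum>i<card ?S. d i * (if b i = b j \<and> l (b i) \<noteq> 0 then 1 else 0)) = 0"
        by (simp add: ip_sum_left ip_scale_left orthonormal)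
      moreover have "(\<Sum>i<card ?S. d i * (if b i = b j \<and> l (b i) \<noteq> 0 then 1 else 0)) = (\<Sum>i<card ?S. if i = j then d i else 0)"
        using inj bj by (intro sum.cong) auto
      ultimately show ?thesis using j by simp
    qed
    have "AE \<eta> in \<mu>. (\<Sum>i<card ?S. Re (cf i) * e (b i) \<eta>) = 0" "AE \<eta> in \<mu>. (\<Sum>i<card ?S. Im (cf i) * e (b i) \<eta>) = 0"
      using ae by (auto simp: complex_eq_iff elim!: eventually_mono)
    then show "cf j = 0" using *[of "\<lambda>i. Re (cf i)"] *[of "\<lambda>i. Im (cf i)"] by (simp add: complex_eq_iff)
  qed
  then show "card ?S \<in> {m. \<exists>\<phi>. (\<forall>i<m. \<phi> i \<in> gen_eigenspace \<mu> K z) \<and> ae_lin_indep \<mu> m \<phi>}"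
    using e_in_gen_eigenspace bij_betwE[OF b] by (auto intro!: exI[of _ "\<lambda>i \<xi>. complex_of_real (e (b i) \<xi>)"])
next
  let ?S = "idx z"
  fix m assume "m \<in> {m. \<exists>\<phi>. (\<forall>i<m. \<phi> i \<in> gen_eigenspace \<mu> K z) \<and> ae_lin_indep \<mu> m \<phi>}"
  then obtain \<phi> where \<phi>: "\<And>i. i < m \<Longrightarrow> \<phi> i \<in> gen_eigenspace \<mu> K z" and ind: "ae_lin_indep \<mu> m \<phi>" by auto
  have "\<exists>c. \<forall>i<m. AE \<eta> in \<mu>. \<phi> i \<eta> = (\<Sum>k\<in>?S. c i k * complex_of_real (e k \<eta>))"
    using gen_eigenspace_expansion[OF z \<phi>] by metis
  then obtain c where c: "\<And>i. i < m \<Longrightarrow> AE \<eta> in \<mu>. \<phi> i \<eta> = (\<Sum>k\<in>?S. c i k * complex_of_real (e k \<eta>))" by blast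
  show "m \<le> card ?S"
  proof (rule ccontr)
    assume "\<not> m \<le> card ?S"
    then obtain cf where cf: "\<exists>i\<in>{..<m}. cf i \<noteq> 0" "\<forall>k\<in>?S. (\<Sum>i<m. cf i * c i k) = 0"
      using exists_nontrivial_combination[OF finite_idx[OF z], of "{..<m}" c] by auto
    have "AE \<eta> in \<mu>. \<forall>i\<in>{..<m}. \<phi> i \<eta> = (\<Sum>k\<in>?S. c i k * complex_of_real (e k \<eta>))"
      using c by (subst AE_ball_countable) auto
    then have "AE \<eta> in \<mu>. (\<Sum>i<m. cf i * \<phi> i \<eta>) = 0"
    proof eventually_elim
      case (elim \<eta>)
      have "(\<Sum>i<m. cf i * \<phi> i \<eta>) = (\<Sum>i<m. \<Sum>k\<in>?S. cf i * c i k * complex_of_real (e k \<eta>))"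
        using elim by (intro sum.cong) (auto simp: sum_distrib_left ac_simps)
      also have "\<dots> = (\<Sum>k\<in>?S. \<Sum>i<m. cf i * c i k * complex_of_real (e k \<eta>))" by (rule sum.swap)
      also have "\<dots> = (\<Sum>k\<in>?S. (\<Sum>i<m. cf i * c i k) * complex_of_real (e k \<eta>))" by (simp add: sum_distrib_right)
      also have "\<dots> = 0" using cf(2) by simp
      finally show ?case .
    qed
    then show False using ind cf(1) unfolding ae_lin_indep_def by blast
  qed
qed

text \<open>The definite description requires every admissible enumeration to give the same product.
  Any of them agrees with \<open>l\<close> up to a bijection of the nonzero entries, and absolute
  summability of the logarithms makes the sum invariant under such a rearrangement.\<close>

theorem fredholm_det_eq:
  assumes pos: "\<And>k. - 1 < l k"
  shows "fredholm_det \<mu> K = complex_of_real (exp (\<Sum>k. ln (1 + l k)))"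
proof -
  define s where "s = (\<Sum>k. ln (1 + l k))"
  have abs_sum: "summable (\<lambda>k. \<bar>ln (1 + l k)\<bar>)" using ln_one_plus_abs_summable[OF summable_l] .
  have sums: "(\<lambda>k. ln (1 + l k)) sums s"
    using summable_rabs_cancel[OF abs_sum] by (simp add: s_def summable_sums)
  have hs: "((\<lambda>k. ln (1 + l k)) has_sum s) UNIV"
    using norm_summable_imp_has_sum[OF _ sums] abs_sum by simp
  have enum: "eigen_enum \<mu> K (\<lambda>k. complex_of_real (l k))"
    unfolding eigen_enum_def using finite_idx alg_mult_eq_card by (auto simp: idx_def)
  have "d = complex_of_real (exp s)" if en: "eigen_enum \<mu> K lam" and d: "(\<lambda>n. 1 + lam n) has_prod d" for lam d
  proof -
    define N N' where "N = {n. l n \<noteq> 0}" and "N' = {n. lam n \<noteq> 0}"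
    \<comment> \<open>Both sequences take each nonzero value equally often. The fibrewise bijections
      glue to a bijection of the nonzero entries; the numbers of zeros may differ, but zeros
      contribute \<open>ln 1 = 0\<close>.\<close>
    have "\<exists>b. bij_betw b {n. lam n = z} (idx z)" if "z \<noteq> 0" for z
    proof (rule finite_same_card_bij)
      show "finite {n. lam n = z}" "card {n. lam n = z} = card (idx z)"
        using en that alg_mult_eq_card[OF that] by (auto simp: eigen_enum_def)
    qed (rule finite_idx[OF that])
    then obtain b where b: "\<And>z. z \<noteq> 0 \<Longrightarrow> bij_betw (b z) {n. lam n = z} (idx z)" by metis
    define \<sigma> where "\<sigma> n = b (lam n) n" for n
    have \<sigma>: "complex_of_real (l (\<sigma> n)) = lam n" if "n \<in> N'" for n
      using bij_betwE[OF b[of "lam n"]] that by (auto simp: N'_def \<sigma>_def idx_def)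
    have bij: "bij_betw \<sigma> N' N"
    proof (rule bij_betw_imageI)
      show "inj_on \<sigma> N'"
      proof (rule inj_onI)
        fix n m assume nm: "n \<in> N'" "m \<in> N'" "\<sigma> n = \<sigma> m"
        then have eq: "lam n = lam m" using \<sigma>[of n] \<sigma>[of m] by simp
        have "inj_on (b (lam n)) {k. lam k = lam n}" using b[of "lam n"] nm by (auto simp: N'_def bij_betw_def)
        then show "n = m" using nm eq by (auto simp: \<sigma>_def inj_on_def)
      qed
      show "\<sigma> ` N' = N"
      proof
        show "\<sigma> ` N' \<subseteq> N" using \<sigma> by (fastforce simp: N_def N'_def)
        show "N \<subseteq> \<sigma> ` N'"
        proof
          fix k assume "k \<in> N"
          then have k: "complex_of_real (l k) \<noteq> 0" "k \<in> idx (complex_of_real (l k))" by (auto simp: N_def idx_def)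
          then obtain n where "lam n = complex_of_real (l k)" "b (complex_of_real (l k)) n = k"
            using b[OF k(1)] unfolding bij_betw_def by force
          then show "k \<in> \<sigma> ` N'" using k by (auto simp: \<sigma>_def N'_def intro!: image_eqI[of _ _ n])
        qed
      qed
    qed
    define l' where "l' n = Re (lam n)" for n
    have l': "lam n = complex_of_real (l' n)" "- 1 < l' n" for n
    proof -
      show "lam n = complex_of_real (l' n)" using \<sigma>[of n] by (cases "n \<in> N'") (auto simp: l'_def N'_def complex_eq_iff)
      show "- 1 < l' n" using \<sigma>[of n] pos[of "\<sigma> n"] by (cases "n \<in> N'") (auto simp: l'_def N'_def complex_eq_iff)
    qed
    have "((\<lambda>k. ln (1 + l k)) has_sum s) N"
      using hs by (rule has_sum_cong_neutral[THEN iffD1, rotated -1]) (auto simp: N_def)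
    then have "((\<lambda>n. ln (1 + l (\<sigma> n))) has_sum s) N'"
      using has_sum_reindex_bij_betw[OF bij, of "\<lambda>k. ln (1 + l k)" s] by simp
    then have "((\<lambda>n. ln (1 + l' n)) has_sum s) UNIV"
    proof (rule has_sum_cong_neutral[THEN iffD1, rotated -1])
      show "ln (1 + l (\<sigma> n)) = ln (1 + l' n)" if "n \<in> N' \<inter> UNIV" for n
        using \<sigma>[of n] that by (simp add: l'_def complex_eq_iff)
    qed (auto simp: N'_def l'_def)
    then have "(\<lambda>n. ln (1 + l' n)) sums s" by (rule has_sum_imp_sums)
    then have "(\<lambda>n. 1 + complex_of_real (l' n)) has_prod complex_of_real (exp s)"
      using l' by (intro has_prod_one_plus) auto
    then show ?thesis using d l'(1) has_prod_unique2 by auto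
  qed
  moreover have "(\<lambda>k. 1 + complex_of_real (l k)) has_prod complex_of_real (exp s)"
    using has_prod_one_plus[OF pos sums] .
  ultimately show ?thesis unfolding fredholm_det_def s_def[symmetric] using enum
    by (intro the_equality) blast+
qed

end

section \<open>Gaussian integrals of quadratic forms\<close>

lemma has_bochner_integral_of_realD:
  "has_bochner_integral M (\<lambda>x. complex_of_real (f x)) (complex_of_real r) \<Longrightarrow> has_bochner_integral M f r"
  using has_bochner_integral_bounded_linear[OF bounded_linear_Re] by fastforce

text \<open>With \<open>z = a + i b\<close>, translating the variable by \<open>a\<close> leaves the
  characteristic function at \<open>b\<close>, times \<open>exp (a^2/2 + i a b)\<close>.\<close>

lemma std_normal_complex_mgf:
  "has_bochner_integral std_normal_distribution (\<lambda>y. exp (z * complex_of_real y)) (exp (z\<^sup>2 / 2))"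
proof -
  define a b where "a = Re z" and "b = Im z"
  interpret real_distribution std_normal_distribution by (rule real_dist_normal_dist)
  have i: "has_bochner_integral std_normal_distribution (\<lambda>y. iexp (b * y)) (complex_of_real (exp (- (b\<^sup>2) / 2)))"
    using char_std_normal_distribution integrable_iexp[of "\<lambda>y. b * y"]
    by (simp add: has_bochner_integral_iff char_def fun_eq_iff)
  have "has_bochner_integral lborel (\<lambda>y. std_normal_density y *\<^sub>R iexp (b * y)) (complex_of_real (exp (- (b\<^sup>2) / 2)))"
    using i by (simp add: has_bochner_integral_iff integrable_density integral_density)
  then have "has_bochner_integral lborel (\<lambda>y. std_normal_density (- a + 1 * y) *\<^sub>R iexp (b * (- a + 1 * y)))
    (complex_of_real (exp (- (b\<^sup>2) / 2)) /\<^sub>R \<bar>1\<bar>)"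
    by (subst (asm) lborel_has_bochner_integral_real_affine_iff[of 1 _ _ "- a"]) auto
  then have "has_bochner_integral lborel (\<lambda>y. exp (complex_of_real (a\<^sup>2 / 2) + \<i> * a * b) *
      (std_normal_density (y - a) *\<^sub>R iexp (b * (y - a))))
    (exp (complex_of_real (a\<^sup>2 / 2) + \<i> * a * b) * complex_of_real (exp (- (b\<^sup>2) / 2)))"
    by (intro has_bochner_integral_mult_right) (auto simp: algebra_simps)
  moreover have "exp (complex_of_real (a\<^sup>2 / 2) + \<i> * a * b) * complex_of_real (exp (- (b\<^sup>2) / 2)) = exp (z\<^sup>2 / 2)"
  proof -
    have "z = Complex a b" by (simp add: a_def b_def)
    then have "complex_of_real (a\<^sup>2 / 2) + \<i> * a * b + complex_of_real (- (b\<^sup>2) / 2) = z\<^sup>2 / 2"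
      by (simp add: complex_eq_iff power2_eq_square field_simps)
    then show ?thesis by (simp only: exp_of_real[symmetric] exp_add[symmetric])
  qed
  moreover have "exp (complex_of_real (a\<^sup>2 / 2) + \<i> * a * b) * (std_normal_density (y - a) *\<^sub>R iexp (b * (y - a)))
    = std_normal_density y *\<^sub>R exp (z * complex_of_real y)" for y
  proof -
    have e: "std_normal_density u *\<^sub>R w = complex_of_real (1 / sqrt (2 * pi)) * (exp (complex_of_real (- u\<^sup>2 / 2)) * w)" for u and w :: complex
      unfolding std_normal_density_def exp_of_real by (simp add: scaleR_conv_of_real)
    have "z = Complex a b" by (simp add: a_def b_def)
    then have "(complex_of_real (a\<^sup>2 / 2) + \<i> * a * b) + (complex_of_real (- (y - a)\<^sup>2 / 2) + \<i> * complex_of_real (b * (y - a)))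
      = complex_of_real (- y\<^sup>2 / 2) + z * complex_of_real y"
      by (simp add: complex_eq_iff power2_eq_square field_simps)
    then have "exp (complex_of_real (a\<^sup>2 / 2) + \<i> * a * b) * (exp (complex_of_real (- (y - a)\<^sup>2 / 2)) * iexp (b * (y - a)))
      = exp (complex_of_real (- y\<^sup>2 / 2)) * exp (z * complex_of_real y)"
      by (simp only: exp_add[symmetric])
    then show ?thesis unfolding e by (simp only: mult.left_commute)
  qed
  ultimately have "has_bochner_integral lborel (\<lambda>y. std_normal_density y *\<^sub>R exp (z * complex_of_real y)) (exp (z\<^sup>2 / 2))"
    by simp
  then show ?thesis by (subst has_bochner_integral_density) auto
qed

text \<open>The integrand against the standard density is \<open>\<sigma>\<close> times the normal
  density of variance \<open>\<sigma>^2 = 1 / (1 + b)\<close>.\<close>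

lemma std_normal_exp_square:
  assumes "- 1 < b"
  shows "has_bochner_integral std_normal_distribution (\<lambda>y. exp (- (b * y\<^sup>2 / 2))) ((1 + b) powr (- 1/2))"
proof -
  define \<sigma> where "\<sigma> = 1 / sqrt (1 + b)"
  have \<sigma>: "0 < \<sigma>" "\<sigma>\<^sup>2 = 1 / (1 + b)" using assms by (auto simp: \<sigma>_def power_divide)
  have p: "(1 + b) powr (- 1/2) = \<sigma>"
    using assms by (simp add: \<sigma>_def powr_half_sqrt[symmetric] powr_minus_divide)
  have "std_normal_density y *\<^sub>R exp (- (b * y\<^sup>2 / 2)) = \<sigma> * normal_density 0 \<sigma> y" for y
  proof -
    have "sqrt (2 * pi * \<sigma>\<^sup>2) = sqrt (2 * pi) * \<sigma>" using \<sigma>(1) by (simp only: real_sqrt_mult real_sqrt_abs abs_of_pos)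
    moreover have "- y\<^sup>2 / 2 + - (b * y\<^sup>2 / 2) = - y\<^sup>2 / (2 * \<sigma>\<^sup>2)"
      using assms by (simp add: \<sigma>(2) field_simps)
    ultimately show ?thesis using \<sigma>(1)
      by (simp add: std_normal_density_def normal_density_def mult_exp_exp)
  qed
  moreover have "has_bochner_integral lborel (\<lambda>y. \<sigma> * normal_density 0 \<sigma> y) (\<sigma> * 1)"
    using \<sigma> by (intro has_bochner_integral_mult_right) (auto simp: has_bochner_integral_iff)
  ultimately show ?thesis unfolding p by (subst has_bochner_integral_density) auto
qed

lemma (in prob_space) std_normal_exp:
  assumes X: "distributed M lborel X std_normal_density"
  shows "has_bochner_integral M (\<lambda>\<omega>. exp (z * complex_of_real (X \<omega>))) (exp (z\<^sup>2 / 2))"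
proof -
  have Xm: "X \<in> borel_measurable M" using distributed_measurable[OF X] by simp
  have d: "distr M borel X = std_normal_distribution"
    using distributed_distr_eq_density[OF X] by (metis distr_cong sets_lborel)
  have "has_bochner_integral (distr M borel X) (\<lambda>y. exp (z * complex_of_real y)) (exp (z\<^sup>2 / 2))"
    unfolding d by (rule std_normal_complex_mgf)
  then show ?thesis using Xm by (simp add: has_bochner_integral_iff integrable_distr_eq integral_distr)
qed

text \<open>The exponential moment formula encodes that the \<open>g k\<close>,
  \<open>k \<in> I\<close>, are independent standard normal. The index set leaves out those
  \<open>k\<close> whose eigenvalue is 0.\<close>

locale gaussian_family = prob_space M for M :: "'w measure" +
  fixes g :: "nat \<Rightarrow> 'w \<Rightarrow> real" and I :: "nat set"
  assumes g_measurable: "\<And>k. k \<in> I \<Longrightarrow> g k \<in> borel_measurable M"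
    and g_exp: "\<And>F z. finite F \<Longrightarrow> F \<subseteq> I \<Longrightarrow>
      has_bochner_integral M (\<lambda>\<omega>. exp (\<Sum>k\<in>F. z k * complex_of_real (g k \<omega>))) (exp ((\<Sum>k\<in>F. (z k)\<^sup>2) / 2))"
begin

text \<open>Induction step by the identity \<open>exp (- l g\<^sup>2 / 2) = E exp (s Y g)\<close> with \<open>s\<^sup>2 = - l\<close> and an
  independent standard normal \<open>Y\<close>, which trades a quadratic exponent for a linear one.\<close>

lemma exp_quadratic_linear:
  assumes "finite S" "finite F" "S \<inter> F = {}" "S \<union> F \<subseteq> I" "\<And>k. k \<in> S \<Longrightarrow> - 1 < l k"
  shows "has_bochner_integral M
    (\<lambda>\<omega>. complex_of_real (exp (- (\<Sum>k\<in>S. l k * (g k \<omega>)\<^sup>2) / 2)) * exp (\<Sum>k\<in>F. z k * complex_of_real (g k \<omega>)))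
    (complex_of_real (\<Prod>k\<in>S. (1 + l k) powr (- 1/2)) * exp ((\<Sum>k\<in>F. (z k)\<^sup>2) / 2))"
  using assms
proof (induction S arbitrary: F z rule: finite_induct)
  case empty
  then show ?case using g_exp[of F z] by simp
next
  case (insert i S)
  let ?N = std_normal_distribution
  interpret N: prob_space ?N by (rule prob_space_normal_density) simp
  interpret P: pair_sigma_finite ?N M ..
  define s where "s = csqrt (complex_of_real (- l i))"
  have s2: "s\<^sup>2 = - complex_of_real (l i)" by (simp add: s_def)
  have li: "- 1 < l i" using insert.prems by auto
  have i: "i \<in> I" "i \<notin> F" and fin: "finite (insert i F)" using insert by auto
  have gm [measurable]: "k \<in> S \<union> insert i F \<Longrightarrow> g k \<in> borel_measurable M" for k
    using insert.prems g_measurable by auto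
  \<comment> \<open>\<open>s\<close> is real or purely imaginary. The absolute value of the
    integrand involves only \<open>Re s\<close>, and its integral over the auxiliary normal variable
    converges exactly because this square is below 1, that is, because
    \<open>l i > -1\<close>.\<close>
  have Re_s: "(Re s)\<^sup>2 < 1"
  proof -
    have "(Re s)\<^sup>2 - (Im s)\<^sup>2 = - l i" "Re s * Im s = 0"
      using s2 by (auto simp: complex_eq_iff Re_power2 Im_power2)
    then show ?thesis using li by (cases "Re s = 0") auto
  qed
  define E where "E \<omega> = complex_of_real (exp (- (\<Sum>k\<in>S. l k * (g k \<omega>)\<^sup>2) / 2)) * exp (\<Sum>k\<in>F. z k * complex_of_real (g k \<omega>))" for \<omega>
  define H where "H = (\<lambda>(y, \<omega>). E \<omega> * exp (s * complex_of_real y * complex_of_real (g i \<omega>)))"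
  define PS where "PS = (\<Prod>k\<in>S. (1 + l k) powr (- 1/2))"
  have IH: "has_bochner_integral M
    (\<lambda>\<omega>. complex_of_real (exp (- (\<Sum>k\<in>S. l k * (g k \<omega>)\<^sup>2) / 2)) * exp (\<Sum>k\<in>insert i F. z' k * complex_of_real (g k \<omega>)))
    (complex_of_real PS * exp ((\<Sum>k\<in>insert i F. (z' k)\<^sup>2) / 2))" for z'
    unfolding PS_def using insert.prems insert.hyps fin by (intro insert.IH) auto
  have inner: "has_bochner_integral M (\<lambda>\<omega>. H (y, \<omega>)) (complex_of_real PS * exp ((\<Sum>k\<in>F. (z k)\<^sup>2) / 2) * complex_of_real (exp (- (l i * y\<^sup>2 / 2))))" for y
  proof -
    define z' where "z' = z(i := s * complex_of_real y)"
    have z': "(\<Sum>k\<in>F. z' k * w k) = (\<Sum>k\<in>F. z k * w k)" "(\<Sum>k\<in>F. (z' k)\<^sup>2) = (\<Sum>k\<in>F. (z k)\<^sup>2)" for w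
      using i by (auto simp: z'_def intro!: sum.cong)
    have "(\<Sum>k\<in>insert i F. (z' k)\<^sup>2) / 2 = (\<Sum>k\<in>F. (z k)\<^sup>2) / 2 + complex_of_real (- (l i * y\<^sup>2 / 2))"
      using insert i z' by (simp add: z'_def power_mult_distrib s2 add_divide_distrib)
    then have 1: "complex_of_real PS * exp ((\<Sum>k\<in>insert i F. (z' k)\<^sup>2) / 2) = complex_of_real PS * exp ((\<Sum>k\<in>F. (z k)\<^sup>2) / 2) * complex_of_real (exp (- (l i * y\<^sup>2 / 2)))"
      by (simp only: exp_add exp_of_real mult.assoc)
    have "(\<Sum>k\<in>insert i F. z' k * complex_of_real (g k \<omega>)) = (\<Sum>k\<in>F. z k * complex_of_real (g k \<omega>)) + s * complex_of_real y * complex_of_real (g i \<omega>)" for \<omega>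
      using insert i z' by (simp add: z'_def)
    then have 2: "complex_of_real (exp (- (\<Sum>k\<in>S. l k * (g k \<omega>)\<^sup>2) / 2)) * exp (\<Sum>k\<in>insert i F. z' k * complex_of_real (g k \<omega>)) = H (y, \<omega>)" for \<omega>
      by (simp add: H_def E_def exp_add mult.assoc)
    show ?thesis using IH[of z'] unfolding 1 2 .
  qed
  \<comment> \<open>The absolute value of \<open>H\<close> is of the same shape with all arguments
    replaced by their real parts, so the induction hypothesis also yields the integrability that
    Fubini's theorem needs.\<close>
  have inner_norm: "has_bochner_integral M (\<lambda>\<omega>. norm (H (y, \<omega>))) (PS * exp ((\<Sum>k\<in>F. (Re (z k))\<^sup>2) / 2) * exp (- ((- (Re s)\<^sup>2) * y\<^sup>2 / 2)))" for y
  proof -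
    define z' where "z' = (\<lambda>k. complex_of_real (Re (z k)))(i := complex_of_real (Re s * y))"
    have z': "(\<Sum>k\<in>F. z' k * w k) = (\<Sum>k\<in>F. complex_of_real (Re (z k)) * w k)" "(\<Sum>k\<in>F. (z' k)\<^sup>2) = complex_of_real (\<Sum>k\<in>F. (Re (z k))\<^sup>2)" for w
      using i by (auto simp: z'_def intro!: sum.cong)
    have "(\<Sum>k\<in>insert i F. (z' k)\<^sup>2) / 2 = complex_of_real ((\<Sum>k\<in>F. (Re (z k))\<^sup>2) / 2 + - ((- (Re s)\<^sup>2) * y\<^sup>2 / 2))"
      using insert i z' by (simp add: z'_def power_mult_distrib add_divide_distrib)
    then have 1: "complex_of_real PS * exp ((\<Sum>k\<in>insert i F. (z' k)\<^sup>2) / 2) =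
      complex_of_real (PS * exp ((\<Sum>k\<in>F. (Re (z k))\<^sup>2) / 2) * exp (- ((- (Re s)\<^sup>2) * y\<^sup>2 / 2)))"
      by (simp only: exp_add exp_of_real of_real_mult mult.assoc)
    have e: "(\<Sum>k\<in>insert i F. z' k * complex_of_real (g k \<omega>)) = complex_of_real ((\<Sum>k\<in>F. Re (z k) * g k \<omega>) + Re s * y * g i \<omega>)" for \<omega>
      using insert i z' by (simp add: z'_def)
    have 2: "complex_of_real (exp (- (\<Sum>k\<in>S. l k * (g k \<omega>)\<^sup>2) / 2)) * exp (\<Sum>k\<in>insert i F. z' k * complex_of_real (g k \<omega>)) = complex_of_real (norm (H (y, \<omega>)))" for \<omega>
      unfolding e exp_of_real H_def E_def by (simp add: norm_mult exp_add)
    have "has_bochner_integral M (\<lambda>\<omega>. complex_of_real (norm (H (y, \<omega>)))) (complex_of_real (PS * exp ((\<Sum>k\<in>F. (Re (z k))\<^sup>2) / 2) * exp (- ((- (Re s)\<^sup>2) * y\<^sup>2 / 2))))"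
      using IH[of z'] unfolding 1 2 .
    then show ?thesis by (rule has_bochner_integral_of_realD)
  qed
  have Em [measurable]: "E \<in> borel_measurable M"
  proof -
    have [measurable]: "(\<lambda>\<omega>. \<Sum>k\<in>S. l k * (g k \<omega>)\<^sup>2) \<in> borel_measurable M"
      using gm by (intro borel_measurable_sum borel_measurable_times borel_measurable_power) auto
    have [measurable]: "(\<lambda>\<omega>. \<Sum>k\<in>F. z k * complex_of_real (g k \<omega>)) \<in> borel_measurable M"
      using gm by (intro borel_measurable_sum borel_measurable_times borel_measurable_of_real) auto
    show ?thesis unfolding E_def by measurable
  qed
  have gim [measurable]: "g i \<in> borel_measurable M" using gm by auto
  have Hm [measurable]: "H \<in> borel_measurable (?N \<Otimes>\<^sub>M M)"
    unfolding H_def by measurable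
  have intH: "integrable (?N \<Otimes>\<^sub>M M) H"
  proof (rule P.Fubini_integrable[OF Hm])
    have "integrable ?N (\<lambda>y. PS * exp ((\<Sum>k\<in>F. (Re (z k))\<^sup>2) / 2) * exp (- ((- (Re s)\<^sup>2) * y\<^sup>2 / 2)))"
      using std_normal_exp_square[of "- (Re s)\<^sup>2"] Re_s by (intro integrable_mult_right) (auto simp: has_bochner_integral_iff)
    then show "integrable ?N (\<lambda>y. \<integral>\<omega>. norm (H (y, \<omega>)) \<partial>M)"
      using inner_norm by (simp add: has_bochner_integral_iff)
    show "AE y in ?N. integrable M (\<lambda>\<omega>. H (y, \<omega>))"
      using inner by (auto simp: has_bochner_integral_iff)
  qed
  have outer: "(\<integral>y. H (y, \<omega>) \<partial>?N) = complex_of_real (exp (- (\<Sum>k\<in>insert i S. l k * (g k \<omega>)\<^sup>2) / 2)) * exp (\<Sum>k\<in>F. z k * complex_of_real (g k \<omega>))" for \<omega>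
  proof -
    have "(\<integral>y. H (y, \<omega>) \<partial>?N) = E \<omega> * (\<integral>y. exp ((s * complex_of_real (g i \<omega>)) * complex_of_real y) \<partial>?N)"
      by (simp add: H_def ac_simps)
    also have "\<dots> = E \<omega> * exp ((s * complex_of_real (g i \<omega>))\<^sup>2 / 2)"
      using std_normal_complex_mgf by (simp add: has_bochner_integral_iff)
    also have "(s * complex_of_real (g i \<omega>))\<^sup>2 / 2 = complex_of_real (- (l i * (g i \<omega>)\<^sup>2) / 2)"
      by (simp add: power_mult_distrib s2)
    also have "E \<omega> * exp (complex_of_real (- (l i * (g i \<omega>)\<^sup>2) / 2)) =
      complex_of_real (exp (- (l i * (g i \<omega>)\<^sup>2) / 2) * exp (- (\<Sum>k\<in>S. l k * (g k \<omega>)\<^sup>2) / 2)) * exp (\<Sum>k\<in>F. z k * complex_of_real (g k \<omega>))"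
      by (simp add: E_def exp_of_real[symmetric])
    also have "exp (- (l i * (g i \<omega>)\<^sup>2) / 2) * exp (- (\<Sum>k\<in>S. l k * (g k \<omega>)\<^sup>2) / 2) = exp (- (\<Sum>k\<in>insert i S. l k * (g k \<omega>)\<^sup>2) / 2)"
      using insert.hyps by (simp add: exp_add[symmetric] add_divide_distrib diff_divide_distrib)
    finally show ?thesis .
  qed
  have val: "(\<integral>\<omega>. (\<integral>y. H (y, \<omega>) \<partial>?N) \<partial>M) = complex_of_real (\<Prod>k\<in>insert i S. (1 + l k) powr (- 1/2)) * exp ((\<Sum>k\<in>F. (z k)\<^sup>2) / 2)"
  proof -
    have "(\<integral>\<omega>. (\<integral>y. H (y, \<omega>) \<partial>?N) \<partial>M) = (\<integral>y. (\<integral>\<omega>. H (y, \<omega>) \<partial>M) \<partial>?N)"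
      using P.Fubini_integral[of "\<lambda>y \<omega>. H (y, \<omega>)"] intH by simp
    also have "\<dots> = (\<integral>y. complex_of_real PS * exp ((\<Sum>k\<in>F. (z k)\<^sup>2) / 2) * complex_of_real (exp (- (l i * y\<^sup>2 / 2))) \<partial>?N)"
      using inner by (simp add: has_bochner_integral_iff)
    also have "\<dots> = complex_of_real PS * exp ((\<Sum>k\<in>F. (z k)\<^sup>2) / 2) * complex_of_real ((1 + l i) powr (- 1/2))"
      using std_normal_exp_square[OF li] by (simp only: integral_mult_right_zero integral_of_real has_bochner_integral_iff)
    finally show ?thesis using insert.hyps by (simp add: PS_def)
  qed
  have "integrable M (\<lambda>\<omega>. \<integral>y. H (y, \<omega>) \<partial>?N)"
    using P.integrable_snd[of "\<lambda>y \<omega>. H (y, \<omega>)"] intH by simp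
  then show ?case using val unfolding outer by (simp only: has_bochner_integral_iff)
qed

lemma exp_quadratic:
  assumes "finite S" "S \<subseteq> I" "\<And>k. k \<in> S \<Longrightarrow> - 1 < l k"
  shows "(\<integral>\<^sup>+\<omega>. ennreal (exp (- (\<Sum>k\<in>S. l k * (g k \<omega>)\<^sup>2) / 2)) \<partial>M) = ennreal (\<Prod>k\<in>S. (1 + l k) powr (- 1/2))"
proof -
  have "has_bochner_integral M (\<lambda>\<omega>. complex_of_real (exp (- (\<Sum>k\<in>S. l k * (g k \<omega>)\<^sup>2) / 2)))
    (complex_of_real (\<Prod>k\<in>S. (1 + l k) powr (- 1/2)))"
    using exp_quadratic_linear[of S "{}" l "\<lambda>_. 0"] assms by simp
  then have "has_bochner_integral M (\<lambda>\<omega>. exp (- (\<Sum>k\<in>S. l k * (g k \<omega>)\<^sup>2) / 2)) (\<Prod>k\<in>S. (1 + l k) powr (- 1/2))"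
    by (rule has_bochner_integral_of_realD)
  then show ?thesis by (simp add: has_bochner_integral_iff nn_integral_eq_integral)
qed

text \<open>Dominated convergence over the partial sums. Positive terms only decrease the
  exponential, so the majorant retains just the negative eigenvalues; its partial exponentials
  increase, and their integrals are known by the finite formula.\<close>

theorem exp_quadratic_series:
  assumes I: "I = {k. l k \<noteq> 0}" and l: "\<And>k. - 1 < l k" and sl: "summable (\<lambda>k. \<bar>l k\<bar>)"
    and Q: "Q \<in> borel_measurable M" and series: "AE \<omega> in M. (\<lambda>k. l k * (g k \<omega>)\<^sup>2) sums Q \<omega>"
  shows "(\<integral>\<^sup>+\<omega>. ennreal (exp (- Q \<omega> / 2)) \<partial>M) = ennreal (exp (- (\<Sum>k. ln (1 + l k)) / 2))"
proof -
  have partial: "(\<integral>\<^sup>+\<omega>. ennreal (exp (- (\<Sum>k<n. m k * (g k \<omega>)\<^sup>2) / 2)) \<partial>M) = ennreal (exp (- (\<Sum>k<n. ln (1 + m k)) / 2))"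
    if m: "\<And>k. - 1 < m k" "\<And>k. l k = 0 \<Longrightarrow> m k = 0" for m n
  proof -
    define S where "S = {k. k < n \<and> m k \<noteq> 0}"
    have S: "(\<Sum>k<n. m k * f k) = (\<Sum>k\<in>S. m k * f k)" for f :: "nat \<Rightarrow> real"
      by (rule sum.mono_neutral_right) (auto simp: S_def)
    have "(\<Sum>k<n. ln (1 + m k)) = (\<Sum>k\<in>S. ln (1 + m k))"
      by (rule sum.mono_neutral_right) (auto simp: S_def)
    then have "exp (- (\<Sum>k<n. ln (1 + m k)) / 2) = exp (\<Sum>k\<in>S. - ln (1 + m k) / 2)"
      by (simp add: sum_negf sum_divide_distrib)
    also have "\<dots> = (\<Prod>k\<in>S. exp (- ln (1 + m k) / 2))" by (rule exp_sum) (auto simp: S_def)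
    also have "\<dots> = (\<Prod>k\<in>S. (1 + m k) powr (- 1/2))"
    proof (rule prod.cong)
      fix k
      have "0 < 1 + m k" using m(1)[of k] by linarith
      then show "exp (- ln (1 + m k) / 2) = (1 + m k) powr (- 1/2)" by (simp add: powr_def)
    qed simp
    finally show ?thesis unfolding S using m by (subst exp_quadratic) (auto simp: S_def I)
  qed
  \<comment> \<open>This is \<open>min (l k) 0\<close>, still above -1, absolutely summable, and 0
    wherever \<open>l\<close> is.\<close>
  define m where "m k = - max 0 (- l k)" for k
  have m: "- 1 < m k" "l k = 0 \<Longrightarrow> m k = 0" "m k \<le> 0" "m k \<le> l k" "\<bar>m k\<bar> \<le> \<bar>l k\<bar>" for k using l[of k] by (auto simp: m_def)
  have sm: "summable (\<lambda>k. \<bar>m k\<bar>)" using m by (intro summable_comparison_test'[OF sl]) auto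
  define Y where "Y n \<omega> = ennreal (exp (- (\<Sum>k<n. m k * (g k \<omega>)\<^sup>2) / 2))" for n \<omega>
  have gm: "(\<lambda>\<omega>. r k * (g k \<omega>)\<^sup>2) \<in> borel_measurable M" if "\<And>k. l k = 0 \<Longrightarrow> r k = 0" for r :: "nat \<Rightarrow> real" and k
    using g_measurable[of k] that[of k] I by (cases "l k = 0") auto
  have meas: "(\<lambda>\<omega>. ennreal (exp (- (\<Sum>k<n. r k * (g k \<omega>)\<^sup>2) / 2))) \<in> borel_measurable M"
    if "\<And>k. l k = 0 \<Longrightarrow> r k = 0" for r n
  proof -
    have [measurable]: "(\<lambda>\<omega>. \<Sum>k<n. r k * (g k \<omega>)\<^sup>2) \<in> borel_measurable M"
      using gm[OF that] by (intro borel_measurable_sum)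
    show ?thesis by measurable
  qed
  have Ym [measurable]: "Y n \<in> borel_measurable M" for n unfolding Y_def by (rule meas) (use m in auto)
  have incY: "incseq Y"
  proof (rule incseq_SucI, rule le_funI)
    fix n \<omega>
    show "Y n \<omega> \<le> Y (Suc n) \<omega>"
      using mult_right_mono[OF m(3)[of n], of "(g n \<omega>)\<^sup>2"] by (simp add: Y_def ennreal_leI)
  qed
  define C where "C = (\<Sum>k. \<bar>ln (1 + m k)\<bar>)"
  have asm: "summable (\<lambda>k. \<bar>ln (1 + m k)\<bar>)" using ln_one_plus_abs_summable[OF sm] .
  have "(\<integral>\<^sup>+\<omega>. (SUP n. Y n \<omega>) \<partial>M) = (SUP n. \<integral>\<^sup>+\<omega>. Y n \<omega> \<partial>M)"
    using incY by (intro nn_integral_monotone_convergence_SUP) auto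
  also have "\<dots> \<le> ennreal (exp C)"
  proof (rule SUP_least)
    fix n
    have "- (\<Sum>k<n. ln (1 + m k)) / 2 \<le> C"
    proof -
      have "- (\<Sum>k<n. ln (1 + m k)) \<le> (\<Sum>k<n. \<bar>ln (1 + m k)\<bar>)"
        unfolding sum_negf[symmetric] by (intro sum_mono) auto
      also have "\<dots> \<le> C" unfolding C_def using asm by (intro sum_le_suminf) auto
      finally show ?thesis using suminf_nonneg[OF asm] by (simp add: C_def)
    qed
    then show "(\<integral>\<^sup>+\<omega>. Y n \<omega> \<partial>M) \<le> ennreal (exp C)"
      unfolding Y_def by (subst partial) (use m in \<open>auto intro!: ennreal_leI\<close>)
  qed
  also have "\<dots> < \<infinity>" by simp
  finally have fin: "(\<integral>\<^sup>+\<omega>. (SUP n. Y n \<omega>) \<partial>M) < \<infinity>" .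
  have "(\<lambda>n. \<integral>\<^sup>+\<omega>. ennreal (exp (- (\<Sum>k<n. l k * (g k \<omega>)\<^sup>2) / 2)) \<partial>M) \<longlonglongrightarrow> (\<integral>\<^sup>+\<omega>. ennreal (exp (- Q \<omega> / 2)) \<partial>M)"
  proof (rule nn_integral_dominated_convergence[where w = "\<lambda>\<omega>. SUP n. Y n \<omega>"])
    show "(\<lambda>\<omega>. ennreal (exp (- (\<Sum>k<n. l k * (g k \<omega>)\<^sup>2) / 2))) \<in> borel_measurable M" for n by (rule meas)
    show "(\<lambda>\<omega>. ennreal (exp (- Q \<omega> / 2))) \<in> borel_measurable M" using Q by measurable
    show "AE \<omega> in M. ennreal (exp (- (\<Sum>k<n. l k * (g k \<omega>)\<^sup>2) / 2)) \<le> (SUP n. Y n \<omega>)" for n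
    proof (rule AE_I2)
      fix \<omega>
      have "(\<Sum>k<n. m k * (g k \<omega>)\<^sup>2) \<le> (\<Sum>k<n. l k * (g k \<omega>)\<^sup>2)"
        by (intro sum_mono mult_right_mono m) auto
      then have "ennreal (exp (- (\<Sum>k<n. l k * (g k \<omega>)\<^sup>2) / 2)) \<le> Y n \<omega>"
        unfolding Y_def by (intro ennreal_leI) simp
      also have "\<dots> \<le> (SUP n. Y n \<omega>)" by (rule SUP_upper) simp
      finally show "ennreal (exp (- (\<Sum>k<n. l k * (g k \<omega>)\<^sup>2) / 2)) \<le> (SUP n. Y n \<omega>)" .
    qed
    show "AE \<omega> in M. (\<lambda>n. ennreal (exp (- (\<Sum>k<n. l k * (g k \<omega>)\<^sup>2) / 2))) \<longlonglongrightarrow> ennreal (exp (- Q \<omega> / 2))"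
      using series by eventually_elim (auto simp: sums_def intro!: tendsto_intros)
  qed (use fin in auto)
  moreover have "(\<lambda>n. \<integral>\<^sup>+\<omega>. ennreal (exp (- (\<Sum>k<n. l k * (g k \<omega>)\<^sup>2) / 2)) \<partial>M) \<longlonglongrightarrow> ennreal (exp (- (\<Sum>k. ln (1 + l k)) / 2))"
  proof -
    have "summable (\<lambda>k. ln (1 + l k))" using ln_one_plus_abs_summable[OF sl] by (rule summable_rabs_cancel)
    then have "(\<lambda>n. \<Sum>k<n. ln (1 + l k)) \<longlonglongrightarrow> (\<Sum>k. ln (1 + l k))" by (rule summable_LIMSEQ)
    then have "(\<lambda>n. ennreal (exp (- (\<Sum>k<n. ln (1 + l k)) / 2))) \<longlonglongrightarrow> ennreal (exp (- (\<Sum>k. ln (1 + l k)) / 2))"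
      by (intro tendsto_intros) auto
    then show ?thesis using partial[OF l] by simp
  qed
  ultimately show ?thesis by (rule LIMSEQ_unique)
qed

end

section \<open>Volterra equations and step approximations\<close>

lemma integrable_restrict_IccD:
  fixes f :: "real \<Rightarrow> real"
  assumes "integrable (restrict_space lborel {a..b}) f"
  shows "f integrable_on {a..b}" "(\<integral>u. f u \<partial>restrict_space lborel {a..b}) = integral {a..b} f"
proof -
  have *: "set_integrable lborel {a..b} f"
    using assms by (simp add: set_integrable_def integrable_restrict_space)
  show "f integrable_on {a..b}" by (rule set_borel_integral_eq_integral(1)[OF *])
  show "(\<integral>u. f u \<partial>restrict_space lborel {a..b}) = integral {a..b} f"
    using set_borel_integral_eq_integral(2)[OF *] by (simp add: set_lebesgue_integral_def integral_restrict_space)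
qed

lemma integrable_restrict_Icc_continuous:
  fixes f :: "real \<Rightarrow> real"
  assumes "continuous_on {a..b} f"
  shows "integrable (restrict_space lborel {a..b}) f"
  using borel_integrable_atLeastAtMost'[OF assms]
  by (simp add: set_integrable_def integrable_restrict_space)

text \<open>Kernels cut off by a strict inequality become integrals over a closed subinterval; the
  two differ at one point only.\<close>

lemma integral_restrict_Icc_cut:
  fixes F :: "real \<Rightarrow> real"
  assumes F: "integrable (restrict_space lborel {a..b}) F" and y: "y \<in> {a..b}"
  shows "(\<integral>u. (if u < y then F u else 0) \<partial>restrict_space lborel {a..b}) = integral {a..y} F"
    and "(\<integral>u. (if y < u then F u else 0) \<partial>restrict_space lborel {a..b}) = integral {y..b} F"
proof -
  let ?N = "restrict_space lborel {a..b}"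
  have Fm [measurable]: "F \<in> borel_measurable ?N" using F by auto
  have id [measurable]: "(\<lambda>u. u) \<in> borel_measurable ?N" by (intro measurable_restrict_space1) simp
  have 1: "integrable ?N (\<lambda>u. if u < y then F u else 0)" "integrable ?N (\<lambda>u. if y < u then F u else 0)"
    by (rule Bochner_Integration.integrable_bound[OF F]; simp)+
  have "(\<integral>u. (if u < y then F u else 0) \<partial>?N) = integral {a..b} (\<lambda>u. if u < y then F u else 0)"
    by (rule integrable_restrict_IccD(2)[OF 1(1)])
  also have "\<dots> = integral {a..b} (\<lambda>u. if u \<in> {a..y} then F u else 0)"
    by (rule integral_spike[of "{y}"]) auto
  also have "\<dots> = integral ({a..y} \<inter> {a..b}) F" by (rule integral_restrict_Int)
  also have "{a..y} \<inter> {a..b} = {a..y}" using y by auto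
  finally show "(\<integral>u. (if u < y then F u else 0) \<partial>?N) = integral {a..y} F" .
  have "(\<integral>u. (if y < u then F u else 0) \<partial>?N) = integral {a..b} (\<lambda>u. if y < u then F u else 0)"
    by (rule integrable_restrict_IccD(2)[OF 1(2)])
  also have "\<dots> = integral {a..b} (\<lambda>u. if u \<in> {y..b} then F u else 0)"
    by (rule integral_spike[of "{y}"]) auto
  also have "\<dots> = integral ({y..b} \<inter> {a..b}) F" by (rule integral_restrict_Int)
  also have "{y..b} \<inter> {a..b} = {y..b}" using y by auto
  finally show "(\<integral>u. (if y < u then F u else 0) \<partial>?N) = integral {y..b} F" .
qed

text \<open>Variation of constants for the primitive of \<open>\<xi>\<close> instead of
  \<open>\<xi>\<close> itself. The driving path \<open>w\<close> enters by its values only, not by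
  increments or derivatives, so the solution depends continuously on \<open>w\<close> in the
  supremum norm.\<close>

lemma volterra_solution:
  fixes \<xi> w :: "real \<Rightarrow> real"
  assumes \<xi>: "continuous_on {0..y} \<xi>" and eq: "\<And>s. s \<in> {0..y} \<Longrightarrow> \<xi> s = w s + p * integral {0..s} \<xi>" and y: "0 \<le> y"
  shows "\<xi> y = w y + p * integral {0..y} (\<lambda>u. exp (p * (y - u)) * w u)"
proof -
  define Y where "Y s = integral {0..s} \<xi>" for s
  define \<Phi> where "\<Phi> u = exp (p * (y - u)) * Y u" for u
  have "(\<Phi> has_vector_derivative exp (p * (y - u)) * w u) (at u within {0..y})" if u: "u \<in> {0..y}" for u
  proof -
    have "(Y has_vector_derivative \<xi> u) (at u within {0..y})"
      unfolding Y_def by (rule integral_has_vector_derivative[OF \<xi> u])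
    then have "(Y has_real_derivative \<xi> u) (at u within {0..y})"
      by (simp add: has_real_derivative_iff_has_vector_derivative)
    then have "(\<Phi> has_real_derivative exp (p * (y - u)) * (- p) * Y u + exp (p * (y - u)) * \<xi> u) (at u within {0..y})"
      unfolding \<Phi>_def by (auto intro!: derivative_eq_intros)
    moreover have "exp (p * (y - u)) * (- p) * Y u + exp (p * (y - u)) * \<xi> u = exp (p * (y - u)) * w u"
      using eq[OF u] by (simp add: Y_def algebra_simps)
    ultimately show ?thesis by (simp add: has_real_derivative_iff_has_vector_derivative)
  qed
  then have "((\<lambda>u. exp (p * (y - u)) * w u) has_integral (\<Phi> y - \<Phi> 0)) {0..y}"
    using y by (intro fundamental_theorem_of_calculus) auto
  then have "integral {0..y} (\<lambda>u. exp (p * (y - u)) * w u) = Y y"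
    by (simp add: \<Phi>_def Y_def integral_unique)
  then show ?thesis using eq[of y] y by (simp add: Y_def)
qed

text \<open>For \<open>s < t\<close>, the primitive of the indicator of \<open>[s, t)\<close>
  divided by its length: the building block of piecewise linear interpolation.\<close>

definition ramp :: "real \<Rightarrow> real \<Rightarrow> real \<Rightarrow> real" where
  "ramp s t u = max 0 (min 1 ((u - s) / (t - s)))"

lemma continuous_on_ramp [continuous_intros]: "continuous_on A (ramp s t)"
  unfolding ramp_def by (cases "t = s") (auto intro!: continuous_intros)

lemma ramp_values:
  assumes "s < t"
  shows "u \<le> s \<Longrightarrow> ramp s t u = 0" "t \<le> u \<Longrightarrow> ramp s t u = 1" "s \<le> u \<Longrightarrow> u \<le> t \<Longrightarrow> ramp s t u = (u - s) / (t - s)"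
    "0 \<le> ramp s t u" "ramp s t u \<le> 1"
  using assms by (auto simp: ramp_def max_def min_def divide_simps)

lemma ramp_has_derivative:
  assumes "s < t" "u \<notin> {s, t}"
  shows "(ramp s t has_real_derivative (if s \<le> u \<and> u < t then 1 / (t - s) else 0)) (at u)"
proof -
  consider "u < s" | "s < u" "u < t" | "t < u" using assms by fastforce
  then show ?thesis
  proof cases
    case 1
    have "(ramp s t has_real_derivative 0) (at u)"
      by (rule has_field_derivative_transform_within_open[of "\<lambda>_. 0" _ _ "{..<s}"])
        (use 1 assms ramp_values in auto)
    then show ?thesis using 1 by simp
  next
    case 2
    have "(ramp s t has_real_derivative 1 / (t - s)) (at u)"
      by (rule has_field_derivative_transform_within_open[of "\<lambda>u. (u - s) / (t - s)" _ _ "{s<..<t}"])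
        (use 2 assms ramp_values(3) in \<open>auto intro!: derivative_eq_intros\<close>)
    then show ?thesis using 2 by simp
  next
    case 3
    have "(ramp s t has_real_derivative 0) (at u)"
      by (rule has_field_derivative_transform_within_open[of "\<lambda>_. 1" _ _ "{t<..}"])
        (use 3 assms ramp_values in auto)
    then show ?thesis using 3 by simp
  qed
qed

text \<open>Integration by parts against the ramp, which is differentiable off \<open>s\<close> and
  \<open>t\<close>. The right side is the formula of \<open>volterra_solution\<close> with the ramp
  as driving path, so step forcing and rough forcing become comparable.\<close>

lemma ramp_convolution:
  assumes st: "0 \<le> s" "s < t" and y: "0 \<le> y"
  shows "integral {0..y} (\<lambda>u. if s \<le> u \<and> u < t then exp (p * (y - u)) / (t - s) else 0)
    = ramp s t y + p * integral {0..y} (\<lambda>u. exp (p * (y - u)) * ramp s t u)"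
proof -
  define \<Phi> where "\<Phi> u = exp (p * (y - u)) * ramp s t u" for u
  have \<Phi>c: "continuous_on {0..y} \<Phi>" unfolding \<Phi>_def by (intro continuous_intros)
  have 1: "((\<lambda>u. (if s \<le> u \<and> u < t then exp (p * (y - u)) / (t - s) else 0) - p * \<Phi> u) has_integral (\<Phi> y - \<Phi> 0)) {0..y}"
  proof (rule fundamental_theorem_of_calculus_strong[of "{s, t}"])
    fix u assume u: "u \<in> {0..y} - {s, t}"
    have "(\<Phi> has_real_derivative exp (p * (y - u)) * (- p) * ramp s t u + exp (p * (y - u)) * (if s \<le> u \<and> u < t then 1 / (t - s) else 0)) (at u)"
      unfolding \<Phi>_def using u ramp_has_derivative[OF st(2), of u] by (auto intro!: derivative_eq_intros)
    moreover have "exp (p * (y - u)) * (- p) * ramp s t u + exp (p * (y - u)) * (if s \<le> u \<and> u < t then 1 / (t - s) else 0)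
      = (if s \<le> u \<and> u < t then exp (p * (y - u)) / (t - s) else 0) - p * \<Phi> u"
      by (auto simp: \<Phi>_def)
    ultimately show "(\<Phi> has_vector_derivative (if s \<le> u \<and> u < t then exp (p * (y - u)) / (t - s) else 0) - p * \<Phi> u) (at u)"
      by (simp only: has_real_derivative_iff_has_vector_derivative)
  qed (use y \<Phi>c in auto)
  have 2: "((\<lambda>u. p * \<Phi> u) has_integral (p * integral {0..y} \<Phi>)) {0..y}"
    using integrable_integral[OF integrable_continuous_interval[OF \<Phi>c]] by (rule has_integral_mult_right)
  have "((\<lambda>u. if s \<le> u \<and> u < t then exp (p * (y - u)) / (t - s) else 0) has_integral (\<Phi> y - \<Phi> 0 + p * integral {0..y} \<Phi>)) {0..y}"
    using has_integral_add[OF 1 2] by (simp only: diff_add_cancel)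
  then show ?thesis using st ramp_values(1)[OF st(2), of 0] by (simp add: \<Phi>_def[abs_def] integral_unique)
qed

text \<open>The sum telescopes up to the cell containing \<open>u\<close>. One
  \<open>\<epsilon>\<close> pays for moving from the left end of the cell to \<open>u\<close>, the
  other for the partial increment within the cell.\<close>

lemma piecewise_linear_approx:
  fixes w :: "real \<Rightarrow> real"
  assumes m: "0 < m" and h: "h = x / real m" and x: "0 < x" and w0: "w 0 = 0"
    and osc: "\<And>s t. s \<in> {0..x} \<Longrightarrow> t \<in> {0..x} \<Longrightarrow> \<bar>s - t\<bar> \<le> h \<Longrightarrow> \<bar>w s - w t\<bar> \<le> \<epsilon>"
    and u: "u \<in> {0..x}"
  shows "\<bar>(\<Sum>j<m. (w (real (Suc j) * h) - w (real j * h)) * ramp (real j * h) (real (Suc j) * h) u) - w u\<bar> \<le> 2 * \<epsilon>"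
proof -
  have h0: "0 < h" "real m * h = x" using m x by (auto simp: h)
  \<comment> \<open>Index of the cell of \<open>u\<close>; the cap at \<open>m - 1\<close> puts the
    right end point \<open>u = x\<close> into the last cell.\<close>
  define J where "J = min (nat \<lfloor>u / h\<rfloor>) (m - 1)"
  have J: "J < m" using m by (simp add: J_def min_less_iff_disj)
  have uh: "0 \<le> u / h" using u h0 by simp
  have J1: "real J * h \<le> u"
  proof -
    have "real J \<le> real (nat \<lfloor>u / h\<rfloor>)" by (simp add: J_def)
    also have "\<dots> \<le> u / h" using uh by simp
    finally show ?thesis using h0(1) by (simp only: pos_le_divide_eq)
  qed
  have J2: "u \<le> real (Suc J) * h"
  proof (cases "nat \<lfloor>u / h\<rfloor> \<le> m - 1")
    case True
    have "u / h \<le> real (nat \<lfloor>u / h\<rfloor>) + 1" using uh by linarith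
    then have "u / h \<le> real (Suc J)" using True by (simp add: J_def)
    then show ?thesis using h0(1) by (simp only: pos_divide_le_eq)
  next
    case False
    then have "Suc J = m" using m by (simp add: J_def)
    then show ?thesis using h0 u by simp
  qed
  define \<Delta> where "\<Delta> j = w (real (Suc j) * h) - w (real j * h)" for j
  have lt: "real j * h < real (Suc j) * h" for j using h0 by simp
  have "(\<Sum>j<m. \<Delta> j * ramp (real j * h) (real (Suc j) * h) u) = (\<Sum>j<m. if j < J then \<Delta> j else if j = J then \<Delta> J * ramp (real J * h) (real (Suc J) * h) u else 0)"
  proof (rule sum.cong)
    fix j
    have "ramp (real j * h) (real (Suc j) * h) u = 1" if "j < J"
    proof -
      have "real (Suc j) * h \<le> real J * h" using that h0 by (intro mult_right_mono) auto
      then show ?thesis using J1 ramp_values(2)[OF lt] by simp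
    qed
    moreover have "ramp (real j * h) (real (Suc j) * h) u = 0" if "J < j"
    proof -
      have "real (Suc J) * h \<le> real j * h" using that h0 by (intro mult_right_mono) auto
      then show ?thesis using J2 ramp_values(1)[OF lt] by simp
    qed
    ultimately show "\<Delta> j * ramp (real j * h) (real (Suc j) * h) u = (if j < J then \<Delta> j else if j = J then \<Delta> J * ramp (real J * h) (real (Suc J) * h) u else 0)"
      by (cases j J rule: linorder_cases) auto
  qed simp
  also have "\<dots> = (\<Sum>j<Suc J. if j < J then \<Delta> j else if j = J then \<Delta> J * ramp (real J * h) (real (Suc J) * h) u else 0)"
    using J by (intro sum.mono_neutral_right) auto
  also have "\<dots> = (\<Sum>j<J. \<Delta> j) + \<Delta> J * ramp (real J * h) (real (Suc J) * h) u"
    unfolding sum.lessThan_Suc by (intro arg_cong2[where f = "(+)"] sum.cong) auto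
  also have "(\<Sum>j<J. \<Delta> j) = w (real J * h)"
    unfolding \<Delta>_def using sum_lessThan_telescope[of "\<lambda>j. w (real j * h)" J] w0 by simp
  finally have eq: "(\<Sum>j<m. \<Delta> j * ramp (real j * h) (real (Suc j) * h) u) - w u
    = (w (real J * h) - w u) + \<Delta> J * ramp (real J * h) (real (Suc J) * h) u" by simp
  have in1: "real J * h \<in> {0..x}" "real (Suc J) * h \<in> {0..x}"
  proof -
    have "real (Suc J) * h \<le> real m * h" using J h0 by (intro mult_right_mono) auto
    then show "real J * h \<in> {0..x}" "real (Suc J) * h \<in> {0..x}" using h0 lt[of J] by auto
  qed
  have width: "real (Suc J) * h = real J * h + h" by (simp only: of_nat_Suc distrib_right mult_1_left add.commute)
  have "\<bar>w (real J * h) - w u\<bar> \<le> \<epsilon>"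
    using J1 J2 unfolding width by (intro osc in1 u) linarith
  moreover have "\<bar>\<Delta> J\<bar> \<le> \<epsilon>"
    unfolding \<Delta>_def using h0(1) by (intro osc in1) (simp add: distrib_right)
  moreover have "\<bar>\<Delta> J * ramp (real J * h) (real (Suc J) * h) u\<bar> \<le> \<bar>\<Delta> J\<bar> * 1"
    unfolding abs_mult using ramp_values(4,5)[OF lt, of J u] by (intro mult_left_mono) auto
  ultimately have "\<bar>(w (real J * h) - w u) + \<Delta> J * ramp (real J * h) (real (Suc J) * h) u\<bar> \<le> \<epsilon> + \<epsilon>"
    by (intro order_trans[OF abs_triangle_ineq] add_mono) auto
  then show ?thesis unfolding eq[unfolded \<Delta>_def] \<Delta>_def by simp
qed

text \<open>Both terms have the form of \<open>volterra_solution\<close>, for the interpolated and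
  the true path, so their difference is controlled by the uniform distance
  \<open>2 * \<epsilon>\<close> of the paths and the bound \<open>exp (\<bar>p\<bar> * x)\<close> on
  the kernel.\<close>

lemma step_convolution_approx:
  fixes w \<xi> :: "real \<Rightarrow> real"
  assumes m: "0 < m" and h: "h = x / real m" and x: "0 < x" and w0: "w 0 = 0"
    and osc: "\<And>s t. s \<in> {0..x} \<Longrightarrow> t \<in> {0..x} \<Longrightarrow> \<bar>s - t\<bar> \<le> h \<Longrightarrow> \<bar>w s - w t\<bar> \<le> \<epsilon>"
    and w: "continuous_on {0..x} w" and \<xi>: "continuous_on {0..x} \<xi>"
    and eq: "\<And>s. s \<in> {0..x} \<Longrightarrow> \<xi> s = w s + p * integral {0..s} \<xi>"
    and y: "y \<in> {0..x}"
  shows "\<bar>(\<Sum>j<m. (w (real (Suc j) * h) - w (real j * h)) *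
      integral {0..y} (\<lambda>u. if real j * h \<le> u \<and> u < real (Suc j) * h then exp (p * (y - u)) / h else 0)) - \<xi> y\<bar>
    \<le> 2 * \<epsilon> * (1 + \<bar>p\<bar> * x * exp (\<bar>p\<bar> * x))"
proof -
  have h0: "0 < h" using m x by (auto simp: h)
  define \<Delta> where "\<Delta> j = w (real (Suc j) * h) - w (real j * h)" for j
  define \<Theta> where "\<Theta> u = (\<Sum>j<m. \<Delta> j * ramp (real j * h) (real (Suc j) * h) u)" for u
  have \<Theta>: "\<bar>\<Theta> u - w u\<bar> \<le> 2 * \<epsilon>" if "u \<in> {0..x}" for u
    unfolding \<Theta>_def \<Delta>_def by (rule piecewise_linear_approx[OF m h x]) (use w0 osc that in auto)
  have \<epsilon>: "0 \<le> 2 * \<epsilon>" using \<Theta>[of 0] x by auto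
  have conv: "integral {0..y} (\<lambda>u. if real j * h \<le> u \<and> u < real (Suc j) * h then exp (p * (y - u)) / h else 0)
    = ramp (real j * h) (real (Suc j) * h) y + p * integral {0..y} (\<lambda>u. exp (p * (y - u)) * ramp (real j * h) (real (Suc j) * h) u)" for j
  proof -
    have width: "real (Suc j) * h - real j * h = h" by (simp add: algebra_simps)
    have "0 \<le> real j * h" "real j * h < real (Suc j) * h" "0 \<le> y" using h0 y by auto
    from ramp_convolution[OF this, of p] show ?thesis unfolding width .
  qed
  have ci: "(\<lambda>u. exp (p * (y - u)) * f u) integrable_on {0..y}" if "continuous_on {0..y} f" for f :: "real \<Rightarrow> real"
    by (intro integrable_continuous_interval continuous_intros that)
  have "(\<Sum>j<m. \<Delta> j * integral {0..y} (\<lambda>u. if real j * h \<le> u \<and> u < real (Suc j) * h then exp (p * (y - u)) / h else 0))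
    = \<Theta> y + p * (\<Sum>j<m. \<Delta> j * integral {0..y} (\<lambda>u. exp (p * (y - u)) * ramp (real j * h) (real (Suc j) * h) u))"
    unfolding conv by (simp add: \<Theta>_def distrib_left sum.distrib sum_distrib_left mult.left_commute)
  also have "(\<Sum>j<m. \<Delta> j * integral {0..y} (\<lambda>u. exp (p * (y - u)) * ramp (real j * h) (real (Suc j) * h) u))
    = integral {0..y} (\<lambda>u. exp (p * (y - u)) * \<Theta> u)"
  proof -
    have "integral {0..y} (\<lambda>u. exp (p * (y - u)) * \<Theta> u) = integral {0..y} (\<lambda>u. \<Sum>j<m. \<Delta> j * (exp (p * (y - u)) * ramp (real j * h) (real (Suc j) * h) u))"
      by (simp add: \<Theta>_def sum_distrib_left mult.left_commute)
    also have "\<dots> = (\<Sum>j<m. integral {0..y} (\<lambda>u. \<Delta> j * (exp (p * (y - u)) * ramp (real j * h) (real (Suc j) * h) u)))"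
      by (rule integral_sum) (auto intro!: integrable_on_mult_right ci continuous_intros)
    finally show ?thesis by simp
  qed
  finally have s: "(\<Sum>j<m. \<Delta> j * integral {0..y} (\<lambda>u. if real j * h \<le> u \<and> u < real (Suc j) * h then exp (p * (y - u)) / h else 0))
    = \<Theta> y + p * integral {0..y} (\<lambda>u. exp (p * (y - u)) * \<Theta> u)" .
  have v: "\<xi> y = w y + p * integral {0..y} (\<lambda>u. exp (p * (y - u)) * w u)"
  proof (rule volterra_solution)
    have "{0..y} \<subseteq> {0..x}" using y by auto
    then show "continuous_on {0..y} \<xi>" using continuous_on_subset[OF \<xi>] by blast
  qed (use eq y in auto)
  have d: "(\<Sum>j<m. \<Delta> j * integral {0..y} (\<lambda>u. if real j * h \<le> u \<and> u < real (Suc j) * h then exp (p * (y - u)) / h else 0)) - \<xi> y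
    = (\<Theta> y - w y) + p * (integral {0..y} (\<lambda>u. exp (p * (y - u)) * \<Theta> u) - integral {0..y} (\<lambda>u. exp (p * (y - u)) * w u))"
    unfolding s v by (simp add: algebra_simps)
  have \<Theta>c: "continuous_on {0..y} \<Theta>" unfolding \<Theta>_def by (intro continuous_intros)
  have sub: "{0..y} \<subseteq> {0..x}" using y by auto
  have wc: "continuous_on {0..y} w" using continuous_on_subset[OF w sub] .
  have "integral {0..y} (\<lambda>u. exp (p * (y - u)) * \<Theta> u) - integral {0..y} (\<lambda>u. exp (p * (y - u)) * w u)
    = integral {0..y} (\<lambda>u. exp (p * (y - u)) * (\<Theta> u - w u))"
    using ci[OF \<Theta>c] ci[OF wc] by (simp add: Henstock_Kurzweil_Integration.integral_diff[symmetric] right_diff_distrib)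
  also have "\<bar>\<dots>\<bar> \<le> exp (\<bar>p\<bar> * x) * (2 * \<epsilon>) * (y - 0)"
    unfolding real_norm_def[symmetric]
  proof (rule integral_bound)
    show "continuous_on {0..y} (\<lambda>u. exp (p * (y - u)) * (\<Theta> u - w u))" by (intro continuous_intros \<Theta>c wc)
    show "norm (exp (p * (y - u)) * (\<Theta> u - w u)) \<le> exp (norm p * x) * (2 * \<epsilon>)" if "u \<in> {0..y}" for u
    proof -
      have "p * (y - u) \<le> \<bar>p\<bar> * x" using that y by (intro mult_mono) auto
      then have "exp (p * (y - u)) \<le> exp (\<bar>p\<bar> * x)" by simp
      moreover have "\<bar>\<Theta> u - w u\<bar> \<le> 2 * \<epsilon>" using that sub by (intro \<Theta>) auto
      ultimately show ?thesis unfolding real_norm_def abs_mult abs_exp_cancel by (intro mult_mono) auto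
    qed
  qed (use y in simp)
  also have "\<dots> \<le> exp (\<bar>p\<bar> * x) * (2 * \<epsilon>) * x" using y \<epsilon> by (intro mult_left_mono) auto
  finally have "\<bar>p * (integral {0..y} (\<lambda>u. exp (p * (y - u)) * \<Theta> u) - integral {0..y} (\<lambda>u. exp (p * (y - u)) * w u))\<bar> \<le> \<bar>p\<bar> * (exp (\<bar>p\<bar> * x) * (2 * \<epsilon>) * x)"
    unfolding abs_mult by (intro mult_left_mono) auto
  then have "\<bar>(\<Theta> y - w y) + p * (integral {0..y} (\<lambda>u. exp (p * (y - u)) * \<Theta> u) - integral {0..y} (\<lambda>u. exp (p * (y - u)) * w u))\<bar>
    \<le> 2 * \<epsilon> + \<bar>p\<bar> * (exp (\<bar>p\<bar> * x) * (2 * \<epsilon>) * x)"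
    by (intro order_trans[OF abs_triangle_ineq] add_mono \<Theta>[OF y])
  also have "2 * \<epsilon> + \<bar>p\<bar> * (exp (\<bar>p\<bar> * x) * (2 * \<epsilon>) * x) = 2 * \<epsilon> * (1 + \<bar>p\<bar> * x * exp (\<bar>p\<bar> * x))"
    by (simp only: distrib_left mult_1_right ac_simps)
  finally show ?thesis unfolding \<Delta>_def[symmetric] d .
qed

section \<open>The kernel of the Ornstein-Uhlenbeck functional\<close>

locale ou_kernel =
  fixes p c :: "real^'n" and a x :: real and G :: "real^'n^'n"
  assumes x_pos: "0 < x" and G_sym: "\<And>i j. G $ i $ j = G $ j $ i"
begin

abbreviation \<mu> :: "(real \<times> 'n) measure" where "\<mu> \<equiv> Delta_measure x"
abbreviation \<nu>0 :: "real measure" where "\<nu>0 \<equiv> restrict_space lborel {0..x}"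

text \<open>Kernel of \<open>f \<mapsto> a * (c \<bullet> \<xi> y)\<close>, where component
  \<open>i\<close> of \<open>\<xi> y\<close> is the integral of
  \<open>exp (p $ i * (y - u)) * f (u, i)\<close> over \<open>u < y\<close>, that is,
  \<open>\<xi>' = D \<xi> + f\<close> with \<open>\<xi> 0 = 0\<close>.\<close>

definition hh :: "real \<Rightarrow> real \<times> 'n \<Rightarrow> real" where
  "hh y \<eta> = (if fst \<eta> < y then a * c $ snd \<eta> * exp (p $ snd \<eta> * (y - fst \<eta>)) else 0)"

text \<open>Kernel of \<open>f \<mapsto> \<xi> x $ i\<close> for the same linear equation.\<close>

definition kk :: "'n \<Rightarrow> real \<times> 'n \<Rightarrow> real" where
  "kk i \<eta> = (if snd \<eta> = i then exp (p $ i * (x - fst \<eta>)) else 0)"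

text \<open>One bound for both kernels: the summand 1 covers \<open>kk\<close>, which lacks the
  factor \<open>a * c\<close>, and the sum over components is a convenient maximum.\<close>

definition bd :: real where
  "bd = (\<Sum>j\<in>UNIV. (\<bar>a * c $ j\<bar> + 1) * exp (\<bar>p $ j\<bar> * x))"

lemma space_mu [simp]: "space \<mu> = {0..x} \<times> UNIV"
  by (simp add: Delta_measure_def space_pair_measure space_restrict_space)

lemma finite_nu0: "finite_measure \<nu>0"
  by (rule finite_measureI) (simp add: emeasure_restrict_space space_restrict_space emeasure_lborel_Icc_eq)

sublocale N: finite_measure \<nu>0 by (rule finite_nu0)
sublocale Cn: finite_measure "count_space (UNIV :: 'n set)" by (rule finite_measure_count_space) simp
sublocale P: pair_sigma_finite \<nu>0 "count_space (UNIV :: 'n set)" ..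

lemma finite_Delta: "finite_measure \<mu>"
  unfolding Delta_measure_def using finite_measure_pair_measure[OF Cn.finite_measure_axioms finite_nu0] .

lemma measurable_Delta:
  assumes "\<And>i. (\<lambda>u. f (u, i)) \<in> borel_measurable \<nu>0"
  shows "f \<in> borel_measurable \<mu>"
proof -
  have "(\<lambda>z. f (snd z, fst z)) \<in> borel_measurable (count_space UNIV \<Otimes>\<^sub>M \<nu>0)"
    using assms by (intro measurable_pair_measure_countable1) (auto intro: countable_finite)
  from measurable_compose[OF measurable_pair_swap' this] show ?thesis
    by (simp add: Delta_measure_def split_beta')
qed

lemma measurable_section: "f \<in> borel_measurable \<mu> \<Longrightarrow> (\<lambda>u. f (u, i)) \<in> borel_measurable \<nu>0"
  unfolding Delta_measure_def by (rule measurable_Pair1) auto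

lemma integral_Delta:
  fixes f :: "real \<times> 'n \<Rightarrow> real"
  assumes "integrable \<mu> f"
  shows "(\<integral>\<eta>. f \<eta> \<partial>\<mu>) = (\<Sum>i\<in>UNIV. \<integral>u. f (u, i) \<partial>\<nu>0)"
  using P.integral_snd[of "\<lambda>u i. f (u, i)"] assms
  by (simp add: Delta_measure_def lebesgue_integral_count_space_finite)

lemma fst_measurable [measurable]: "fst \<in> borel_measurable \<mu>"
  by (rule measurable_Delta) (simp add: measurable_restrict_space1)

lemma bd_term: "(\<bar>a * c $ j\<bar> + 1) * exp (\<bar>p $ j\<bar> * x) \<le> bd"
  unfolding bd_def by (rule member_le_sum) auto

lemma exp_bound: "u \<in> {0..x} \<Longrightarrow> y \<in> {0..x} \<Longrightarrow> u \<le> y \<Longrightarrow> exp (p $ j * (y - u)) \<le> exp (\<bar>p $ j\<bar> * x)"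
  by (auto intro!: mult_mono)

lemma hh_bound: "y \<in> {0..x} \<Longrightarrow> \<eta> \<in> space \<mu> \<Longrightarrow> \<bar>hh y \<eta>\<bar> \<le> bd"
proof -
  assume y: "y \<in> {0..x}" and \<eta>: "\<eta> \<in> space \<mu>"
  let ?j = "snd \<eta>"
  have "\<bar>hh y \<eta>\<bar> \<le> (\<bar>a * c $ ?j\<bar> + 1) * exp (\<bar>p $ ?j\<bar> * x)"
    using exp_bound[of "fst \<eta>" y ?j] y \<eta> by (auto simp: hh_def abs_mult intro!: mult_mono)
  then show ?thesis using bd_term[of ?j] by linarith
qed

lemma kk_bound: "\<eta> \<in> space \<mu> \<Longrightarrow> \<bar>kk i \<eta>\<bar> \<le> bd"
proof -
  assume \<eta>: "\<eta> \<in> space \<mu>"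
  have "\<bar>kk i \<eta>\<bar> \<le> 1 * exp (\<bar>p $ i\<bar> * x)"
    using exp_bound[of "fst \<eta>" x i] \<eta> x_pos by (auto simp: kk_def)
  also have "\<dots> \<le> (\<bar>a * c $ i\<bar> + 1) * exp (\<bar>p $ i\<bar> * x)" by (intro mult_right_mono) auto
  finally show ?thesis using bd_term[of i] by linarith
qed

lemma id_measurable [measurable]: "(\<lambda>u. u) \<in> borel_measurable \<nu>0"
  by (intro measurable_restrict_space1) simp

lemma hh_measurable: "case_prod hh \<in> borel_measurable (\<nu>0 \<Otimes>\<^sub>M \<mu>)"
proof -
  have [measurable]: "(\<lambda>\<eta>. a * c $ snd \<eta>) \<in> borel_measurable \<mu>" "(\<lambda>\<eta>. p $ snd \<eta>) \<in> borel_measurable \<mu>"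
    by (rule measurable_Delta; simp)+
  show ?thesis unfolding hh_def by measurable
qed

lemma kk_measurable: "kk i \<in> borel_measurable \<mu>"
  unfolding kk_def by (rule measurable_Delta, unfold fst_conv snd_conv, measurable)

lemma hh_section_measurable: "y \<in> {0..x} \<Longrightarrow> hh y \<in> borel_measurable \<mu>"
  using measurable_Pair2[OF hh_measurable, of y] by (simp add: space_restrict_space)

lemma hh_tendsto:
  assumes "z \<longlonglongrightarrow> y" "fst \<eta> \<noteq> y"
  shows "(\<lambda>n. hh (z n) \<eta>) \<longlonglongrightarrow> hh y \<eta>"
proof (cases "fst \<eta> < y")
  case True
  then have "\<forall>\<^sub>F n in sequentially. fst \<eta> < z n" using order_tendstoD(1)[OF assms(1)] by simp
  then have ev: "\<forall>\<^sub>F n in sequentially. a * c $ snd \<eta> * exp (p $ snd \<eta> * (z n - fst \<eta>)) = hh (z n) \<eta>"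
    by eventually_elim (simp add: hh_def)
  have "(\<lambda>n. a * c $ snd \<eta> * exp (p $ snd \<eta> * (z n - fst \<eta>))) \<longlonglongrightarrow> a * c $ snd \<eta> * exp (p $ snd \<eta> * (y - fst \<eta>))"
    by (intro tendsto_intros assms)
  then show ?thesis using True ev by (simp add: hh_def tendsto_cong)
next
  case False
  then have "y < fst \<eta>" using assms by simp
  then have "\<forall>\<^sub>F n in sequentially. z n < fst \<eta>" using order_tendstoD(2)[OF assms(1)] by simp
  then have "\<forall>\<^sub>F n in sequentially. hh (z n) \<eta> = hh y \<eta>"
    by (rule eventually_mono) (use False in \<open>simp add: hh_def\<close>)
  then show ?thesis by (rule tendsto_eventually)
qed

lemma AE_nu0_neq: "AE u in \<nu>0. u \<noteq> (y :: real)"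
proof -
  have "AE u in lborel. u \<noteq> y" by (rule AE_lborel_singleton)
  then show ?thesis by (subst AE_restrict_space_iff) auto
qed

lemma AE_Delta_neq: "AE \<eta> in \<mu>. fst \<eta> \<noteq> (y :: real)"
proof -
  have "AE u in \<nu>0. AE i in count_space (UNIV :: 'n set). fst (u, i) \<noteq> y"
    using AE_nu0_neq[of y] by eventually_elim simp
  moreover have "{\<eta> \<in> space \<mu>. fst \<eta> \<noteq> y} \<in> sets \<mu>" by measurable
  ultimately show ?thesis unfolding Delta_measure_def by (intro P.AE_pair_measure)
qed

text \<open>\<open>hh y\<close> jumps at time \<open>y\<close>, so continuity in \<open>y\<close>
  fails pointwise on that slice. The slice is null, and dominated convergence along a hypothetical
  bad sequence gives the contradiction.\<close>

lemma hh_L2_continuous: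
  assumes y: "y \<in> {0..x}" and e: "0 < e"
  shows "\<exists>d>0. \<forall>z\<in>{0..x}. \<bar>y - z\<bar> < d \<longrightarrow> real_ip \<mu> (hh y - hh z) (hh y - hh z) < e"
proof (rule ccontr)
  assume neg: "\<not> ?thesis"
  have "\<exists>z\<in>{0..x}. \<bar>y - z\<bar> < 1 / Suc n \<and> e \<le> real_ip \<mu> (hh y - hh z) (hh y - hh z)" for n
  proof -
    have "0 < 1 / real (Suc n)" by simp
    then show ?thesis using neg by (meson not_le)
  qed
  then obtain z where z: "\<And>n. z n \<in> {0..x}" "\<And>n. \<bar>y - z n\<bar> < 1 / Suc n"
    "\<And>n. e \<le> real_ip \<mu> (hh y - hh (z n)) (hh y - hh (z n))" by metis
  have "(\<lambda>n. z n - y) \<longlonglongrightarrow> 0"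
  proof (rule Lim_null_comparison)
    show "\<forall>\<^sub>F n in sequentially. norm (z n - y) \<le> inverse (real (Suc n))"
      using z(2) by (auto intro!: always_eventually simp: abs_minus_commute inverse_eq_divide less_imp_le)
  qed (rule LIMSEQ_inverse_real_of_nat)
  then have zy: "z \<longlonglongrightarrow> y" by (simp add: LIM_zero_iff)
  have "(\<lambda>n. real_ip \<mu> (hh y - hh (z n)) (hh y - hh (z n))) \<longlonglongrightarrow> (\<integral>\<eta>. (0::real) \<partial>\<mu>)"
    unfolding real_ip_def
  proof (rule integral_dominated_convergence[where w = "\<lambda>_. (2 * bd) * (2 * bd)"])
    show "(\<lambda>\<eta>. (hh y - hh (z n)) \<eta> * (hh y - hh (z n)) \<eta>) \<in> borel_measurable \<mu>" for n
      using hh_section_measurable[OF y] hh_section_measurable[OF z(1)] by simp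
    show "integrable \<mu> (\<lambda>_. (2 * bd) * (2 * bd))" using finite_Delta by (rule finite_measure.integrable_const)
    show "AE \<eta> in \<mu>. (\<lambda>n. (hh y - hh (z n)) \<eta> * (hh y - hh (z n)) \<eta>) \<longlonglongrightarrow> 0"
      using AE_Delta_neq[of y]
    proof eventually_elim
      case (elim \<eta>)
      have "(\<lambda>n. hh y \<eta> - hh (z n) \<eta>) \<longlonglongrightarrow> hh y \<eta> - hh y \<eta>"
        by (intro tendsto_intros hh_tendsto[OF zy elim])
      then show ?case using tendsto_mult[of "\<lambda>n. hh y \<eta> - hh (z n) \<eta>" 0 sequentially "\<lambda>n. hh y \<eta> - hh (z n) \<eta>" 0] by simp
    qed
    fix n
    have "norm ((hh y - hh (z n)) \<eta> * (hh y - hh (z n)) \<eta>) \<le> (2 * bd) * (2 * bd)" if "\<eta> \<in> space \<mu>" for \<eta>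
    proof -
      have "\<bar>hh y \<eta> - hh (z n) \<eta>\<bar> \<le> 2 * bd"
        using hh_bound[OF y that] hh_bound[OF z(1) that, of n] by linarith
      then show ?thesis unfolding real_norm_def abs_mult by (intro mult_mono) auto
    qed
    then show "AE \<eta> in \<mu>. norm ((hh y - hh (z n)) \<eta> * (hh y - hh (z n)) \<eta>) \<le> (2 * bd) * (2 * bd)" by (rule AE_I2)
  qed simp
  then have "e \<le> 0" using z(3) by (intro LIMSEQ_le_const[where X = "\<lambda>n. real_ip \<mu> (hh y - hh (z n)) (hh y - hh (z n))"]) auto
  then show False using e by simp
qed

sublocale factored_kernel "Delta_measure x" x hh kk G bd
  by (rule factored_kernel.intro) (rule finite_Delta less_imp_le[OF x_pos] hh_measurable hh_bound kk_measurable kk_bound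
      G_sym hh_L2_continuous | assumption)+

text \<open>Both cut-offs hold exactly for \<open>y > max u v\<close>, so the
  \<open>y\<close>-integral of the product of exponentials is \<open>dexp\<close>, including its
  value \<open>x - max u v\<close> when \<open>p $ i + p $ j = 0\<close>. The end term comes out
  with the indices of \<open>G\<close> exchanged, which its symmetry repairs.\<close>

lemma kernel_factorization:
  assumes \<xi>: "\<xi> \<in> space \<mu>" and \<eta>: "\<eta> \<in> space \<mu>" and B: "B - diag p = G"
  shows "f2 a c p B x \<xi> \<eta> = (\<integral>y. hh y \<xi> * hh y \<eta> \<partial>\<nu>) - (\<Sum>i\<in>UNIV. \<Sum>j\<in>UNIV. G $ i $ j * kk i \<xi> * kk j \<eta>)"
proof -
  obtain v j u i where [simp]: "\<xi> = (v, j)" "\<eta> = (u, i)" by (cases \<xi>, cases \<eta>)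
  have vu: "v \<in> {0..x}" "u \<in> {0..x}" using \<xi> \<eta> by auto
  define s where "s = p $ i + p $ j"
  define C where "C = a\<^sup>2 * c $ i * c $ j * exp (- p $ i * u) * exp (- p $ j * v)"
  define w where "w = max u v"
  have w: "w \<in> {0..x}" using vu by (auto simp: w_def)
  have ex: "integral {w..x} (\<lambda>y. exp (s * y)) = dexp s x w"
  proof (cases "s = 0")
    case True
    then show ?thesis using w by (simp add: dexp_def)
  next
    case False
    have "((\<lambda>y. exp (s * y)) has_integral (exp (s * x) / s - exp (s * w) / s)) {w..x}"
      using w False by (intro fundamental_theorem_of_calculus)
        (auto simp: has_real_derivative_iff_has_vector_derivative[symmetric] intro!: derivative_eq_intros)
    then show ?thesis using False by (simp add: dexp_def integral_unique diff_divide_distrib)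
  qed
  have "hh y \<xi> * hh y \<eta> = (if w < y then C * exp (s * y) else 0)" for y
  proof (cases "w < y")
    case True
    have "exp (p $ j * (y - v)) * exp (p $ i * (y - u)) = exp (- p $ i * u) * exp (- p $ j * v) * exp (s * y)"
      by (simp add: exp_add[symmetric] s_def algebra_simps)
    then show ?thesis using True by (simp add: hh_def C_def w_def power2_eq_square)
  next
    case False
    then show ?thesis by (auto simp: hh_def w_def)
  qed
  then have "(\<integral>y. hh y \<xi> * hh y \<eta> \<partial>\<nu>) = (\<integral>y. (if w < y then C * exp (s * y) else 0) \<partial>\<nu>)" by simp
  also have "\<dots> = integral {w..x} (\<lambda>y. C * exp (s * y))"
    by (rule integral_restrict_Icc_cut(2)[OF integrable_restrict_Icc_continuous w]) (intro continuous_intros)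
  also have "\<dots> = C * dexp s x w" using ex by simp
  finally have 1: "(\<integral>y. hh y \<xi> * hh y \<eta> \<partial>\<nu>) = C * dexp s x w" .
  have "(\<Sum>i'\<in>UNIV. \<Sum>j'\<in>UNIV. G $ i' $ j' * kk i' \<xi> * kk j' \<eta>)
    = (\<Sum>i'\<in>UNIV. if i' = j then (\<Sum>j'\<in>UNIV. if j' = i then G $ j $ i * exp (p $ j * (x - v)) * exp (p $ i * (x - u)) else 0) else 0)"
    by (intro sum.cong) (auto simp: kk_def if_distrib cong: if_cong intro!: sum.cong sum.neutral)
  also have "\<dots> = G $ j $ i * exp (p $ j * (x - v)) * exp (p $ i * (x - u))"
    by simp
  also have "\<dots> = G $ i $ j * exp ((p $ i + p $ j) * x - u * p $ i - v * p $ j)"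
    using G_sym[of i j] by (simp add: exp_add[symmetric] mult.assoc algebra_simps)
  finally have 2: "(\<Sum>i'\<in>UNIV. \<Sum>j'\<in>UNIV. G $ i' $ j' * kk i' \<xi> * kk j' \<eta>) = G $ i $ j * exp ((p $ i + p $ j) * x - u * p $ i - v * p $ j)" .
  have 3: "(B - diag p) $ i $ j = G $ i $ j" by (simp only: B)
  show ?thesis unfolding 1 2 f2_def using 3 by (simp add: C_def s_def w_def)
qed

lemma obs_continuous:
  assumes f: "f \<in> real_L2 \<mu>"
  shows "continuous_on {0..x} (obs f)"
  unfolding continuous_on_iff
proof (intro ballI allI impI)
  fix y e :: real assume y: "y \<in> {0..x}" and e: "0 < e"
  \<comment> \<open>Adding 1 allows division even if \<open>f\<close> is null.\<close>
  define b where "b = real_ip \<mu> f f + 1"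
  have b: "0 < b" "real_ip \<mu> f f \<le> b" using ip_nonneg[OF f] by (auto simp: b_def)
  obtain d where d: "d > 0" "\<And>z. z \<in> {0..x} \<Longrightarrow> \<bar>y - z\<bar> < d \<Longrightarrow> real_ip \<mu> (hh y - hh z) (hh y - hh z) < e\<^sup>2 / b"
    using hh_L2_continuous[OF y, of "e\<^sup>2 / b"] e b by auto
  have "dist (obs f z) (obs f y) < e" if z: "z \<in> {0..x}" "dist z y < d" for z
  proof -
    have hz: "hh y - hh z \<in> real_L2 \<mu>" using y z by auto
    have "(obs f y - obs f z)\<^sup>2 = (real_ip \<mu> (hh y - hh z) f)\<^sup>2"
      using y z f by (simp add: obs_def ip_diff_left)
    also have "\<dots> \<le> real_ip \<mu> (hh y - hh z) (hh y - hh z) * real_ip \<mu> f f" by (rule CS_ip[OF hz f])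
    also have "\<dots> \<le> real_ip \<mu> (hh y - hh z) (hh y - hh z) * b" using ip_nonneg[OF hz] b by (intro mult_left_mono) auto
    also have "\<dots> < e\<^sup>2 / b * b" using d(2)[OF z(1)] z(2) b by (intro mult_strict_right_mono) (auto simp: dist_real_def abs_minus_commute)
    also have "\<dots> = e\<^sup>2" using b by simp
    finally have "\<bar>obs f y - obs f z\<bar>\<^sup>2 < e\<^sup>2" by simp
    then have "\<bar>obs f y - obs f z\<bar> < e" using e by (simp add: power2_less_imp_less)
    then show ?thesis by (simp add: dist_real_def abs_minus_commute)
  qed
  then show "\<exists>d>0. \<forall>z\<in>{0..x}. dist z y < d \<longrightarrow> dist (obs f z) (obs f y) < e" using d(1) by blast
qed

text \<open>Pulling \<open>exp (- p $ j * v)\<close> out of the kernel leaves an indefinite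
  integral. The purpose is continuity of eigenfunctions with nonzero eigenvalue, as
  \<open>e = T e / l\<close>; without it the calculus below would not apply to them.\<close>

lemma T_section_continuous:
  assumes f: "f \<in> real_L2 \<mu>"
  shows "continuous_on {0..x} (\<lambda>v. T f (v, j))"
proof -
  define F where "F v = exp (- p $ j * v) * integral {v..x} (\<lambda>y. a * c $ j * exp (p $ j * y) * obs f y)
      - (\<Sum>i\<in>UNIV. \<Sum>j'\<in>UNIV. G $ i $ j' * (if j = i then exp (p $ i * (x - v)) else 0) * obs_end f j')" for v
  have oc: "continuous_on {0..x} (\<lambda>y. a * c $ j * exp (p $ j * y) * obs f y)"
    by (intro continuous_intros obs_continuous f)
  have "continuous_on {0..x} (\<lambda>v. integral {v..x} (\<lambda>y. a * c $ j * exp (p $ j * y) * obs f y))"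
    by (rule indefinite_integral_continuous_1') (rule integrable_continuous_interval[OF oc])
  moreover have "continuous_on {0..x} (\<lambda>v. if j = i then exp (p $ i * (x - v)) else 0)" for i
    by (cases "j = i") (auto intro!: continuous_intros)
  ultimately have "continuous_on {0..x} F" unfolding F_def
    by (intro continuous_intros)
  moreover have "T f (v, j) = F v" if v: "v \<in> {0..x}" for v
  proof -
    have "hh y (v, j) * obs f y = (if v < y then exp (- p $ j * v) * (a * c $ j * exp (p $ j * y) * obs f y) else 0)" for y
      by (simp add: hh_def exp_add[symmetric] exp_diff exp_minus algebra_simps divide_inverse)
    then have "(\<integral>y. hh y (v, j) * obs f y \<partial>\<nu>) = (\<integral>y. (if v < y then exp (- p $ j * v) * (a * c $ j * exp (p $ j * y) * obs f y) else 0) \<partial>\<nu>)"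
      by simp
    also have "\<dots> = integral {v..x} (\<lambda>y. exp (- p $ j * v) * (a * c $ j * exp (p $ j * y) * obs f y))"
      by (rule integral_restrict_Icc_cut(2)[OF integrable_restrict_Icc_continuous v]) (intro continuous_intros oc)
    finally show ?thesis using v by (simp add: T_def adj_def F_def kk_def cong: if_cong)
  qed
  ultimately show ?thesis using continuous_on_eq[of "{0..x}" F "\<lambda>v. T f (v, j)"] by metis
qed

lemma eigenfunction_continuous:
  assumes e: "e \<in> real_L2 \<mu>" and Te: "T e = l *\<^sub>R e" and l: "l \<noteq> 0"
  shows "continuous_on {0..x} (\<lambda>u. e (u, i))"
proof -
  have "e (u, i) = (1 / l) * T e (u, i)" for u using l by (simp add: Te)
  then show ?thesis by (simp only:) (intro continuous_intros T_section_continuous e)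
qed

end

section \<open>Step functions on the partition\<close>

context ou_kernel
begin

text \<open>Time cell \<open>j\<close> in component \<open>i\<close>. The factor
  \<open>1 / sqrt (x / m)\<close> normalises it in \<open>L2\<close>; the same factor in
  \<open>incr\<close> makes the increments of a Wiener path standard normal.\<close>

definition cell :: "nat \<Rightarrow> nat \<times> 'n \<Rightarrow> real \<times> 'n \<Rightarrow> real" where
  "cell m = (\<lambda>(j, i) (v, i'). if i' = i \<and> real j * (x / m) \<le> v \<and> v < real (Suc j) * (x / m) then 1 / sqrt (x / m) else 0)"

definition cells :: "nat \<Rightarrow> (nat \<times> 'n) set" where "cells m = {..<m} \<times> UNIV"

definition incr :: "nat \<Rightarrow> (real \<Rightarrow> real^'n) \<Rightarrow> nat \<times> 'n \<Rightarrow> real" where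
  "incr m W = (\<lambda>(j, i). (W (real (Suc j) * (x / m)) - W (real j * (x / m))) $ i / sqrt (x / m))"

text \<open>The piecewise constant derivative of the piecewise linear interpolation of \<open>W\<close>.\<close>

definition stepf :: "nat \<Rightarrow> (real \<Rightarrow> real^'n) \<Rightarrow> real \<times> 'n \<Rightarrow> real" where
  "stepf m W = (\<Sum>q\<in>cells m. incr m W q *\<^sub>R cell m q)"

text \<open>The linear equation in integrated form and by components: it makes sense for a driving
  path without derivative and covers both Wiener paths and primitives of continuous
  functions.\<close>

definition path :: "(real \<Rightarrow> real^'n) \<Rightarrow> (real \<Rightarrow> real^'n) \<Rightarrow> bool" where
  "path W \<xi> \<longleftrightarrow> continuous_on {0..x} W \<and> continuous_on {0..x} \<xi> \<and> W 0 = 0 \<and>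
    (\<forall>s\<in>{0..x}. \<forall>i. \<xi> s $ i = W s $ i + p $ i * integral {0..s} (\<lambda>u. \<xi> u $ i))"

lemma finite_cells [simp]: "finite (cells m)" by (simp add: cells_def)

lemma cell_in [simp, intro]: "cell m q \<in> real_L2 \<mu>"
proof (rule bounded_in_real_L2[OF finite_Delta, where B = "\<bar>1 / sqrt (x / m)\<bar>"])
  obtain j i where q: "q = (j, i)" by (cases q)
  show "cell m q \<in> borel_measurable \<mu>"
    unfolding q cell_def by (rule measurable_Delta) simp
  show "\<bar>cell m q \<eta>\<bar> \<le> \<bar>1 / sqrt (x / m)\<bar>" for \<eta> unfolding q cell_def by (cases \<eta>) simp
qed

lemma stepf_in [simp, intro]: "stepf m W \<in> real_L2 \<mu>"
  unfolding stepf_def by auto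

lemma cell_integral:
  assumes m: "0 < m" and F: "continuous_on {0..x} F" and y: "y \<in> {0..x}"
  shows "(\<integral>u. (if u < y then F u * cell m (j, i) (u, i) else 0) \<partial>\<nu>)
    = sqrt (x / m) * integral {0..y} (\<lambda>u. if real j * (x / m) \<le> u \<and> u < real (Suc j) * (x / m) then F u / (x / m) else 0)"
proof -
  have h: "0 < x / m" using m x_pos by simp
  have i1: "integrable \<nu> (\<lambda>u. F u * cell m (j, i) (u, i))"
  proof (rule Bochner_Integration.integrable_bound[of _ "\<lambda>u. 1 / sqrt (x / m) * F u"])
    show "integrable \<nu> (\<lambda>u. 1 / sqrt (x / m) * F u)" using integrable_restrict_Icc_continuous[OF F] by simp
    show "(\<lambda>u. F u * cell m (j, i) (u, i)) \<in> borel_measurable \<nu>"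
      using borel_measurable_integrable[OF integrable_restrict_Icc_continuous[OF F]]
        measurable_section[OF real_L2_measurable[OF cell_in], of m "(j, i)" i] by (rule borel_measurable_times)
    show "AE u in \<nu>. norm (F u * cell m (j, i) (u, i)) \<le> norm (1 / sqrt (x / m) * F u)"
      by (simp add: cell_def abs_mult)
  qed
  have "(\<integral>u. (if u < y then F u * cell m (j, i) (u, i) else 0) \<partial>\<nu>) = integral {0..y} (\<lambda>u. F u * cell m (j, i) (u, i))"
    by (rule integral_restrict_Icc_cut(1)[OF i1 y])
  also have "\<dots> = integral {0..y} (\<lambda>u. sqrt (x / m) * (if real j * (x / m) \<le> u \<and> u < real (Suc j) * (x / m) then F u / (x / m) else 0))"
  proof (rule arg_cong[where f = "integral {0..y}"])
    have "1 / sqrt (x / m) = sqrt (x / m) / (x / m)"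
      using sqrt_divide_self_eq[of "x / m"] h by (simp only: inverse_eq_divide less_imp_le)
    then show "(\<lambda>u. F u * cell m (j, i) (u, i)) = (\<lambda>u. sqrt (x / m) * (if real j * (x / m) \<le> u \<and> u < real (Suc j) * (x / m) then F u / (x / m) else 0))"
      unfolding cell_def by (auto simp: fun_eq_iff)
  qed
  also have "\<dots> = sqrt (x / m) * integral {0..y} (\<lambda>u. if real j * (x / m) \<le> u \<and> u < real (Suc j) * (x / m) then F u / (x / m) else 0)"
    by (rule integral_mult_right)
  finally show ?thesis .
qed

lemma cell_orthonormal:
  assumes m: "0 < m" and q: "q \<in> cells m" and q': "q' \<in> cells m"
  shows "real_ip \<mu> (cell m q) (cell m q') = (if q = q' then 1 else 0)"
proof -
  define h where "h = x / m"
  have h: "0 < h" "real m * h = x" using m x_pos by (auto simp: h_def)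
  obtain j i where qq: "q = (j, i)" by (cases q)
  obtain j' i' where qq': "q' = (j', i')" by (cases q')
  show ?thesis
  proof (cases "q = q'")
    case False
    have zero: "cell m q \<eta> * cell m q' \<eta> = 0" for \<eta>
    proof (cases "j = j'")
      case True
      then show ?thesis using False by (cases \<eta>) (auto simp: qq qq' cell_def)
    next
      case False
      have "\<not> (real j * h \<le> v \<and> v < real (Suc j) * h \<and> real j' * h \<le> v \<and> v < real (Suc j') * h)" for v
      proof
        assume *: "real j * h \<le> v \<and> v < real (Suc j) * h \<and> real j' * h \<le> v \<and> v < real (Suc j') * h"
        have "real j * h < real (Suc j') * h" "real j' * h < real (Suc j) * h" using * by linarith+
        then have "real j < real (Suc j')" "real j' < real (Suc j)" using h(1) by (simp_all only: mult_less_cancel_right_pos)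
        then show False using False by simp
      qed
      then show ?thesis by (cases \<eta>) (auto simp: qq qq' cell_def h_def)
    qed
    show ?thesis unfolding real_ip_def zero using False by simp
  next
    case True
    have j: "j < m" using q by (simp add: qq cells_def)
    \<comment> \<open>The constant \<open>1 / h\<close> is written with the factor
      \<open>exp (0 * (x - u))\<close> so that \<open>ramp_convolution\<close> with exponent 0
      evaluates the integral.\<close>
    have sq: "cell m q (u, k) * cell m q (u, k) = (if k = i then (if real j * h \<le> u \<and> u < real (Suc j) * h then exp (0 * (x - u)) / (real (Suc j) * h - real j * h) else 0) else 0)" for u k
    proof -
      have w: "real (Suc j) * h - real j * h = h" by (simp add: distrib_right)
      have s2: "1 / sqrt h * (1 / sqrt h) = exp (0 * (x - u)) / h" using h(1) by simp
      show ?thesis unfolding qq cell_def h_def[symmetric] w s2[symmetric] by auto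
    qed
    have int: "integrable \<mu> (\<lambda>\<eta>. cell m q \<eta> * cell m q \<eta>)" by (intro integrable_mult_real_L2) auto
    have ii: "integrable \<nu> (\<lambda>u. cell m q (u, i) * cell m q (u, i))"
    proof (rule N.integrable_const_bound[where B = "\<bar>1 / sqrt (x / m) * (1 / sqrt (x / m))\<bar>"])
      show "(\<lambda>u. cell m q (u, i) * cell m q (u, i)) \<in> borel_measurable \<nu>"
        using measurable_section[OF real_L2_measurable[OF cell_in]] by (intro borel_measurable_times)
    qed (auto simp: qq cell_def)
    have "real_ip \<mu> (cell m q) (cell m q) = (\<Sum>k\<in>UNIV. \<integral>u. cell m q (u, k) * cell m q (u, k) \<partial>\<nu>)"
      unfolding real_ip_def by (rule integral_Delta[OF int])
    also have "\<dots> = (\<Sum>k\<in>UNIV. if k = i then (\<integral>u. cell m q (u, i) * cell m q (u, i) \<partial>\<nu>) else 0)"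
      by (intro sum.cong) (auto simp: sq)
    also have "\<dots> = integral {0..x} (\<lambda>u. cell m q (u, i) * cell m q (u, i))"
      using integrable_restrict_IccD(2)[OF ii] by simp
    also have "\<dots> = ramp (real j * h) (real (Suc j) * h) x + 0 * integral {0..x} (\<lambda>u. exp (0 * (x - u)) * ramp (real j * h) (real (Suc j) * h) u)"
      unfolding sq if_P[OF refl] using h x_pos by (intro ramp_convolution) auto
    also have "\<dots> = 1"
    proof -
      have "real (Suc j) * h \<le> real m * h" using j h(1) by (intro mult_right_mono) auto
      then show ?thesis using h ramp_values(2)[of "real j * h" "real (Suc j) * h" x] by simp
    qed
    finally show ?thesis using True by simp
  qed
qed

lemma obs_cell:
  assumes m: "0 < m" and y: "y \<in> {0..x}"
  shows "obs (cell m (j, i)) y = a * c $ i * (sqrt (x / m) *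
    integral {0..y} (\<lambda>u. if real j * (x / m) \<le> u \<and> u < real (Suc j) * (x / m) then exp (p $ i * (y - u)) / (x / m) else 0))"
proof -
  have int: "integrable \<mu> (\<lambda>\<eta>. hh y \<eta> * cell m (j, i) \<eta>)" using y by (intro integrable_mult_real_L2) auto
  have "obs (cell m (j, i)) y = (\<Sum>k\<in>UNIV. \<integral>u. hh y (u, k) * cell m (j, i) (u, k) \<partial>\<nu>)"
    unfolding obs_def real_ip_def by (rule integral_Delta[OF int])
  also have "\<dots> = (\<Sum>k\<in>UNIV. if k = i then (\<integral>u. (if u < y then (a * c $ i * exp (p $ i * (y - u))) * cell m (j, i) (u, i) else 0) \<partial>\<nu>) else 0)"
    by (intro sum.cong refl) (auto simp: hh_def cell_def intro!: Bochner_Integration.integral_cong)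
  also have "\<dots> = (\<integral>u. (if u < y then (a * c $ i * exp (p $ i * (y - u))) * cell m (j, i) (u, i) else 0) \<partial>\<nu>)" by simp
  also have "\<dots> = sqrt (x / m) * integral {0..y} (\<lambda>u. if real j * (x / m) \<le> u \<and> u < real (Suc j) * (x / m) then a * c $ i * exp (p $ i * (y - u)) / (x / m) else 0)"
    by (rule cell_integral[OF m _ y]) (intro continuous_intros)
  also have "(\<lambda>u. if real j * (x / m) \<le> u \<and> u < real (Suc j) * (x / m) then a * c $ i * exp (p $ i * (y - u)) / (x / m) else 0)
    = (\<lambda>u. (a * c $ i) * (if real j * (x / m) \<le> u \<and> u < real (Suc j) * (x / m) then exp (p $ i * (y - u)) / (x / m) else 0))"
    by (auto simp: fun_eq_iff)
  finally show ?thesis by simp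
qed

lemma obs_end_cell:
  assumes m: "0 < m"
  shows "obs_end (cell m (j, i)) k = (if k = i then sqrt (x / m) *
    integral {0..x} (\<lambda>u. if real j * (x / m) \<le> u \<and> u < real (Suc j) * (x / m) then exp (p $ i * (x - u)) / (x / m) else 0) else 0)"
proof -
  have int: "integrable \<mu> (\<lambda>\<eta>. kk k \<eta> * cell m (j, i) \<eta>)" by (intro integrable_mult_real_L2) auto
  have "obs_end (cell m (j, i)) k = (\<Sum>l\<in>UNIV. \<integral>u. kk k (u, l) * cell m (j, i) (u, l) \<partial>\<nu>)"
    unfolding obs_end_def real_ip_def by (rule integral_Delta[OF int])
  also have "\<dots> = (\<Sum>l\<in>UNIV. if l = i then (if k = i then (\<integral>u. exp (p $ i * (x - u)) * cell m (j, i) (u, i) \<partial>\<nu>) else 0) else 0)"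
    by (intro sum.cong refl) (auto simp: kk_def cell_def)
  also have "\<dots> = (if k = i then (\<integral>u. exp (p $ i * (x - u)) * cell m (j, i) (u, i) \<partial>\<nu>) else 0)" by simp
  also have "(\<integral>u. exp (p $ i * (x - u)) * cell m (j, i) (u, i) \<partial>\<nu>) = (\<integral>u. (if u < x then exp (p $ i * (x - u)) * cell m (j, i) (u, i) else 0) \<partial>\<nu>)"
  proof (rule integral_cong_AE)
    show "(\<lambda>u. exp (p $ i * (x - u)) * cell m (j, i) (u, i)) \<in> borel_measurable \<nu>"
      using measurable_section[OF real_L2_measurable[OF cell_in], of m "(j, i)" i] by measurable
    then show "(\<lambda>u. if u < x then exp (p $ i * (x - u)) * cell m (j, i) (u, i) else 0) \<in> borel_measurable \<nu>" by measurable
    have "AE u in \<nu>. u \<in> {0..x}" by (rule AE_I2) simp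
    with AE_nu0_neq[of x] show "AE u in \<nu>. exp (p $ i * (x - u)) * cell m (j, i) (u, i) = (if u < x then exp (p $ i * (x - u)) * cell m (j, i) (u, i) else 0)"
      by eventually_elim auto
  qed
  also have "\<dots> = sqrt (x / m) * integral {0..x} (\<lambda>u. if real j * (x / m) \<le> u \<and> u < real (Suc j) * (x / m) then exp (p $ i * (x - u)) / (x / m) else 0)"
    using x_pos by (intro cell_integral[OF m]) (auto intro!: continuous_intros)
  finally show ?thesis .
qed

text \<open>Component \<open>i\<close> at time \<open>y\<close> of the solution driven by the
  piecewise linear interpolation of \<open>W\<close>; \<open>obs\<close> and \<open>obs_end\<close>
  of \<open>stepf\<close> are expressed by it.\<close>

definition stepconv :: "nat \<Rightarrow> (real \<Rightarrow> real^'n) \<Rightarrow> 'n \<Rightarrow> real \<Rightarrow> real" where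
  "stepconv m W i y = (\<Sum>j<m. (W (real (Suc j) * (x / m)) $ i - W (real j * (x / m)) $ i) *
      integral {0..y} (\<lambda>u. if real j * (x / m) \<le> u \<and> u < real (Suc j) * (x / m) then exp (p $ i * (y - u)) / (x / m) else 0))"

lemma obs_stepf:
  assumes m: "0 < m" and y: "y \<in> {0..x}"
  shows "obs (stepf m W) y = (\<Sum>i\<in>UNIV. a * c $ i * stepconv m W i y)"
proof -
  have h: "0 < sqrt (x / m)" using m x_pos by simp
  have "obs (stepf m W) y = (\<Sum>q\<in>cells m. incr m W q * obs (cell m q) y)"
    using y unfolding obs_def stepf_def by (simp add: ip_sum_right ip_scale_right)
  also have "\<dots> = (\<Sum>j<m. \<Sum>i\<in>UNIV. incr m W (j, i) * obs (cell m (j, i)) y)"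
    unfolding cells_def by (simp add: sum.cartesian_product)
  also have "\<dots> = (\<Sum>i\<in>UNIV. \<Sum>j<m. incr m W (j, i) * obs (cell m (j, i)) y)" by (rule sum.swap)
  also have "\<dots> = (\<Sum>i\<in>UNIV. a * c $ i * stepconv m W i y)"
    unfolding stepconv_def sum_distrib_left
    by (intro sum.cong refl) (use h in \<open>simp add: obs_cell[OF m y] incr_def\<close>)
  finally show ?thesis .
qed

lemma obs_end_stepf:
  assumes m: "0 < m"
  shows "obs_end (stepf m W) k = stepconv m W k x"
proof -
  have h: "0 < sqrt (x / m)" using m x_pos by simp
  have "obs_end (stepf m W) k = (\<Sum>q\<in>cells m. incr m W q * obs_end (cell m q) k)"
    unfolding obs_end_def stepf_def by (simp add: ip_sum_right ip_scale_right)
  also have "\<dots> = (\<Sum>j<m. \<Sum>i\<in>UNIV. incr m W (j, i) * obs_end (cell m (j, i)) k)"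
    unfolding cells_def by (simp add: sum.cartesian_product)
  also have "\<dots> = (\<Sum>j<m. incr m W (j, k) * obs_end (cell m (j, k)) k)"
    by (intro sum.cong refl) (simp add: obs_end_cell[OF m] if_distrib cong: if_cong)
  also have "\<dots> = stepconv m W k x"
    unfolding stepconv_def
    by (intro sum.cong refl) (use h in \<open>simp add: obs_end_cell[OF m] incr_def\<close>)
  finally show ?thesis .
qed

text \<open>Error per unit of oscillation of the path, as delivered by
  \<open>step_convolution_approx\<close>.\<close>

definition K0 :: "'n \<Rightarrow> real" where "K0 i = 2 * (1 + \<bar>p $ i\<bar> * x * exp (\<bar>p $ i\<bar> * x))"

lemma stepconv_approx:
  assumes P: "path W \<xi>" and m: "0 < m" and y: "y \<in> {0..x}"
    and osc: "\<And>s t. s \<in> {0..x} \<Longrightarrow> t \<in> {0..x} \<Longrightarrow> \<bar>s - t\<bar> \<le> x / m \<Longrightarrow> norm (W s - W t) \<le> \<epsilon>"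
  shows "\<bar>stepconv m W i y - \<xi> y $ i\<bar> \<le> K0 i * \<epsilon>"
proof -
  have "\<bar>stepconv m W i y - \<xi> y $ i\<bar> \<le> 2 * \<epsilon> * (1 + \<bar>p $ i\<bar> * x * exp (\<bar>p $ i\<bar> * x))"
    unfolding stepconv_def
  proof (rule step_convolution_approx[OF m refl x_pos _ _ _ _ _ y, of "\<lambda>u. W u $ i" \<epsilon> "\<lambda>u. \<xi> u $ i" "p $ i"])
    show "\<bar>W s $ i - W t $ i\<bar> \<le> \<epsilon>" if "s \<in> {0..x}" "t \<in> {0..x}" "\<bar>s - t\<bar> \<le> x / m" for s t
      using osc[OF that] component_le_norm_cart[of "W s - W t" i] by simp
  qed (use P in \<open>auto simp: path_def intro!: continuous_intros\<close>)
  then show ?thesis by (simp add: K0_def ac_simps)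
qed

lemma path_bounded_osc:
  assumes P: "path W \<xi>"
  obtains b where "0 \<le> b" "\<And>s t. s \<in> {0..x} \<Longrightarrow> t \<in> {0..x} \<Longrightarrow> norm (W s - W t) \<le> b"
    "\<And>y. y \<in> {0..x} \<Longrightarrow> norm (\<xi> y) \<le> b"
proof -
  have "bounded (W ` {0..x})" "bounded (\<xi> ` {0..x})"
    using P by (auto simp: path_def intro!: compact_imp_bounded compact_continuous_image)
  then obtain b1 b2 where b: "\<forall>u\<in>{0..x}. norm (W u) \<le> b1" "\<forall>u\<in>{0..x}. norm (\<xi> u) \<le> b2"
    by (auto simp: bounded_iff)
  show ?thesis
  proof (rule that[of "max 0 (max (2 * b1) b2)"])
    show "norm (W s - W t) \<le> max 0 (max (2 * b1) b2)" if "s \<in> {0..x}" "t \<in> {0..x}" for s t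
      using b(1) that norm_triangle_ineq4[of "W s" "W t"] by (smt (verit) max.coboundedI2 max.cobounded1)
    show "norm (\<xi> y) \<le> max 0 (max (2 * b1) b2)" if "y \<in> {0..x}" for y
      using b(2) that by (auto simp: le_max_iff_disj)
  qed simp
qed

text \<open>The oscillation of \<open>W\<close> over the whole interval is a legitimate, if crude,
  \<open>\<epsilon>\<close> for every mesh at once; this gives the constant majorant for dominated
  convergence.\<close>

lemma stepconv_bound:
  assumes P: "path W \<xi>"
  shows "\<exists>b. \<forall>n i. \<forall>y\<in>{0..x}. \<bar>stepconv (Suc n) W i y\<bar> \<le> b"
proof -
  obtain b where b: "0 \<le> b" "\<And>s t. s \<in> {0..x} \<Longrightarrow> t \<in> {0..x} \<Longrightarrow> norm (W s - W t) \<le> b"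
    "\<And>y. y \<in> {0..x} \<Longrightarrow> norm (\<xi> y) \<le> b" using path_bounded_osc[OF P] by blast
  have K: "0 \<le> K0 i" for i using x_pos by (simp add: K0_def)
  have "\<bar>stepconv (Suc n) W i y\<bar> \<le> (\<Sum>i\<in>UNIV. K0 i) * b + b" if y: "y \<in> {0..x}" for n i y
  proof -
    have "\<bar>stepconv (Suc n) W i y - \<xi> y $ i\<bar> \<le> K0 i * b"
      using b(2) by (intro stepconv_approx[OF P _ y]) auto
    also have "\<dots> \<le> (\<Sum>i\<in>UNIV. K0 i) * b"
      using b(1) K by (intro mult_right_mono member_le_sum) auto
    finally show ?thesis using b(3)[OF y] component_le_norm_cart[of "\<xi> y" i] by linarith
  qed
  then show ?thesis by blast
qed

lemma stepconv_tendsto: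
  assumes P: "path W \<xi>" and y: "y \<in> {0..x}"
  shows "(\<lambda>n. stepconv (Suc n) W i y) \<longlonglongrightarrow> \<xi> y $ i"
proof (rule LIMSEQ_I)
  fix e :: real assume e: "0 < e"
  have K: "0 < K0 i" using x_pos by (simp add: K0_def add_pos_nonneg)
  have uc: "uniformly_continuous_on {0..x} W"
    using P by (intro compact_uniformly_continuous) (auto simp: path_def)
  have "0 < e / (2 * K0 i)" using e K by simp
  from uc[unfolded uniformly_continuous_on_def, rule_format, OF this]
  obtain d where d: "0 < d" "\<And>s t. s \<in> {0..x} \<Longrightarrow> t \<in> {0..x} \<Longrightarrow> dist s t < d \<Longrightarrow> dist (W s) (W t) < e / (2 * K0 i)"
    by (metis dist_commute)
  obtain M :: nat where M: "x / d < M" using reals_Archimedean2 by blast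
  have "norm (stepconv (Suc n) W i y - \<xi> y $ i) < e" if "n \<ge> M" for n
  proof -
    have "x / d < Suc n" using M that by simp
    then have small: "x / Suc n < d" using d(1) by (simp add: field_simps)
    have "\<bar>stepconv (Suc n) W i y - \<xi> y $ i\<bar> \<le> K0 i * (e / (2 * K0 i))"
    proof (rule stepconv_approx[OF P _ y])
      show "norm (W s - W t) \<le> e / (2 * K0 i)" if "s \<in> {0..x}" "t \<in> {0..x}" "\<bar>s - t\<bar> \<le> x / real (Suc n)" for s t
        using d(2)[OF that(1,2)] that(3) small by (simp add: dist_norm)
    qed simp
    also have "\<dots> = e / 2" using K by simp
    finally show ?thesis using e by simp
  qed
  then show "\<exists>M. \<forall>n\<ge>M. norm (stepconv (Suc n) W i y - \<xi> y $ i) < e" by blast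
qed

text \<open>The pairing of \<open>T f\<close> with white noise, made meaningful by
  \<open>ip_T\<close>: the observations of the noise are replaced by values of \<open>\<xi>\<close>,
  so no integral against \<open>W\<close> is taken.\<close>

definition form :: "(real \<times> 'n \<Rightarrow> real) \<Rightarrow> (real \<Rightarrow> real^'n) \<Rightarrow> real" where
  "form f \<xi> = (\<integral>y. obs f y * (a * (c \<bullet> \<xi> y)) \<partial>\<nu>) - (\<Sum>i\<in>UNIV. \<Sum>j\<in>UNIV. G $ i $ j * obs_end f i * \<xi> x $ j)"

text \<open>With \<open>G = \<beta> - D\<close>, this is minus twice the exponent inside the
  expectation.\<close>

definition quad :: "(real \<Rightarrow> real^'n) \<Rightarrow> real" where
  "quad \<xi> = (\<integral>y. (a * (c \<bullet> \<xi> y)) * (a * (c \<bullet> \<xi> y)) \<partial>\<nu>) - (\<Sum>i\<in>UNIV. \<Sum>j\<in>UNIV. G $ i $ j * \<xi> x $ i * \<xi> x $ j)"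

lemma obs_stepf_tendsto:
  assumes P: "path W \<xi>" and y: "y \<in> {0..x}"
  shows "(\<lambda>n. obs (stepf (Suc n) W) y) \<longlonglongrightarrow> a * (c \<bullet> \<xi> y)"
proof -
  have "(\<lambda>n. \<Sum>i\<in>UNIV. a * c $ i * stepconv (Suc n) W i y) \<longlonglongrightarrow> (\<Sum>i\<in>UNIV. a * c $ i * \<xi> y $ i)"
    by (intro tendsto_intros stepconv_tendsto[OF P y])
  then show ?thesis using y by (simp add: obs_stepf inner_vec_def sum_distrib_left mult.assoc)
qed

lemma obs_stepf_bound:
  assumes P: "path W \<xi>"
  shows "\<exists>b. \<forall>n. \<forall>y\<in>{0..x}. \<bar>obs (stepf (Suc n) W) y\<bar> \<le> b"
proof -
  obtain b where b: "\<forall>n i. \<forall>y\<in>{0..x}. \<bar>stepconv (Suc n) W i y\<bar> \<le> b" using stepconv_bound[OF P] by blast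
  have "\<bar>obs (stepf (Suc n) W) y\<bar> \<le> (\<Sum>i\<in>UNIV. \<bar>a * c $ i\<bar> * b)" if y: "y \<in> {0..x}" for n y
  proof -
    have "\<bar>obs (stepf (Suc n) W) y\<bar> \<le> (\<Sum>i\<in>UNIV. \<bar>a * c $ i * stepconv (Suc n) W i y\<bar>)"
      using y by (simp add: obs_stepf sum_abs del: abs_mult)
    also have "\<dots> \<le> (\<Sum>i\<in>UNIV. \<bar>a * c $ i\<bar> * b)"
      using b y unfolding abs_mult[of "a * c $ _"] by (intro sum_mono mult_left_mono) auto
    finally show ?thesis .
  qed
  then show ?thesis by blast
qed

lemma obs_path_measurable: "path W \<xi> \<Longrightarrow> (\<lambda>y. a * (c \<bullet> \<xi> y)) \<in> borel_measurable \<nu>"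
  by (rule borel_measurable_integrable, rule integrable_restrict_Icc_continuous)
    (auto simp: path_def intro!: continuous_intros)

text \<open>\<open>T\<close> sees a step function only through its observations. These converge even
  though the step functions themselves need not converge in \<open>L2\<close>.\<close>

lemma ip_T_stepf_tendsto:
  assumes P: "path W \<xi>" and f: "f \<in> real_L2 \<mu>"
  shows "(\<lambda>n. real_ip \<mu> (T f) (stepf (Suc n) W)) \<longlonglongrightarrow> form f \<xi>"
proof -
  obtain b where b: "\<forall>n. \<forall>y\<in>{0..x}. \<bar>obs (stepf (Suc n) W) y\<bar> \<le> b" using obs_stepf_bound[OF P] by blast
  have "(\<lambda>n. \<integral>y. obs f y * obs (stepf (Suc n) W) y \<partial>\<nu>) \<longlonglongrightarrow> (\<integral>y. obs f y * (a * (c \<bullet> \<xi> y)) \<partial>\<nu>)"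
  proof (rule integral_dominated_convergence[where w = "\<lambda>y. \<bar>obs f y\<bar> * b"])
    show "integrable \<nu> (\<lambda>y. \<bar>obs f y\<bar> * b)" using integrable_obs[OF f] by simp
    show "AE y in \<nu>. (\<lambda>n. obs f y * obs (stepf (Suc n) W) y) \<longlonglongrightarrow> obs f y * (a * (c \<bullet> \<xi> y))"
      by (rule AE_I2) (auto intro!: tendsto_mult_left obs_stepf_tendsto[OF P])
    show "AE y in \<nu>. norm (obs f y * obs (stepf (Suc n) W) y) \<le> \<bar>obs f y\<bar> * b" for n
      by (rule AE_I2) (use b in \<open>auto simp: abs_mult intro!: mult_left_mono\<close>)
  qed (use obs_measurable[OF f] obs_measurable[OF stepf_in] obs_path_measurable[OF P] in auto)
  moreover have "(\<lambda>n. \<Sum>i\<in>UNIV. \<Sum>j\<in>UNIV. G $ i $ j * obs_end f i * obs_end (stepf (Suc n) W) j)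
    \<longlonglongrightarrow> (\<Sum>i\<in>UNIV. \<Sum>j\<in>UNIV. G $ i $ j * obs_end f i * \<xi> x $ j)"
    unfolding obs_end_stepf[OF zero_less_Suc] using x_pos by (intro tendsto_intros stepconv_tendsto[OF P]) auto
  ultimately show ?thesis unfolding form_def using f by (auto simp: ip_T intro!: tendsto_diff)
qed

lemma ip_T_stepf_stepf_tendsto:
  assumes P: "path W \<xi>"
  shows "(\<lambda>n. real_ip \<mu> (T (stepf (Suc n) W)) (stepf (Suc n) W)) \<longlonglongrightarrow> quad \<xi>"
proof -
  obtain b where b: "\<forall>n. \<forall>y\<in>{0..x}. \<bar>obs (stepf (Suc n) W) y\<bar> \<le> b" using obs_stepf_bound[OF P] by blast
  have "(\<lambda>n. \<integral>y. obs (stepf (Suc n) W) y * obs (stepf (Suc n) W) y \<partial>\<nu>) \<longlonglongrightarrow> (\<integral>y. (a * (c \<bullet> \<xi> y)) * (a * (c \<bullet> \<xi> y)) \<partial>\<nu>)"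
  proof (rule integral_dominated_convergence[where w = "\<lambda>y. b * b"])
    show "AE y in \<nu>. (\<lambda>n. obs (stepf (Suc n) W) y * obs (stepf (Suc n) W) y) \<longlonglongrightarrow> (a * (c \<bullet> \<xi> y)) * (a * (c \<bullet> \<xi> y))"
      by (rule AE_I2) (auto intro!: tendsto_mult obs_stepf_tendsto[OF P])
    show "AE y in \<nu>. norm (obs (stepf (Suc n) W) y * obs (stepf (Suc n) W) y) \<le> b * b" for n
    proof (rule AE_I2)
      fix y assume "y \<in> space \<nu>"
      then have "\<bar>obs (stepf (Suc n) W) y\<bar> \<le> b" using b by auto
      then show "norm (obs (stepf (Suc n) W) y * obs (stepf (Suc n) W) y) \<le> b * b"
        unfolding real_norm_def abs_mult by (intro mult_mono) auto
    qed
  qed (use obs_measurable[OF stepf_in] obs_path_measurable[OF P] in auto)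
  moreover have "(\<lambda>n. \<Sum>i\<in>UNIV. \<Sum>j\<in>UNIV. G $ i $ j * obs_end (stepf (Suc n) W) i * obs_end (stepf (Suc n) W) j)
    \<longlonglongrightarrow> (\<Sum>i\<in>UNIV. \<Sum>j\<in>UNIV. G $ i $ j * \<xi> x $ i * \<xi> x $ j)"
    unfolding obs_end_stepf[OF zero_less_Suc] using x_pos by (intro tendsto_intros stepconv_tendsto[OF P]) auto
  ultimately show ?thesis unfolding quad_def by (auto simp: ip_T intro!: tendsto_diff)
qed

section \<open>Continuous forcing and the projection onto cells\<close>

definition prim :: "(real \<times> 'n \<Rightarrow> real) \<Rightarrow> real \<Rightarrow> real^'n" where
  "prim f u = (\<chi> i. integral {0..u} (\<lambda>v. f (v, i)))"

definition response :: "(real \<times> 'n \<Rightarrow> real) \<Rightarrow> real \<Rightarrow> real^'n" where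
  "response f y = (\<chi> i. integral {0..y} (\<lambda>u. exp (p $ i * (y - u)) * f (u, i)))"

lemma response_derivative:
  assumes f: "continuous_on {0..x} (\<lambda>u. f (u, i))" and y: "y \<in> {0..x}"
  shows "((\<lambda>y. response f y $ i) has_real_derivative p $ i * response f y $ i + f (y, i)) (at y within {0..x})"
proof -
  define Z where "Z y = integral {0..y} (\<lambda>u. exp (- p $ i * u) * f (u, i))" for y
  have r: "response f y $ i = exp (p $ i * y) * Z y" for y
  proof -
    have eq: "exp (p $ i * (y - u)) * f (u, i) = exp (p $ i * y) * (exp (- p $ i * u) * f (u, i))" for u
      by (simp add: exp_add[symmetric] mult.assoc[symmetric] right_diff_distrib)
    show ?thesis unfolding response_def Z_def vec_lambda_beta eq by simp
  qed
  have "(Z has_vector_derivative exp (- p $ i * y) * f (y, i)) (at y within {0..x})"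
    unfolding Z_def by (rule integral_has_vector_derivative[OF _ y]) (intro continuous_intros f)
  then have "(Z has_real_derivative exp (- p $ i * y) * f (y, i)) (at y within {0..x})"
    by (simp add: has_real_derivative_iff_has_vector_derivative)
  then have "((\<lambda>y. exp (p $ i * y) * Z y) has_real_derivative exp (p $ i * y) * p $ i * Z y + exp (p $ i * y) * (exp (- p $ i * y) * f (y, i))) (at y within {0..x})"
    by (auto intro!: derivative_eq_intros)
  moreover have "exp (p $ i * y) * (exp (- p $ i * y) * f (y, i)) = f (y, i)"
    by (simp add: exp_add[symmetric] mult.assoc[symmetric])
  moreover have "exp (p $ i * y) * p $ i * Z y + f (y, i) = p $ i * (exp (p $ i * y) * Z y) + f (y, i)" by simp
  ultimately show ?thesis unfolding r by (simp only:)
qed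

text \<open>Puts a continuous forcing \<open>f\<close> on the same footing as a Wiener path, so that
  the convergence result for step functions can be applied to \<open>f\<close> as well.\<close>

lemma path_prim_response:
  assumes f: "\<And>i. continuous_on {0..x} (\<lambda>u. f (u, i))"
  shows "path (prim f) (response f)"
proof -
  have rc: "continuous_on {0..x} (\<lambda>y. response f y $ i)" for i
    using response_derivative[where f = f, OF f] by (meson DERIV_continuous continuous_on_eq_continuous_within)
  have pc: "continuous_on {0..x} (\<lambda>u. prim f u $ i)" for i
    unfolding prim_def vec_lambda_beta
    by (rule indefinite_integral_continuous_1) (rule integrable_continuous_interval[OF f])
  have "continuous_on {0..x} (\<lambda>y. \<chi> i. response f y $ i)" "continuous_on {0..x} (\<lambda>u. \<chi> i. prim f u $ i)"
    by (intro continuous_on_vec_lambda rc pc)+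
  then have "continuous_on {0..x} (response f)" "continuous_on {0..x} (prim f)" by simp_all
  moreover have "response f s $ i = prim f s $ i + p $ i * integral {0..s} (\<lambda>u. response f u $ i)" if s: "s \<in> {0..x}" for s i
  proof -
    have sub: "{0..s} \<subseteq> {0..x}" using s by auto
    have "((\<lambda>y. response f y $ i) has_real_derivative p $ i * response f y $ i + f (y, i)) (at y within {0..s})"
      if "y \<in> {0..s}" for y
      using response_derivative[where f = f, OF f, of y] that sub by (blast intro: DERIV_subset)
    then have "((\<lambda>y. p $ i * response f y $ i + f (y, i)) has_integral (response f s $ i - response f 0 $ i)) {0..s}"
      using s by (intro fundamental_theorem_of_calculus) (auto simp: has_real_derivative_iff_has_vector_derivative)
    then have "response f s $ i = integral {0..s} (\<lambda>y. p $ i * response f y $ i + f (y, i))"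
      by (simp add: integral_unique response_def)
    also have "\<dots> = integral {0..s} (\<lambda>y. p $ i * response f y $ i) + integral {0..s} (\<lambda>y. f (y, i))"
      by (intro Henstock_Kurzweil_Integration.integral_add integrable_continuous_interval
          continuous_on_mult_left continuous_on_subset[OF rc sub] continuous_on_subset[OF f sub])
    finally show ?thesis by (simp add: prim_def)
  qed
  ultimately show ?thesis by (simp add: path_def prim_def zero_vec_def)
qed

lemma obs_response:
  assumes f: "f \<in> real_L2 \<mu>" and fc: "\<And>i. continuous_on {0..x} (\<lambda>u. f (u, i))" and y: "y \<in> {0..x}"
  shows "obs f y = a * (c \<bullet> response f y)"
proof -
  have int: "integrable \<mu> (\<lambda>\<eta>. hh y \<eta> * f \<eta>)" using y f by (intro integrable_mult_real_L2) auto
  have "(\<integral>u. hh y (u, i) * f (u, i) \<partial>\<nu>) = a * c $ i * response f y $ i" for i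
  proof -
    have "(\<integral>u. hh y (u, i) * f (u, i) \<partial>\<nu>) = (\<integral>u. (if u < y then (a * c $ i) * (exp (p $ i * (y - u)) * f (u, i)) else 0) \<partial>\<nu>)"
      by (rule Bochner_Integration.integral_cong) (auto simp: hh_def)
    also have "\<dots> = integral {0..y} (\<lambda>u. (a * c $ i) * (exp (p $ i * (y - u)) * f (u, i)))"
      by (rule integral_restrict_Icc_cut(1)[OF integrable_restrict_Icc_continuous y]) (intro continuous_intros fc)
    finally show ?thesis by (simp add: response_def)
  qed
  then show ?thesis unfolding obs_def real_ip_def integral_Delta[OF int]
    by (simp add: inner_vec_def sum_distrib_left mult.assoc)
qed

lemma obs_end_response:
  assumes f: "f \<in> real_L2 \<mu>" and fc: "\<And>i. continuous_on {0..x} (\<lambda>u. f (u, i))"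
  shows "obs_end f k = response f x $ k"
proof -
  have int: "integrable \<mu> (\<lambda>\<eta>. kk k \<eta> * f \<eta>)" using f by (intro integrable_mult_real_L2) auto
  have "(\<integral>u. kk k (u, i) * f (u, i) \<partial>\<nu>) = (if i = k then response f x $ k else 0)" for i
  proof (cases "i = k")
    case True
    have "integrable \<nu> (\<lambda>u. exp (p $ k * (x - u)) * f (u, k))"
      by (intro integrable_restrict_Icc_continuous continuous_intros fc)
    then show ?thesis using True integrable_restrict_IccD(2) by (simp add: kk_def response_def)
  qed (simp add: kk_def)
  then show ?thesis unfolding obs_end_def real_ip_def integral_Delta[OF int] by simp
qed

lemma incr_prim:
  assumes f: "f \<in> real_L2 \<mu>" and fc: "\<And>i. continuous_on {0..x} (\<lambda>u. f (u, i))"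
    and m: "0 < m" and q: "q \<in> cells m"
  shows "incr m (prim f) q = real_ip \<mu> f (cell m q)"
proof -
  obtain j i where qq: "q = (j, i)" by (cases q)
  have j: "j < m" using q by (simp add: qq cells_def)
  define h where "h = x / m"
  have h: "0 < h" "real m * h = x" using m x_pos by (auto simp: h_def)
  define s t where "s = real j * h" and "t = real (Suc j) * h"
  have st: "0 \<le> s" "s < t" "t \<le> x"
  proof -
    show "0 \<le> s" "s < t" using h by (auto simp: s_def t_def)
    have "real (Suc j) * h \<le> real m * h" using j h(1) by (intro mult_right_mono) auto
    then show "t \<le> x" using h by (simp add: t_def)
  qed
  have int: "integrable \<mu> (\<lambda>\<eta>. f \<eta> * cell m q \<eta>)" using f by (intro integrable_mult_real_L2) auto
  \<comment> \<open>The cell ends at \<open>t \<le> x\<close>, so the cut-off at \<open>x\<close>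
    built into \<open>cell_integral\<close> changes nothing.\<close>
  have cell_cut: "(if u < x then f (u, i) * cell m (j, i) (u, i) else 0) = f (u, i) * cell m (j, i) (u, i)" for u
    using st(3) by (auto simp: cell_def t_def h_def)
  have "real_ip \<mu> f (cell m q) = (\<Sum>k\<in>UNIV. \<integral>u. f (u, k) * cell m q (u, k) \<partial>\<nu>)"
    unfolding real_ip_def by (rule integral_Delta[OF int])
  also have "\<dots> = (\<Sum>k\<in>UNIV. if k = i then (\<integral>u. f (u, i) * cell m (j, i) (u, i) \<partial>\<nu>) else 0)"
    by (intro sum.cong refl) (auto simp: qq cell_def)
  also have "\<dots> = sqrt h * integral {0..x} (\<lambda>u. if s \<le> u \<and> u < t then f (u, i) / h else 0)"
    using cell_integral[OF m fc, of x i j i, unfolded cell_cut, folded h_def, folded s_def t_def] x_pos by simp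
  also have "integral {0..x} (\<lambda>u. if s \<le> u \<and> u < t then f (u, i) / h else 0) = integral {0..x} (\<lambda>u. if u \<in> {s..t} then f (u, i) / h else 0)"
    by (rule integral_spike[of "{t}"]) auto
  also have "\<dots> = integral ({s..t} \<inter> {0..x}) (\<lambda>u. f (u, i) / h)" by (rule integral_restrict_Int)
  also have "{s..t} \<inter> {0..x} = {s..t}" using st by auto
  also have "sqrt h * integral {s..t} (\<lambda>u. f (u, i) / h) = integral {s..t} (\<lambda>u. f (u, i)) / sqrt h"
  proof -
    have "sqrt h / h = inverse (sqrt h)" using h by (intro sqrt_divide_self_eq) simp
    then have "sqrt h * (integral {s..t} (\<lambda>u. f (u, i)) / h) = inverse (sqrt h) * integral {s..t} (\<lambda>u. f (u, i))"
      by (simp only: times_divide_eq_right times_divide_eq_left[symmetric])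
    then show ?thesis by (simp add: divide_inverse mult.commute)
  qed
  also have "integral {s..t} (\<lambda>u. f (u, i)) = prim f t $ i - prim f s $ i"
  proof -
    have "{0..t} \<subseteq> {0..x}" using st by auto
    then have "(\<lambda>u. f (u, i)) integrable_on {0..t}"
      using continuous_on_subset[OF fc] by (intro integrable_continuous_interval) blast
    then have "integral {0..s} (\<lambda>u. f (u, i)) + integral {s..t} (\<lambda>u. f (u, i)) = integral {0..t} (\<lambda>u. f (u, i))"
      using st by (intro Henstock_Kurzweil_Integration.integral_combine) auto
    then show ?thesis by (simp add: prim_def)
  qed
  finally show ?thesis by (simp add: qq incr_def h_def s_def t_def)
qed

lemma ip_stepf:
  "f \<in> real_L2 \<mu> \<Longrightarrow> real_ip \<mu> f (stepf m W) = (\<Sum>q\<in>cells m. incr m W q * real_ip \<mu> f (cell m q))"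
  unfolding stepf_def by (simp add: ip_sum_right ip_scale_right)

text \<open>The step functions of \<open>prim f\<close> are the orthogonal projections of \<open>f\<close> onto the cells.\<close>

lemma gram_tendsto:
  assumes f: "f \<in> real_L2 \<mu>" and fc: "\<And>i. continuous_on {0..x} (\<lambda>u. f (u, i))"
    and e: "e \<in> real_L2 \<mu>" and Te: "T e = l *\<^sub>R e" and l: "l \<noteq> 0"
  shows "(\<lambda>n. \<Sum>q\<in>cells (Suc n). real_ip \<mu> f (cell (Suc n) q) * real_ip \<mu> e (cell (Suc n) q)) \<longlonglongrightarrow> real_ip \<mu> e f"
proof -
  have P: "path (prim f) (response f)" by (rule path_prim_response) (rule fc)
  \<comment> \<open>For continuous forcing the observations are exactly those of the response, so
    the limiting form is an honest inner product; the eigenvalue equation then removes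
    \<open>T\<close>.\<close>
  have "form e (response f) = real_ip \<mu> (T e) f"
  proof -
    have "(\<integral>y. obs e y * (a * (c \<bullet> response f y)) \<partial>\<nu>) = (\<integral>y. obs e y * obs f y \<partial>\<nu>)"
      by (rule Bochner_Integration.integral_cong) (auto simp: obs_response[OF f fc])
    then show ?thesis using e f by (simp add: form_def ip_T obs_end_response[OF f fc])
  qed
  then have "(\<lambda>n. real_ip \<mu> (T e) (stepf (Suc n) (prim f))) \<longlonglongrightarrow> l * real_ip \<mu> e f"
    using ip_T_stepf_tendsto[OF P e] e f by (simp add: Te ip_scale_left)
  moreover have "real_ip \<mu> (T e) (stepf (Suc n) (prim f)) = l * (\<Sum>q\<in>cells (Suc n). real_ip \<mu> f (cell (Suc n) q) * real_ip \<mu> e (cell (Suc n) q))" for n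
    using e by (simp add: Te ip_scale_left ip_stepf incr_prim[OF f fc] sum_distrib_left mult.left_commute)
  ultimately have "(\<lambda>n. l * (\<Sum>q\<in>cells (Suc n). real_ip \<mu> f (cell (Suc n) q) * real_ip \<mu> e (cell (Suc n) q))) \<longlonglongrightarrow> l * real_ip \<mu> e f"
    by simp
  then show ?thesis using l by (simp add: tendsto_mult_left_iff)
qed

end

section \<open>The matrix Riccati equation\<close>

lemma matrix_inv_works:
  fixes A :: "real^'n^'n"
  assumes "invertible A"
  shows "A ** matrix_inv A = mat 1" "matrix_inv A ** A = mat 1"
proof -
  have "\<exists>B. A ** B = mat 1 \<and> B ** A = mat 1" using assms by (simp add: invertible_def)
  from someI_ex[OF this] show "A ** matrix_inv A = mat 1" "matrix_inv A ** A = mat 1"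
    by (simp_all add: matrix_inv_def)
qed

lemma matrix_inv_eqI:
  fixes A B :: "real^'n^'n"
  assumes "A ** B = mat 1" "B ** A = mat 1"
  shows "matrix_inv A = B"
proof -
  have inv: "invertible A" using assms by (auto simp: invertible_def)
  have "matrix_inv A = (B ** A) ** matrix_inv A" using assms by simp
  also have "\<dots> = B" by (simp add: matrix_inv_works[OF inv] flip: matrix_mul_assoc)
  finally show ?thesis .
qed

text \<open>Cramer's rule as a total function, whose differentiability is read off from that of determinants.\<close>

definition cramer_inv :: "real^'n^'n \<Rightarrow> real^'n^'n" where
  "cramer_inv A = (\<chi> k j. det (\<chi> i l. if l = k then (if i = j then 1 else 0) else A $ i $ l) / det A)"

lemma matrix_inv_cramer:
  fixes A :: "real^'n^'n"
  assumes "invertible A"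
  shows "matrix_inv A = cramer_inv A"
proof -
  have d: "det A \<noteq> 0" using assms invertible_det_nz by blast
  have "matrix_inv A $ k $ j = cramer_inv A $ k $ j" for k j
  proof -
    let ?b = "(\<chi> i. if i = j then 1 else 0) :: real^'n"
    have "A *v (matrix_inv A *v ?b) = ?b"
      by (simp add: matrix_vector_mul_assoc matrix_inv_works[OF assms])
    then have "matrix_inv A *v ?b = (\<chi> k. det (\<chi> i l. if l = k then ?b $ i else A $ i $ l) / det A)"
      using cramer[OF d] by blast
    then have "(matrix_inv A *v ?b) $ k = det (\<chi> i l. if l = k then ?b $ i else A $ i $ l) / det A" by simp
    moreover have "(matrix_inv A *v ?b) $ k = matrix_inv A $ k $ j"
      by (simp add: matrix_vector_mult_def if_distrib cong: if_cong)
    ultimately show ?thesis by (simp add: cramer_inv_def cong: if_cong)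
  qed
  then show ?thesis by (simp add: vec_eq_iff)
qed

text \<open>Entrywise derivatives suit Cramer's rule and the symmetry computations.
  \<open>mderiv_has_vector_derivative\<close> connects them with the derivative occurring in
  \<open>beta\<close>.\<close>

definition mderiv :: "(real \<Rightarrow> real^'n^'m) \<Rightarrow> real^'n^'m \<Rightarrow> real \<Rightarrow> bool" where
  "mderiv A A' z \<longleftrightarrow> (\<forall>i j. ((\<lambda>z. A z $ i $ j) has_real_derivative A' $ i $ j) (at z))"

lemma mderiv_mult:
  assumes "mderiv A A' z" "mderiv B B' z"
  shows "mderiv (\<lambda>z. A z ** B z) (A' ** B z + A z ** B') z"
  unfolding mderiv_def
proof (intro allI)
  fix i j
  have "((\<lambda>z. \<Sum>k\<in>UNIV. A z $ i $ k * B z $ k $ j) has_real_derivative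
      (\<Sum>k\<in>UNIV. A' $ i $ k * B z $ k $ j + B' $ k $ j * A z $ i $ k)) (at z)"
    using assms by (intro DERIV_sum DERIV_mult) (auto simp: mderiv_def)
  then show "((\<lambda>z. (A z ** B z) $ i $ j) has_real_derivative (A' ** B z + A z ** B') $ i $ j) (at z)"
    by (simp add: matrix_matrix_mult_def sum.distrib mult.commute[of "B' $ _ $ _"])
qed

lemma mderiv_const: "mderiv (\<lambda>z. C) 0 z"
  by (simp add: mderiv_def)

lemma mderiv_has_vector_derivative:
  assumes "mderiv A A' z"
  shows "(A has_vector_derivative A') (at z)"
  unfolding has_vector_derivative_def
proof (subst has_derivative_componentwise_within, rule ballI)
  fix b :: "real^'a^'b" assume "b \<in> Basis"
  then obtain i j where b: "b = axis i (axis j 1)" by (auto simp: Basis_vec_def)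
  have "((\<lambda>z. A z $ i $ j) has_derivative (\<lambda>x. x * A' $ i $ j)) (at z)"
    using assms by (simp add: mderiv_def has_field_derivative_def mult.commute[of _ "A' $ i $ j"])
  then show "((\<lambda>x. A x \<bullet> b) has_derivative (\<lambda>x. x *\<^sub>R A' \<bullet> b)) (at z)"
    by (simp add: b inner_axis)
qed

lemma det_differentiable:
  fixes A :: "real \<Rightarrow> real^'n^'n"
  assumes "\<And>i j. \<exists>d. ((\<lambda>z. A z $ i $ j) has_real_derivative d) (at z)"
  shows "\<exists>d. ((\<lambda>z. det (A z)) has_real_derivative d) (at z)"
proof -
  obtain d where d: "\<And>i j. ((\<lambda>z. A z $ i $ j) has_real_derivative d i j) (at z)" using assms by metis
  show ?thesis unfolding det_def
    by (intro exI) (rule DERIV_sum, rule DERIV_cmult, rule has_field_derivative_prod, rule d)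
qed

lemma cramer_inv_differentiable:
  fixes A :: "real \<Rightarrow> real^'n^'n"
  assumes A: "mderiv A A' z" and d: "det (A z) \<noteq> 0"
  shows "\<exists>B'. mderiv (\<lambda>z. cramer_inv (A z)) B' z"
proof -
  have "\<exists>b. ((\<lambda>z. cramer_inv (A z) $ k $ j) has_real_derivative b) (at z)" for k j
  proof -
    have "\<exists>b. ((\<lambda>z. A z $ i $ l) has_real_derivative b) (at z)" for i l using A by (auto simp: mderiv_def)
    then obtain d1 where d1: "((\<lambda>z. det (A z)) has_real_derivative d1) (at z)" using det_differentiable[of A z] by blast
    have "\<exists>b. ((\<lambda>z. (\<chi> i l. if l = k then (if i = j then 1 else 0) else A z $ i $ l) $ i $ l) has_real_derivative b) (at z)" for i l
      using A by (cases "l = k") (auto simp: mderiv_def intro: exI[of _ 0])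
    then obtain d2 where d2: "((\<lambda>z. det (\<chi> i l. if l = k then (if i = j then 1 else 0) else A z $ i $ l)) has_real_derivative d2) (at z)"
      using det_differentiable[of "\<lambda>z. \<chi> i l. if l = k then (if i = j then 1 else 0) else A z $ i $ l" z] by blast
    show ?thesis unfolding cramer_inv_def vec_lambda_beta using DERIV_divide[OF d2 d1 d] by blast
  qed
  then obtain b where "\<And>k j. ((\<lambda>z. cramer_inv (A z) $ k $ j) has_real_derivative b k j) (at z)" by metis
  then show ?thesis by (intro exI[of _ "\<chi> k j. b k j"]) (simp add: mderiv_def)
qed

lemma diag_mult: "diag v ** X = (\<chi> i j. v $ i * X $ i $ j)" for X :: "real^'n^'n"
  by (simp add: diag_def matrix_matrix_mult_def vec_eq_iff if_distrib if_distribR cong: if_cong)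

lemma diag_mult_vec: "diag v *v w = (\<chi> i. v $ i * w $ i)"
  by (simp add: diag_def matrix_vector_mult_def vec_eq_iff if_distrib if_distribR cong: if_cong)

lemma mat_vec_inner_symmetric:
  fixes S :: "real^'n^'n"
  assumes "\<And>i j. S $ i $ j = S $ j $ i"
  shows "(S *v v) \<bullet> w = v \<bullet> (S *v w)"
proof -
  have "transpose S = S" using assms by (simp add: transpose_def vec_eq_iff)
  then show ?thesis by (metis dot_lmul_matrix inner_commute transpose_matrix_vector)
qed

locale riccati =
  fixes p c r :: "real^'n" and a x t :: real and U :: "real^'n^'n"
  assumes a_pos: "0 < a" and x_pos: "0 < x" and p_inj: "inj (\<lambda>i. p $ i)" and c_pos: "\<And>i. 0 < c $ i"
    and U_orth: "orthogonal_matrix U"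
    and E_eq: "diag p ** diag p + a^2 *\<^sub>R (\<chi> i j. c$i * c$j) = U ** (diag r ** diag r) ** matrix_inv U"
    and phi_inv: "\<And>z. z \<in> {0..x} \<Longrightarrow> invertible (phi_a U r p z t)"
begin

section \<open>The second order equation for phi in the eigenbasis of E\<close>

abbreviation "Ut \<equiv> transpose U"
abbreviation "\<phi> z \<equiv> phi_a U r p z t"

definition E :: "real^'n^'n" where "E = diag p ** diag p + a^2 *\<^sub>R (\<chi> i j. c$i * c$j)"

lemma UU: "Ut ** U = mat 1" "U ** Ut = mat 1"
  using U_orth by (auto simp: orthogonal_matrix_def)

lemma inv_U: "matrix_inv U = Ut"
  using UU by (intro matrix_inv_eqI) auto

lemma E_vec: "E *v v = (\<chi> i. (p $ i)\<^sup>2 * v $ i) + (a\<^sup>2 * (c \<bullet> v)) *\<^sub>R c"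
proof -
  have e: "E $ i $ j = (if j = i then (p $ i)\<^sup>2 else 0) + a\<^sup>2 * c $ i * c $ j" for i j
    by (simp add: E_def diag_mult) (simp add: diag_def power2_eq_square)
  have "(E *v v) $ i = (p $ i)\<^sup>2 * v $ i + (\<Sum>j\<in>UNIV. a\<^sup>2 * c $ i * c $ j * v $ j)" for i
  proof -
    have "E $ i $ j * v $ j = (if j = i then (p $ i)\<^sup>2 * v $ i else 0) + a\<^sup>2 * c $ i * c $ j * v $ j" for j
      unfolding e by (auto simp: distrib_right)
    then show ?thesis unfolding matrix_vector_mult_def vec_lambda_beta by (simp add: sum.distrib)
  qed
  then show ?thesis
    by (simp add: vec_eq_iff inner_vec_def sum_distrib_left sum_distrib_right ac_simps)
qed

text \<open>A kernel vector \<open>v\<close> of \<open>E\<close> has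
  \<open>p $ i * v $ i = 0\<close> for all \<open>i\<close> and \<open>c \<bullet> v = 0\<close>.
  Since the \<open>p $ i\<close> are distinct, at most one of them is 0, so \<open>v\<close> is
  supported on one coordinate, and positivity of \<open>c\<close> kills it. This gives meaning to
  the inverse of \<open>diag r\<close>.\<close>

lemma r_nonzero: "r $ k \<noteq> 0"
proof
  assume rk: "r $ k = 0"
  define v where "v = U *v axis k 1"
  have Uv: "Ut *v v = axis k 1" unfolding v_def by (simp only: matrix_vector_mul_assoc UU matrix_vector_mul_lid)
  have "E *v v = U *v ((diag r ** diag r) *v (Ut *v v))"
    using E_eq by (simp only: E_def inv_U matrix_vector_mul_assoc matrix_mul_assoc)
  also have "(diag r ** diag r) *v (Ut *v v) = 0"
    unfolding Uv using rk by (auto simp: diag_mult_vec axis_def vec_eq_iff simp flip: matrix_vector_mul_assoc)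
  finally have "E *v v = 0" by simp
  then have "v \<bullet> (E *v v) = 0" by simp
  then have "(\<Sum>i\<in>UNIV. (p $ i * v $ i)\<^sup>2) + (a * (c \<bullet> v))\<^sup>2 = 0"
    by (simp add: E_vec inner_add_right inner_commute[of v c])
      (simp add: inner_vec_def power2_eq_square ac_simps)
  then have z: "(\<Sum>i\<in>UNIV. (p $ i * v $ i)\<^sup>2) = 0" "(a * (c \<bullet> v))\<^sup>2 = 0"
    by (simp_all add: add_nonneg_eq_0_iff sum_nonneg)
  then have pv: "p $ i * v $ i = 0" for i by (simp add: sum_nonneg_eq_0_iff)
  have cv: "c \<bullet> v = 0" using z a_pos by simp
  have "v \<noteq> 0"
  proof
    assume "v = 0"
    then have "axis k (1::real) = 0" using Uv by simp
    then show False by simp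
  qed
  then obtain i where i: "v $ i \<noteq> 0" by (auto simp: vec_eq_iff)
  have "v $ j = 0" if "j \<noteq> i" for j
  proof (rule ccontr)
    assume "v $ j \<noteq> 0"
    then have "p $ j = p $ i" using pv[of i] pv[of j] i by simp
    then show False using p_inj that by (auto simp: inj_def)
  qed
  then have "c \<bullet> v = c $ i * v $ i"
    unfolding inner_vec_def by (subst sum.remove[of _ i]) auto
  then show False using cv i c_pos[of i] by simp
qed

lemma inv_diag_r: "matrix_inv (diag r) = diag (\<chi> k. 1 / r $ k)"
  by (rule matrix_inv_eqI; unfold diag_mult) (auto simp: r_nonzero diag_def mat_def vec_eq_iff)

text \<open>The matrix \<open>D\<close> expressed in the eigenbasis of \<open>E\<close>.\<close>

definition M :: "real^'n^'n" where "M = Ut ** diag p ** U"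

lemma M_sym: "M $ i $ j = M $ j $ i"
proof -
  have "transpose (diag p) = diag p" by (auto simp: transpose_def diag_def vec_eq_iff)
  then have "transpose M = M"
    by (simp add: M_def matrix_transpose_mul matrix_mul_assoc)
  then show ?thesis by (simp add: transpose_def vec_eq_iff)
qed

definition ch :: "real \<Rightarrow> 'n \<Rightarrow> real" where "ch z k = cosh (zeta r z t $ k)"
text \<open>The division by \<open>r $ k\<close> yields \<open>sh' = ch\<close> and
  \<open>ch' = r^2 * sh\<close>, so that only squares of \<open>r\<close> appear afterwards.\<close>

definition sh :: "real \<Rightarrow> 'n \<Rightarrow> real" where "sh z k = sinh (zeta r z t $ k) / r $ k"

definition A :: "real \<Rightarrow> real^'n^'n" where
  "A z = (\<chi> i j. (if i = j then ch z i else 0) - sh z i * M $ i $ j)"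
definition A1 :: "real \<Rightarrow> real^'n^'n" where
  "A1 z = (\<chi> i j. (if i = j then (r $ i)\<^sup>2 * sh z i else 0) - ch z i * M $ i $ j)"
definition A2 :: "real \<Rightarrow> real^'n^'n" where
  "A2 z = (\<chi> i j. (r $ i)\<^sup>2 * A z $ i $ j)"
definition \<phi>1 :: "real \<Rightarrow> real^'n^'n" where "\<phi>1 z = U ** A1 z ** Ut"

lemma phi_eq: "\<phi> z = U ** A z ** Ut"
proof -
  have "diag (\<chi> k. sinh (zeta r z t $ k)) ** matrix_inv (diag r) ** matrix_inv U ** diag p ** U
    = diag (\<chi> k. sinh (zeta r z t $ k)) ** (diag (\<chi> k. 1 / r $ k) ** M)"
    by (simp add: inv_diag_r inv_U M_def matrix_mul_assoc)
  also have "\<dots> = (\<chi> i j. sh z i * M $ i $ j)" by (simp add: diag_mult sh_def)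
  finally have "diag (\<chi> k. cosh (zeta r z t $ k)) - diag (\<chi> k. sinh (zeta r z t $ k)) ** matrix_inv (diag r) ** matrix_inv U ** diag p ** U = A z"
    by (auto simp: A_def ch_def diag_def vec_eq_iff)
  then show ?thesis by (simp add: phi_a_def inv_U)
qed

lemma ch_deriv: "((\<lambda>z. ch z k) has_real_derivative (r $ k)\<^sup>2 * sh z k) (at z)"
  unfolding ch_def sh_def zeta_def vec_lambda_beta
  by (auto intro!: derivative_eq_intros simp: r_nonzero power2_eq_square)

lemma sh_deriv: "((\<lambda>z. sh z k) has_real_derivative ch z k) (at z)"
  unfolding ch_def sh_def zeta_def vec_lambda_beta
  by (auto intro!: derivative_eq_intros simp: r_nonzero)

lemma ch_sh: "(ch z k)\<^sup>2 = 1 + (r $ k)\<^sup>2 * (sh z k)\<^sup>2"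
  using cosh_square_eq[of "zeta r z t $ k"] r_nonzero[of k] by (simp add: ch_def sh_def power_divide)

lemma A_deriv: "mderiv A (A1 z) z"
  unfolding mderiv_def A_def A1_def
  by (auto intro!: derivative_eq_intros ch_deriv sh_deriv)

lemma A1_deriv: "mderiv A1 (A2 z) z"
  unfolding mderiv_def A2_def A1_def A_def
  by (auto intro!: derivative_eq_intros ch_deriv sh_deriv simp: algebra_simps)

lemma phi_deriv: "mderiv \<phi> (\<phi>1 z) z"
  using mderiv_mult[OF mderiv_mult[OF mderiv_const[of U] A_deriv] mderiv_const[of Ut], of z]
  by (simp add: phi_eq[abs_def] \<phi>1_def)

text \<open>In the eigenbasis \<open>E\<close> acts as \<open>R^2\<close>, and
  \<open>A'' = R^2 A\<close>; thus \<open>\<phi>'' = E \<phi>\<close>, the linear equation behind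
  the Riccati equation.\<close>

lemma E_phi: "E ** \<phi> z = U ** A2 z ** Ut"
proof -
  have "E ** \<phi> z = U ** ((diag r ** diag r) ** ((Ut ** U) ** A z)) ** Ut"
    unfolding E_def E_eq phi_eq inv_U by (simp add: matrix_mul_assoc)
  also have "(diag r ** diag r) ** ((Ut ** U) ** A z) = A2 z"
    unfolding matrix_mul_assoc[of "diag r", symmetric] unfolding diag_mult
    by (simp add: UU A2_def power2_eq_square mult.assoc)
  finally show ?thesis .
qed

lemma phi1_deriv: "mderiv \<phi>1 (E ** \<phi> z) z"
  using mderiv_mult[OF mderiv_mult[OF mderiv_const[of U] A1_deriv] mderiv_const[of Ut], of z]
  by (simp add: \<phi>1_def[abs_def] E_phi)

text \<open>Verified by computing the entries at each \<open>z\<close>, since the phases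
  \<open>zeta\<close> need not vanish at a common point from which symmetry could be propagated. The
  identity \<open>ch^2 = 1 + r^2 sh^2\<close> makes the off-diagonal part symmetric in
  \<open>i\<close> and \<open>j\<close>.\<close>

lemma wronskian_symmetric: "transpose (\<phi> z) ** \<phi>1 z = transpose (\<phi>1 z) ** \<phi> z"
proof -
  have "(transpose (A z) ** A1 z) $ i $ j = (if i = j then (r $ i)\<^sup>2 * sh z i * ch z i else 0) - M $ i $ j
      - ((r $ i)\<^sup>2 * (sh z i)\<^sup>2 + (r $ j)\<^sup>2 * (sh z j)\<^sup>2) * M $ i $ j + (\<Sum>k\<in>UNIV. sh z k * ch z k * M $ k $ i * M $ k $ j)" for i j
  proof -
    have "(transpose (A z) ** A1 z) $ i $ j = (\<Sum>k\<in>UNIV. ((if k = i then ch z k else 0) - sh z k * M $ k $ i) * ((if k = j then (r $ k)\<^sup>2 * sh z k else 0) - ch z k * M $ k $ j))"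
      by (simp add: matrix_matrix_mult_def transpose_def A_def A1_def)
    also have "\<dots> = (\<Sum>k\<in>UNIV. (if k = i then (if i = j then ch z i * ((r $ i)\<^sup>2 * sh z i) else 0) else 0)
        - (if k = i then (ch z i)\<^sup>2 * M $ i $ j else 0) - (if k = j then sh z j * M $ j $ i * ((r $ j)\<^sup>2 * sh z j) else 0)
        + sh z k * ch z k * M $ k $ i * M $ k $ j)"
      by (intro sum.cong refl) (auto simp: power2_eq_square algebra_simps)
    also have "\<dots> = (if i = j then ch z i * ((r $ i)\<^sup>2 * sh z i) else 0) - (ch z i)\<^sup>2 * M $ i $ j
      - sh z j * M $ j $ i * ((r $ j)\<^sup>2 * sh z j) + (\<Sum>k\<in>UNIV. sh z k * ch z k * M $ k $ i * M $ k $ j)"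
      by (simp add: sum.distrib sum_subtractf)
    also have "\<dots> = (if i = j then (r $ i)\<^sup>2 * sh z i * ch z i else 0) - M $ i $ j
      - ((r $ i)\<^sup>2 * (sh z i)\<^sup>2 + (r $ j)\<^sup>2 * (sh z j)\<^sup>2) * M $ i $ j + (\<Sum>k\<in>UNIV. sh z k * ch z k * M $ k $ i * M $ k $ j)"
      unfolding ch_sh M_sym[of j i] by (simp add: power2_eq_square algebra_simps)
    finally show ?thesis .
  qed
  note W = this
  have "(transpose (A z) ** A1 z) $ i $ j = (transpose (A z) ** A1 z) $ j $ i" for i j
    unfolding W M_sym[of j i] by (auto simp: ac_simps)
  then have "transpose (transpose (A z) ** A1 z) = transpose (A z) ** A1 z"
    by (simp add: transpose_def vec_eq_iff)
  then have s: "transpose (A1 z) ** A z = transpose (A z) ** A1 z"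
    by (simp add: matrix_transpose_mul)
  have "transpose (\<phi> z) ** \<phi>1 z = U ** (transpose (A z) ** ((Ut ** U) ** A1 z)) ** Ut"
    unfolding phi_eq \<phi>1_def by (simp add: matrix_transpose_mul matrix_mul_assoc)
  also have "\<dots> = U ** (transpose (A1 z) ** ((Ut ** U) ** A z)) ** Ut" by (simp add: UU s)
  also have "\<dots> = transpose (\<phi>1 z) ** \<phi> z"
    unfolding phi_eq \<phi>1_def by (simp add: matrix_transpose_mul matrix_mul_assoc)
  finally show ?thesis .
qed

text \<open>Logarithmic derivative of \<open>\<phi>\<close>. \<open>cramer_inv\<close> agrees with
  the inverse wherever \<open>\<phi>\<close> is invertible and is differentiable there by the
  quotient rule.\<close>

definition Q :: "real \<Rightarrow> real^'n^'n" where "Q z = \<phi>1 z ** cramer_inv (\<phi> z)"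

lemma phi_cramer: "z \<in> {0..x} \<Longrightarrow> \<phi> z ** cramer_inv (\<phi> z) = mat 1" "z \<in> {0..x} \<Longrightarrow> cramer_inv (\<phi> z) ** \<phi> z = mat 1"
  using matrix_inv_works[OF phi_inv] matrix_inv_cramer[OF phi_inv] by auto

lemma beta_eq: "y \<in> {0..x} \<Longrightarrow> beta U r p x t y = - Q (x - y)"
proof -
  assume y: "y \<in> {0..x}"
  have "vector_derivative \<phi> (at (x - y)) = \<phi>1 (x - y)"
    by (rule vector_derivative_at) (rule mderiv_has_vector_derivative[OF phi_deriv])
  then show ?thesis using y matrix_inv_cramer[OF phi_inv, of "x - y"] by (simp add: beta_def Q_def)
qed

text \<open>\<open>Q\<close> is congruent, by the inverse of \<open>\<phi>\<close>, to the matrix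
  \<open>transpose \<phi> ** \<phi>1\<close> that \<open>wronskian_symmetric\<close> shows to be
  symmetric.\<close>

lemma Q_symmetric:
  assumes "z \<in> {0..x}"
  shows "Q z $ i $ j = Q z $ j $ i"
proof -
  let ?g = "cramer_inv (\<phi> z)"
  have tg: "transpose ?g ** transpose (\<phi> z) = mat 1"
    using phi_cramer(1)[OF assms] by (metis matrix_transpose_mul transpose_mat)
  have "Q z = (transpose ?g ** transpose (\<phi> z)) ** (\<phi>1 z ** ?g)" unfolding tg by (simp add: Q_def)
  also have "\<dots> = transpose ?g ** (transpose (\<phi> z) ** \<phi>1 z) ** ?g" by (simp add: matrix_mul_assoc)
  also have "\<dots> = transpose ?g ** transpose (\<phi>1 z) ** (\<phi> z ** ?g)"
    unfolding wronskian_symmetric by (simp add: matrix_mul_assoc)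
  also have "\<dots> = transpose (Q z)" unfolding phi_cramer(1)[OF assms] by (simp add: Q_def matrix_transpose_mul)
  finally have "Q z = transpose (Q z)" .
  then have "Q z $ i $ j = transpose (Q z) $ i $ j" by simp
  then show ?thesis by (simp add: transpose_def)
qed

lemma cramer_phi_differentiable: "z \<in> {0..x} \<Longrightarrow> \<exists>B'. mderiv (\<lambda>z. cramer_inv (\<phi> z)) B' z"
  using cramer_inv_differentiable[OF phi_deriv] phi_inv invertible_det_nz by blast

lemma Q_continuous: "continuous_on {0..x} (\<lambda>z. Q z $ i $ j)"
proof (rule continuous_at_imp_continuous_on, rule ballI)
  fix z assume "z \<in> {0..x}"
  then obtain B' where "mderiv (\<lambda>z. cramer_inv (\<phi> z)) B' z" using cramer_phi_differentiable by blast
  from mderiv_mult[OF phi1_deriv this] show "isCont (\<lambda>z. Q z $ i $ j) z"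
    unfolding mderiv_def Q_def by (blast intro: DERIV_isCont)
qed

text \<open>Differentiating \<open>\<phi> ** cramer_inv \<phi> = mat 1\<close> determines the
  derivative of the inverse. The identity is known on \<open>[0, x]\<close> only, whence the open
  interval; the ends are later covered by continuity.\<close>

lemma Q_deriv:
  assumes z: "z \<in> {0<..<x}"
  shows "mderiv Q (E - Q z ** Q z) z"
proof -
  let ?g = "\<lambda>z. cramer_inv (\<phi> z)"
  have z': "z \<in> {0..x}" using z by auto
  obtain B' where B': "mderiv ?g B' z" using cramer_phi_differentiable[OF z'] by blast
  have "(\<phi>1 z ** ?g z + \<phi> z ** B') $ i $ j = 0" for i j
  proof -
    have "((\<lambda>z. (\<phi> z ** ?g z) $ i $ j) has_real_derivative (\<phi>1 z ** ?g z + \<phi> z ** B') $ i $ j) (at z)"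
      using mderiv_mult[OF phi_deriv B'] by (simp add: mderiv_def)
    moreover have "((\<lambda>z. (\<phi> z ** ?g z) $ i $ j) has_real_derivative 0) (at z)"
    proof (rule has_field_derivative_transform_within_open[OF DERIV_const[of "mat 1 $ i $ j"] _ z])
      show "mat 1 $ i $ j = (\<phi> w ** ?g w) $ i $ j" if "w \<in> {0<..<x}" for w
        using phi_cramer(1)[of w] that by simp
    qed simp
    ultimately show ?thesis by (rule DERIV_unique)
  qed
  then have "\<phi>1 z ** ?g z + \<phi> z ** B' = 0" by (simp add: vec_eq_iff)
  then have "\<phi> z ** B' = - Q z" by (simp add: Q_def eq_neg_iff_add_eq_0 add.commute)
  then have "?g z ** (\<phi> z ** B') = ?g z ** (- Q z)" by simp
  then have B'_eq: "B' = ?g z ** (- Q z)" using phi_cramer(2)[OF z'] by (simp add: matrix_mul_assoc)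
  have neg: "X ** (- Y) = - (X ** Y)" for X Y :: "real^'n^'n"
    by (simp add: matrix_matrix_mult_def vec_eq_iff sum_negf)
  have "(E ** \<phi> z) ** ?g z + \<phi>1 z ** B' = E - Q z ** Q z"
  proof -
    have "(E ** \<phi> z) ** ?g z = E" using phi_cramer(1)[OF z'] by (simp flip: matrix_mul_assoc)
    moreover have "\<phi>1 z ** B' = - (Q z ** Q z)" unfolding B'_eq neg by (simp add: Q_def matrix_mul_assoc)
    ultimately show ?thesis by simp
  qed
  then show ?thesis using mderiv_mult[OF phi1_deriv B'] by (simp add: Q_def[abs_def])
qed

text \<open>This is \<open>beta\<close> on \<open>[0, x]\<close>. The sign and the time reversal
  compensate, so \<open>b\<close> satisfies the same Riccati equation as \<open>Q\<close>.\<close>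

definition b :: "real \<Rightarrow> real^'n^'n" where "b y = - Q (x - y)"

lemma b_symmetric: "y \<in> {0..x} \<Longrightarrow> b y $ i $ j = b y $ j $ i"
  using Q_symmetric[of "x - y"] by (simp add: b_def)

lemma b_continuous: "continuous_on {0..x} (\<lambda>y. b y $ i $ j)"
proof -
  have "continuous_on {0..x} ((\<lambda>z. Q z $ i $ j) \<circ> (\<lambda>y. x - y))"
    by (intro continuous_on_compose continuous_intros continuous_on_subset[OF Q_continuous]) auto
  then show ?thesis by (simp add: b_def o_def continuous_on_minus)
qed

lemma b_deriv:
  assumes y: "y \<in> {0<..<x}"
  shows "mderiv b (E - b y ** b y) y"
  unfolding mderiv_def
proof (intro allI)
  fix i j
  have "((\<lambda>z. Q z $ i $ j) has_real_derivative (E - Q (x - y) ** Q (x - y)) $ i $ j) (at (x - y))"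
    using Q_deriv[of "x - y"] y by (simp add: mderiv_def)
  moreover have "((\<lambda>y. x - y) has_real_derivative -1) (at y)" by (auto intro!: derivative_eq_intros)
  ultimately have "((\<lambda>y. Q (x - y) $ i $ j) has_real_derivative (E - Q (x - y) ** Q (x - y)) $ i $ j * (-1)) (at y)"
    by (rule DERIV_chain2)
  then have "((\<lambda>y. - (Q (x - y) $ i $ j)) has_real_derivative (E - Q (x - y) ** Q (x - y)) $ i $ j) (at y)"
    using DERIV_minus by fastforce
  moreover have "Q (x - y) ** Q (x - y) = b y ** b y"
    by (simp add: b_def matrix_matrix_mult_def vec_eq_iff)
  ultimately show "((\<lambda>y. b y $ i $ j) has_real_derivative (E - b y ** b y) $ i $ j) (at y)" by (simp add: b_def)
qed

end

section \<open>Positivity of the quadratic form\<close>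

lemma matrix_vector_inner: "(S *v v) \<bullet> w = (\<Sum>i\<in>UNIV. \<Sum>j\<in>UNIV. S $ i $ j * v $ j * w $ i)" for S :: "real^'n^'n"
  by (simp add: matrix_vector_mult_def inner_vec_def sum_distrib_right)

context riccati
begin

definition G :: "real^'n^'n" where "G = b x - diag p"

lemma G_symmetric: "G $ i $ j = G $ j $ i"
  using b_symmetric[of x i j] x_pos by (simp add: G_def diag_def)

lemma beta_at_x: "beta U r p x t x = b x"
  using beta_eq[of x] x_pos by (simp add: b_def)

sublocale K: ou_kernel p c a x G
  by (rule ou_kernel.intro) (rule x_pos G_symmetric)+

text \<open>The left side is the derivative of \<open>(S *v \<xi>) \<bullet> \<xi>\<close> along
  \<open>\<xi>' = D \<xi> + F\<close>. With \<open>v = b \<xi>\<close> and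
  \<open>d = D \<xi>\<close>, everything but the term in \<open>c\<close> collects to
  \<open>2 F \<bullet> (v - d) - |v - d|^2\<close>, and the square is completed.\<close>

lemma riccati_derivative_identity:
  fixes \<xi> F :: "real^'n"
  assumes y: "y \<in> {0..x}"
  defines "S \<equiv> b y - diag p" and "\<xi>' \<equiv> diag p *v \<xi> + F"
  shows "((E - b y ** b y) *v \<xi>) \<bullet> \<xi> + (S *v \<xi>') \<bullet> \<xi> + (S *v \<xi>) \<bullet> \<xi>'
    = F \<bullet> F + (a * (c \<bullet> \<xi>))\<^sup>2 - (F - S *v \<xi>) \<bullet> (F - S *v \<xi>)"
proof -
  define v d where "v = b y *v \<xi>" and "d = diag p *v \<xi>"
  have S: "S *v \<xi> = v - d" by (simp add: S_def v_def d_def matrix_vector_mult_diff_rdistrib)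
  have Ssym: "S $ i $ j = S $ j $ i" for i j
    using b_symmetric[OF y, of i j] by (simp add: S_def diag_def)
  have "((E - b y ** b y) *v \<xi>) = E *v \<xi> - b y *v v"
    by (simp add: v_def matrix_vector_mult_diff_rdistrib matrix_vector_mul_assoc)
  moreover have "(E *v \<xi>) \<bullet> \<xi> = d \<bullet> d + (a * (c \<bullet> \<xi>))\<^sup>2"
    by (simp add: E_vec d_def diag_mult_vec inner_add_left) (simp add: inner_vec_def power2_eq_square ac_simps)
  moreover have "(b y *v v) \<bullet> \<xi> = v \<bullet> v"
    using mat_vec_inner_symmetric[of "b y" v \<xi>] b_symmetric[OF y] by (simp add: v_def)
  moreover have "(S *v \<xi>') \<bullet> \<xi> = (d + F) \<bullet> (v - d)"
    using mat_vec_inner_symmetric[of S \<xi>' \<xi>] Ssym by (simp add: S \<xi>'_def d_def)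
  moreover have "(S *v \<xi>) \<bullet> \<xi>' = (v - d) \<bullet> (d + F)" by (simp add: S \<xi>'_def d_def)
  ultimately show ?thesis
    unfolding S by (simp add: inner_diff_left inner_diff_right inner_add_left inner_add_right inner_commute[of d v]
        inner_commute[of d F] inner_commute[of v F])
qed

text \<open>Gronwall argument: the squared norm of \<open>\<xi>\<close>, damped by
  \<open>exp (- L * y)\<close>, has nonpositive derivative and starts at 0.\<close>

lemma linear_ode_zero:
  fixes \<xi> :: "real \<Rightarrow> real^'n"
  assumes d: "\<And>y i. y \<in> {0..x} \<Longrightarrow> ((\<lambda>y. \<xi> y $ i) has_real_derivative (b y *v \<xi> y) $ i) (at y within {0..x})"
    and \<xi>0: "\<xi> 0 = 0" and y: "y \<in> {0..x}"
  shows "\<xi> y = 0"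
proof -
  have "\<exists>B. \<forall>y\<in>{0..x}. \<bar>b y $ i $ j\<bar> \<le> B" for i j
    using compact_imp_bounded[OF compact_continuous_image[OF b_continuous[of i j]]] by (auto simp: bounded_iff)
  then obtain B where B: "\<And>i j y. y \<in> {0..x} \<Longrightarrow> \<bar>b y $ i $ j\<bar> \<le> B i j" by metis
  \<comment> \<open>The factor 2 comes from differentiating the square; the double sum bounds the
    quadratic form of \<open>b y\<close> entry by entry.\<close>
  define L where "L = 2 * (\<Sum>i\<in>UNIV. \<Sum>j\<in>UNIV. B i j)"
  have bound: "2 * ((b y *v v) \<bullet> v) \<le> L * (v \<bullet> v)" if "y \<in> {0..x}" for y v
  proof -
    have "(b y *v v) \<bullet> v \<le> (\<Sum>i\<in>UNIV. \<Sum>j\<in>UNIV. B i j * (v \<bullet> v))"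
      unfolding matrix_vector_inner
    proof (intro sum_mono)
      fix i j
      have "b y $ i $ j * v $ j * v $ i \<le> \<bar>b y $ i $ j\<bar> * (\<bar>v $ j\<bar> * \<bar>v $ i\<bar>)"
        by (metis abs_ge_self abs_mult mult.assoc)
      also have "\<dots> \<le> B i j * (norm v * norm v)"
        using B[OF that, of i j] component_le_norm_cart[of v] by (intro mult_mono) auto
      finally show "b y $ i $ j * v $ j * v $ i \<le> B i j * (v \<bullet> v)" by (simp add: power2_norm_eq_inner flip: power2_eq_square)
    qed
    then show ?thesis by (simp add: L_def sum_distrib_right)
  qed
  define n where "n y = exp (- L * y) * (\<xi> y \<bullet> \<xi> y)" for y
  have nd: "(n has_real_derivative exp (- L * y) * (2 * ((b y *v \<xi> y) \<bullet> \<xi> y) - L * (\<xi> y \<bullet> \<xi> y))) (at y within {0..x})"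
    if "y \<in> {0..x}" for y
  proof -
    have "((\<lambda>y. \<Sum>i\<in>UNIV. \<xi> y $ i * \<xi> y $ i) has_real_derivative (\<Sum>i\<in>UNIV. (b y *v \<xi> y) $ i * \<xi> y $ i + (b y *v \<xi> y) $ i * \<xi> y $ i)) (at y within {0..x})"
      using d[OF that] by (intro DERIV_sum DERIV_mult)
    then have "((\<lambda>y. \<xi> y \<bullet> \<xi> y) has_real_derivative 2 * ((b y *v \<xi> y) \<bullet> \<xi> y)) (at y within {0..x})"
      by (simp add: inner_vec_def sum_distrib_left ac_simps)
    then show ?thesis unfolding n_def by (auto intro!: derivative_eq_intros simp: algebra_simps)
  qed
  have "(n has_real_derivative exp (- L * s) * (2 * ((b s *v \<xi> s) \<bullet> \<xi> s) - L * (\<xi> s \<bullet> \<xi> s))) (at s within {0..y})"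
    if "s \<in> {0..y}" for s
    using that y by (intro DERIV_subset[OF nd]) auto
  then have "((\<lambda>y. exp (- L * y) * (2 * ((b y *v \<xi> y) \<bullet> \<xi> y) - L * (\<xi> y \<bullet> \<xi> y))) has_integral (n y - n 0)) {0..y}"
    using y by (intro fundamental_theorem_of_calculus)
      (simp_all only: has_real_derivative_iff_has_vector_derivative atLeastAtMost_iff)
  moreover have "((\<lambda>y. 0) has_integral (0::real)) {0..y}" by simp
  ultimately have "n y - n 0 \<le> 0"
    by (rule has_integral_le) (use y bound in \<open>auto simp: mult_le_0_iff\<close>)
  then have "\<xi> y \<bullet> \<xi> y \<le> 0" using \<xi>0 by (simp add: n_def mult_le_0_iff)
  then show ?thesis by (meson inner_gt_zero_iff not_le)
qed

text \<open>With \<open>\<xi>' = D \<xi> + f\<close> the quadratic form is the integral of \<open>|f - (\<beta> - D) \<xi>|\<^sup>2\<close>, by completing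
  the square with the Riccati equation \<open>\<beta>' = E - \<beta>\<^sup>2\<close>.\<close>

lemma form_positive:
  assumes f: "f \<in> real_L2 (Delta_measure x)" and fc: "\<And>i. continuous_on {0..x} (\<lambda>u. f (u, i))"
    and nz: "real_ip (Delta_measure x) f f \<noteq> 0"
  shows "0 < real_ip (Delta_measure x) f f + real_ip (Delta_measure x) (K.T f) f"
proof -
  define \<xi> where "\<xi> = K.response f"
  define F where "F u = (\<chi> i. f (u, i))" for u
  define S where "S y = b y - diag p" for y
  define R where "R y = F y - S y *v \<xi> y" for y
  have P: "K.path (K.prim f) \<xi>" unfolding \<xi>_def by (rule K.path_prim_response) (rule fc)
  have \<xi>c: "continuous_on {0..x} \<xi>" using P by (simp add: K.path_def)
  have \<xi>ci: "continuous_on {0..x} (\<lambda>y. \<xi> y $ i)" for i by (intro continuous_intros \<xi>c)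
  have Fci: "continuous_on {0..x} (\<lambda>y. F y $ i)" for i using fc by (simp add: F_def)
  have Sc: "continuous_on {0..x} (\<lambda>y. S y $ i $ j)" for i j
    unfolding S_def by (simp add: continuous_on_diff b_continuous)
  have dp: "(diag p *v \<xi> y) $ i = p $ i * \<xi> y $ i" for y i by (simp add: diag_mult_vec)
  have \<xi>d: "((\<lambda>y. \<xi> y $ i) has_real_derivative (diag p *v \<xi> y + F y) $ i) (at y within {0..x})" if "y \<in> {0..x}" for y i
    using K.response_derivative[where f = f, OF fc that, of i] by (simp add: \<xi>_def dp[unfolded \<xi>_def] F_def)
  have \<xi>0: "\<xi> 0 = 0" by (simp add: \<xi>_def K.response_def vec_eq_iff)
  have Rci: "continuous_on {0..x} (\<lambda>y. R y $ i)" for i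
    unfolding R_def by (simp add: matrix_vector_mult_def) (intro continuous_intros Fci Sc \<xi>c \<xi>ci)
  define w where "w y = (S y *v \<xi> y) \<bullet> \<xi> y" for y
  have wc: "continuous_on {0..x} w"
    unfolding w_def matrix_vector_inner by (intro continuous_intros Sc \<xi>ci)
  define I where "I y = F y \<bullet> F y + (a * (c \<bullet> \<xi> y))\<^sup>2 - R y \<bullet> R y" for y
  \<comment> \<open>Available in the open interval only, like \<open>b_deriv\<close>; continuity of
    \<open>w\<close> up to the ends suffices for the fundamental theorem.\<close>
  have wd: "(w has_real_derivative I y) (at y)" if y: "y \<in> {0<..<x}" for y
  proof -
    have y': "y \<in> {0..x}" using y by auto
    have at: "at y within {0..x} = at y" using y by (intro at_within_interior) auto
    have d1: "((\<lambda>y. S y $ i $ j) has_real_derivative (E - b y ** b y) $ i $ j) (at y)" for i j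
      using b_deriv[OF y] unfolding mderiv_def S_def by (auto intro!: derivative_eq_intros)
    have d2: "((\<lambda>y. \<xi> y $ i) has_real_derivative (diag p *v \<xi> y + F y) $ i) (at y)" for i
      using \<xi>d[OF y', of i] by (simp add: at)
    have "(w has_real_derivative (\<Sum>i\<in>UNIV. \<Sum>j\<in>UNIV. (((E - b y ** b y) $ i $ j * \<xi> y $ j + (diag p *v \<xi> y + F y) $ j * S y $ i $ j) * \<xi> y $ i
        + (diag p *v \<xi> y + F y) $ i * (S y $ i $ j * \<xi> y $ j)))) (at y)"
      unfolding w_def matrix_vector_inner by (intro DERIV_sum DERIV_mult d1 d2)
    also have "(\<Sum>i\<in>UNIV. \<Sum>j\<in>UNIV. (((E - b y ** b y) $ i $ j * \<xi> y $ j + (diag p *v \<xi> y + F y) $ j * S y $ i $ j) * \<xi> y $ i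
        + (diag p *v \<xi> y + F y) $ i * (S y $ i $ j * \<xi> y $ j)))
      = ((E - b y ** b y) *v \<xi> y) \<bullet> \<xi> y + (S y *v (diag p *v \<xi> y + F y)) \<bullet> \<xi> y + (S y *v \<xi> y) \<bullet> (diag p *v \<xi> y + F y)"
      unfolding matrix_vector_inner[of "E - b y ** b y"] matrix_vector_inner[of "S y"]
      by (simp only: sum.distrib[symmetric] distrib_left distrib_right mult.assoc mult.commute mult.left_commute)
    also have "\<dots> = I y"
      unfolding S_def I_def R_def by (rule riccati_derivative_identity[OF y'])
    finally show ?thesis .
  qed
  have "(I has_integral (w x - w 0)) {0..x}"
    using x_pos wc wd by (intro fundamental_theorem_of_calculus_interior)
      (auto simp: has_real_derivative_iff_has_vector_derivative)
  then have intI: "integral {0..x} I = w x" using \<xi>0 by (simp add: integral_unique w_def)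
  have c1: "continuous_on {0..x} (\<lambda>y. F y \<bullet> F y)" "continuous_on {0..x} (\<lambda>y. (a * (c \<bullet> \<xi> y))\<^sup>2)" "continuous_on {0..x} (\<lambda>y. R y \<bullet> R y)"
    unfolding inner_vec_def by (intro continuous_intros Fci Rci \<xi>ci)+
  have split: "integral {0..x} I = integral {0..x} (\<lambda>y. F y \<bullet> F y) + integral {0..x} (\<lambda>y. (a * (c \<bullet> \<xi> y))\<^sup>2) - integral {0..x} (\<lambda>y. R y \<bullet> R y)"
    unfolding I_def using c1
    by (simp add: Henstock_Kurzweil_Integration.integral_diff Henstock_Kurzweil_Integration.integral_add integrable_continuous_interval continuous_on_add)
  have ff: "real_ip (Delta_measure x) f f = integral {0..x} (\<lambda>y. F y \<bullet> F y)"
  proof -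
    have "integrable (Delta_measure x) (\<lambda>\<eta>. f \<eta> * f \<eta>)" using f by (intro integrable_mult_real_L2)
    then have "real_ip (Delta_measure x) f f = (\<Sum>i\<in>UNIV. \<integral>u. f (u, i) * f (u, i) \<partial>K.\<nu>0)"
      unfolding real_ip_def by (rule K.integral_Delta)
    also have "\<dots> = (\<Sum>i\<in>UNIV. integral {0..x} (\<lambda>u. F u $ i * F u $ i))"
      unfolding F_def vec_lambda_beta
      by (intro sum.cong refl integrable_restrict_IccD(2) integrable_restrict_Icc_continuous continuous_intros fc)
    also have "\<dots> = integral {0..x} (\<lambda>y. \<Sum>i\<in>UNIV. F y $ i * F y $ i)"
      by (intro integral_sum[symmetric]) (auto intro!: integrable_continuous_interval continuous_intros Fci)
    finally show ?thesis by (simp add: inner_vec_def)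
  qed
  have Tf: "real_ip (Delta_measure x) (K.T f) f = integral {0..x} (\<lambda>y. (a * (c \<bullet> \<xi> y))\<^sup>2) - w x"
  proof -
    have "(\<integral>y. K.obs f y * K.obs f y \<partial>K.\<nu>0) = (\<integral>y. (a * (c \<bullet> \<xi> y))\<^sup>2 \<partial>K.\<nu>0)"
      by (rule Bochner_Integration.integral_cong) (auto simp: K.obs_response[OF f fc] \<xi>_def power2_eq_square space_restrict_space)
    also have "\<dots> = integral {0..x} (\<lambda>y. (a * (c \<bullet> \<xi> y))\<^sup>2)"
      by (intro integrable_restrict_IccD(2) integrable_restrict_Icc_continuous c1)
    moreover have "(\<Sum>i\<in>UNIV. \<Sum>j\<in>UNIV. G $ i $ j * K.obs_end f i * K.obs_end f j) = w x"
      unfolding w_def matrix_vector_inner K.obs_end_response[OF f fc]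
      by (simp add: S_def G_def \<xi>_def ac_simps)
    ultimately show ?thesis using K.ip_T[OF f f] by simp
  qed
  have eq: "real_ip (Delta_measure x) f f + real_ip (Delta_measure x) (K.T f) f = integral {0..x} (\<lambda>y. R y \<bullet> R y)"
    using ff Tf split intI by simp
  \<comment> \<open>Strictness: if the integral vanishes, then \<open>F = (b - D) \<xi>\<close>, so
    \<open>\<xi>' = b \<xi>\<close> with \<open>\<xi> 0 = 0\<close>. Uniqueness gives
    \<open>\<xi> = 0\<close> and thus \<open>F = 0\<close>, against \<open>nz\<close>.\<close>
  have "integral {0..x} (\<lambda>y. R y \<bullet> R y) \<noteq> 0"
  proof
    assume "integral {0..x} (\<lambda>y. R y \<bullet> R y) = 0"
    then have R0: "R y = 0" if "y \<in> {0..x}" for y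
      using integral_eq_0_iff[OF c1(3) x_pos] that by simp
    have ode: "((\<lambda>y. \<xi> y $ i) has_real_derivative (b y *v \<xi> y) $ i) (at y within {0..x})" if "y \<in> {0..x}" for y i
    proof -
      have "F y = S y *v \<xi> y" using R0[OF that] by (simp add: R_def)
      then have "diag p *v \<xi> y + F y = b y *v \<xi> y" by (simp add: S_def matrix_vector_mult_diff_rdistrib)
      then show ?thesis using \<xi>d[OF that, of i] by simp
    qed
    have "\<xi> y = 0" if "y \<in> {0..x}" for y
      by (rule linear_ode_zero[where \<xi> = \<xi>]) (rule ode \<xi>0 that | assumption)+
    then have "F y = 0" if "y \<in> {0..x}" for y using R0[OF that] that by (simp add: R_def)
    then have "integral {0..x} (\<lambda>y. F y \<bullet> F y) = integral {0..x} (\<lambda>y. 0)"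
      by (intro Henstock_Kurzweil_Integration.integral_cong) auto
    then show False using nz ff by simp
  qed
  moreover have "0 \<le> integral {0..x} (\<lambda>y. R y \<bullet> R y)"
    by (rule integral_nonneg) (use c1 in \<open>auto intro: integrable_continuous_interval\<close>)
  ultimately show ?thesis using eq by simp
qed

lemma eigenvalue_bound:
  assumes e: "e \<in> real_L2 (Delta_measure x)" and Te: "K.T e = l *\<^sub>R e" and l: "l \<noteq> 0"
    and e1: "real_ip (Delta_measure x) e e = 1"
  shows "- 1 < l"
proof -
  have "0 < real_ip (Delta_measure x) e e + real_ip (Delta_measure x) (K.T e) e"
    by (rule form_positive[OF e K.eigenfunction_continuous[OF e Te l]]) (simp add: e1)
  then show ?thesis using e e1 by (simp add: Te K.ip_scale_left)
qed

end

section \<open>The Gaussian family attached to the eigenfunctions\<close>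

text \<open>Bounded second moments give uniform integrability. Fatou's lemma transfers the bound to
  the limit; the distance \<open>d\<close> is then truncated by
  \<open>d \<le> min d R + d^2 / R\<close>, with dominated convergence for the first term and the
  moment bound for the second.\<close>

lemma (in prob_space) L2_bounded_integral_tendsto:
  fixes F :: "nat \<Rightarrow> 'a \<Rightarrow> complex"
  assumes meas [measurable]: "\<And>n. F n \<in> borel_measurable M"
    and lim: "\<And>\<omega>. \<omega> \<in> space M \<Longrightarrow> (\<lambda>n. F n \<omega>) \<longlonglongrightarrow> f \<omega>"
    and sq: "\<And>n. has_bochner_integral M (\<lambda>\<omega>. (norm (F n \<omega>))\<^sup>2) (s n)" and bound: "\<And>n. s n \<le> C"
  shows "integrable M f" "(\<lambda>n. \<integral>\<omega>. F n \<omega> \<partial>M) \<longlonglongrightarrow> (\<integral>\<omega>. f \<omega> \<partial>M)"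
proof -
  have fm [measurable]: "f \<in> borel_measurable M" by (rule borel_measurable_LIMSEQ_metric[OF meas lim])
  have nn: "(\<integral>\<^sup>+\<omega>. ennreal ((norm (F n \<omega>))\<^sup>2) \<partial>M) \<le> ennreal C" for n
    using sq[of n] bound[of n] by (simp add: has_bochner_integral_iff nn_integral_eq_integral ennreal_leI)
  have C0: "0 \<le> C"
  proof -
    have "s 0 = (\<integral>\<omega>. (norm (F 0 \<omega>))\<^sup>2 \<partial>M)" using sq[of 0] by (simp add: has_bochner_integral_iff)
    also have "0 \<le> \<dots>" by simp
    finally show ?thesis using bound[of 0] by simp
  qed
  have "(\<integral>\<^sup>+\<omega>. ennreal ((norm (f \<omega>))\<^sup>2) \<partial>M) = (\<integral>\<^sup>+\<omega>. liminf (\<lambda>n. ennreal ((norm (F n \<omega>))\<^sup>2)) \<partial>M)"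
  proof (rule nn_integral_cong)
    fix \<omega> assume "\<omega> \<in> space M"
    then have "(\<lambda>n. ennreal ((norm (F n \<omega>))\<^sup>2)) \<longlonglongrightarrow> ennreal ((norm (f \<omega>))\<^sup>2)"
      by (intro tendsto_intros tendsto_ennrealI lim)
    then show "ennreal ((norm (f \<omega>))\<^sup>2) = liminf (\<lambda>n. ennreal ((norm (F n \<omega>))\<^sup>2))"
      by (rule lim_imp_Liminf[OF trivial_limit_sequentially, symmetric])
  qed
  also have "\<dots> \<le> liminf (\<lambda>n. \<integral>\<^sup>+\<omega>. ennreal ((norm (F n \<omega>))\<^sup>2) \<partial>M)" by (rule nn_integral_liminf) measurable
  also have "\<dots> \<le> liminf (\<lambda>n. ennreal C)" by (intro Liminf_mono always_eventually allI nn)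
  also have "\<dots> = ennreal C" by (simp add: Liminf_const)
  finally have fC: "(\<integral>\<^sup>+\<omega>. ennreal ((norm (f \<omega>))\<^sup>2) \<partial>M) \<le> ennreal C" .
  have f2: "integrable M (\<lambda>\<omega>. (norm (f \<omega>))\<^sup>2)"
    by (rule integrableI_nonneg) (use fC in \<open>auto intro: le_less_trans\<close>)
  have f2C: "(\<integral>\<omega>. (norm (f \<omega>))\<^sup>2 \<partial>M) \<le> C"
    using fC f2 C0 by (simp add: nn_integral_eq_integral ennreal_le_iff)
  have dom: "norm w \<le> 1 + (norm w)\<^sup>2" for w :: complex
  proof -
    have "0 \<le> (norm w - 1)\<^sup>2" by simp
    then have "2 * norm w \<le> 1 + (norm w)\<^sup>2" by (simp add: power2_diff)
    then show ?thesis using norm_ge_zero[of w] by linarith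
  qed
  have int1: "integrable M g" if "g \<in> borel_measurable M" "integrable M (\<lambda>\<omega>. (norm (g \<omega>))\<^sup>2)" for g :: "'a \<Rightarrow> complex"
  proof (rule Bochner_Integration.integrable_bound[of _ "\<lambda>\<omega>. 1 + (norm (g \<omega>))\<^sup>2"])
    show "AE \<omega> in M. norm (g \<omega>) \<le> norm (1 + (norm (g \<omega>))\<^sup>2)" using dom by (simp add: add_nonneg_nonneg)
  qed (use that in auto)
  show fi: "integrable M f" using fm f2 by (rule int1)
  have Fi: "integrable M (F n)" for n using meas sq by (intro int1) (auto simp: has_bochner_integral_iff)
  define d where "d n \<omega> = norm (F n \<omega> - f \<omega>)" for n \<omega>
  have dm [measurable]: "d n \<in> borel_measurable M" for n unfolding d_def by measurable
  have d2b: "(d n \<omega>)\<^sup>2 \<le> 2 * (norm (F n \<omega>))\<^sup>2 + 2 * (norm (f \<omega>))\<^sup>2" for n \<omega>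
  proof -
    have "d n \<omega> \<le> norm (F n \<omega>) + norm (f \<omega>)" unfolding d_def by (rule norm_triangle_ineq4)
    then have "(d n \<omega>)\<^sup>2 \<le> (norm (F n \<omega>) + norm (f \<omega>))\<^sup>2" by (rule power_mono) (simp add: d_def)
    also have "\<dots> \<le> 2 * (norm (F n \<omega>))\<^sup>2 + 2 * (norm (f \<omega>))\<^sup>2"
      using zero_le_power2[of "norm (F n \<omega>) - norm (f \<omega>)"] by (simp add: power2_sum power2_diff)
    finally show ?thesis .
  qed
  have F2i: "integrable M (\<lambda>\<omega>. (norm (F n \<omega>))\<^sup>2)" for n using sq by (auto simp: has_bochner_integral_iff)
  have d2i: "integrable M (\<lambda>\<omega>. (d n \<omega>)\<^sup>2)" for n
  proof (rule Bochner_Integration.integrable_bound[of _ "\<lambda>\<omega>. 2 * (norm (F n \<omega>))\<^sup>2 + 2 * (norm (f \<omega>))\<^sup>2"])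
    show "integrable M (\<lambda>\<omega>. 2 * (norm (F n \<omega>))\<^sup>2 + 2 * (norm (f \<omega>))\<^sup>2)" using F2i f2 by simp
    show "AE \<omega> in M. norm ((d n \<omega>)\<^sup>2) \<le> norm (2 * (norm (F n \<omega>))\<^sup>2 + 2 * (norm (f \<omega>))\<^sup>2)" using d2b by simp
  qed simp
  have d2C: "(\<integral>\<omega>. (d n \<omega>)\<^sup>2 \<partial>M) \<le> 4 * C" for n
  proof -
    have "(\<integral>\<omega>. (d n \<omega>)\<^sup>2 \<partial>M) \<le> (\<integral>\<omega>. 2 * (norm (F n \<omega>))\<^sup>2 + 2 * (norm (f \<omega>))\<^sup>2 \<partial>M)"
      using d2i F2i f2 d2b by (intro integral_mono) auto
    also have "\<dots> = 2 * s n + 2 * (\<integral>\<omega>. (norm (f \<omega>))\<^sup>2 \<partial>M)" using F2i f2 sq[of n] by (simp add: has_bochner_integral_iff)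
    finally show ?thesis using bound[of n] f2C by linarith
  qed
  show "(\<lambda>n. \<integral>\<omega>. F n \<omega> \<partial>M) \<longlonglongrightarrow> (\<integral>\<omega>. f \<omega> \<partial>M)"
  proof (rule LIMSEQ_I)
    fix e :: real assume e: "0 < e"
    \<comment> \<open>Makes \<open>4 * C / R \<le> e / 2\<close>; the summand 1 keeps
      \<open>R\<close> positive when \<open>C = 0\<close>.\<close>
    define R where "R = 8 * C / e + 1"
    have R: "0 < R" using C0 e by (simp add: R_def add_nonneg_pos)
    have "(\<lambda>n. \<integral>\<omega>. min (d n \<omega>) R \<partial>M) \<longlonglongrightarrow> (\<integral>\<omega>. 0 \<partial>M)"
    proof (rule integral_dominated_convergence[where w = "\<lambda>_. R"])
      show "AE \<omega> in M. (\<lambda>n. min (d n \<omega>) R) \<longlonglongrightarrow> 0"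
      proof (rule AE_I2)
        fix \<omega> assume "\<omega> \<in> space M"
        from lim[OF this] have "(\<lambda>n. d n \<omega>) \<longlonglongrightarrow> 0" unfolding d_def by (simp add: LIM_zero tendsto_norm_zero)
        then have "(\<lambda>n. min (d n \<omega>) R) \<longlonglongrightarrow> min 0 R" by (intro tendsto_intros)
        then show "(\<lambda>n. min (d n \<omega>) R) \<longlonglongrightarrow> 0" using R by simp
      qed
      show "AE \<omega> in M. norm (min (d n \<omega>) R) \<le> R" for n using R by (auto simp: d_def min_def)
    qed auto
    then have lim0: "(\<lambda>n. \<integral>\<omega>. min (d n \<omega>) R \<partial>M) \<longlonglongrightarrow> 0" by simp
    have "\<exists>N. \<forall>n\<ge>N. norm ((\<integral>\<omega>. min (d n \<omega>) R \<partial>M) - 0) < e / 2"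
      by (rule LIMSEQ_D[OF lim0]) (use e in simp)
    then obtain N where N: "\<And>n. n \<ge> N \<Longrightarrow> \<bar>\<integral>\<omega>. min (d n \<omega>) R \<partial>M\<bar> < e / 2" by auto
    have "norm ((\<integral>\<omega>. F n \<omega> \<partial>M) - (\<integral>\<omega>. f \<omega> \<partial>M)) < e" if n: "n \<ge> N" for n
    proof -
      have mi: "integrable M (\<lambda>\<omega>. min (d n \<omega>) R)"
        by (rule integrable_const_bound[of _ R]) (use R in \<open>auto simp: d_def min_def\<close>)
      have "norm ((\<integral>\<omega>. F n \<omega> \<partial>M) - (\<integral>\<omega>. f \<omega> \<partial>M)) = norm (\<integral>\<omega>. F n \<omega> - f \<omega> \<partial>M)" using Fi fi by simp
      also have "\<dots> \<le> (\<integral>\<omega>. d n \<omega> \<partial>M)" unfolding d_def by (rule integral_norm_bound)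
      also have "\<dots> \<le> (\<integral>\<omega>. min (d n \<omega>) R + (d n \<omega>)\<^sup>2 / R \<partial>M)"
      proof (rule integral_mono)
        show "integrable M (d n)" unfolding d_def using Fi fi by simp
        show "integrable M (\<lambda>\<omega>. min (d n \<omega>) R + (d n \<omega>)\<^sup>2 / R)" using mi d2i by simp
        fix \<omega>
        have "0 \<le> d n \<omega>" by (simp add: d_def)
        show "d n \<omega> \<le> min (d n \<omega>) R + (d n \<omega>)\<^sup>2 / R"
        proof (cases "d n \<omega> \<le> R")
          case False
          then have "d n \<omega> * R \<le> (d n \<omega>)\<^sup>2" unfolding power2_eq_square using \<open>0 \<le> d n \<omega>\<close> by (intro mult_left_mono) auto
          then have "d n \<omega> \<le> (d n \<omega>)\<^sup>2 / R" using R by (simp add: pos_le_divide_eq)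
          then show ?thesis using R False by simp
        qed (use R in simp)
      qed
      also have "\<dots> = (\<integral>\<omega>. min (d n \<omega>) R \<partial>M) + (\<integral>\<omega>. (d n \<omega>)\<^sup>2 \<partial>M) / R" using mi d2i by simp
      also have "(\<integral>\<omega>. (d n \<omega>)\<^sup>2 \<partial>M) / R \<le> 4 * C / R" using d2C R by (intro divide_right_mono) auto
      also have "4 * C / R \<le> e / 2"
      proof -
        have "R * (e / 2) = 4 * C + e / 2" using e by (simp add: R_def distrib_right)
        then show ?thesis using R e by (simp add: pos_divide_le_eq mult.commute)
      qed
      also have "(\<integral>\<omega>. min (d n \<omega>) R \<partial>M) < e / 2" using N[OF n] by simp
      finally show ?thesis by simp
    qed
    then show "\<exists>N. \<forall>n\<ge>N. norm ((\<integral>\<omega>. F n \<omega> \<partial>M) - (\<integral>\<omega>. f \<omega> \<partial>M)) < e" by blast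
  qed
qed

lemma vec_nth_borel_measurable [measurable]: "(\<lambda>v :: real^'n. v $ i) \<in> borel_measurable borel"
  by (intro borel_measurable_continuous_onI continuous_intros)

text \<open>The eigenpairs are parameters, so the probabilistic part uses only their listed
  properties. The pathwise assumptions hold at every sample point, which makes the deterministic
  limits available everywhere.\<close>

locale ou_process = ou_kernel p c a x G
  for p c :: "real^'n" and a x and G :: "real^'n^'n" +
  fixes M :: "'w measure" and W \<xi> :: "real \<Rightarrow> 'w \<Rightarrow> real^'n"
    and e :: "nat \<Rightarrow> real \<times> 'n \<Rightarrow> real" and l :: "nat \<Rightarrow> real"
  assumes wiener: "wiener_process M W"
    and ou: "\<And>\<omega>. \<omega> \<in> space M \<Longrightarrow> continuous_on {0..} (\<lambda>s. \<xi> s \<omega>)"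
      "\<And>\<omega> s. \<omega> \<in> space M \<Longrightarrow> 0 \<le> s \<Longrightarrow> \<xi> s \<omega> = W s \<omega> + integral {0..s} (\<lambda>u. diag p *v \<xi> u \<omega>)"
    and e_in [simp, intro]: "\<And>k. e k \<in> real_L2 (Delta_measure x)"
    and T_e: "\<And>k. T (e k) = l k *\<^sub>R e k"
    and orthonormal: "\<And>j k. real_ip (Delta_measure x) (e j) (e k) = (if j = k \<and> l j \<noteq> 0 then 1 else 0)"
    and summable_l: "summable (\<lambda>k. \<bar>l k\<bar>)"
    and expansion: "\<And>f. f \<in> real_L2 (Delta_measure x) \<Longrightarrow>
      (\<lambda>k. l k * (real_ip (Delta_measure x) (e k) f)\<^sup>2) sums real_ip (Delta_measure x) (T f) f"
    and l_gt: "\<And>k. - 1 < l k"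
begin

sublocale prob_space M using wiener by (simp add: wiener_process_def)

lemma path_process: "\<omega> \<in> space M \<Longrightarrow> path (\<lambda>s. W s \<omega>) (\<lambda>s. \<xi> s \<omega>)"
proof -
  assume \<omega>: "\<omega> \<in> space M"
  have sub: "{0..s} \<subseteq> {0..}" for s :: real by auto
  have xc: "continuous_on {0..s} (\<lambda>s. \<xi> s \<omega>)" for s using continuous_on_subset[OF ou(1)[OF \<omega>] sub] .
  have "\<xi> s \<omega> $ i = W s \<omega> $ i + p $ i * integral {0..s} (\<lambda>u. \<xi> u \<omega> $ i)" if "0 \<le> s" for s i
  proof -
    have c: "continuous_on {0..s} (\<lambda>u. diag p *v \<xi> u \<omega>)"
      unfolding diag_mult_vec by (intro continuous_on_vec_lambda continuous_intros xc)
    have "integral {0..s} (\<lambda>u. diag p *v \<xi> u \<omega>) $ i = integral {0..s} (\<lambda>u. (diag p *v \<xi> u \<omega>) $ i)"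
      using integral_component_eq_cart[OF integrable_continuous_interval[OF c]] by simp
    also have "\<dots> = p $ i * integral {0..s} (\<lambda>u. \<xi> u \<omega> $ i)" by (simp add: diag_mult_vec)
    finally show ?thesis using ou(2)[OF \<omega> that] by simp
  qed
  moreover have "W 0 \<omega> = 0" "continuous_on {0..x} (\<lambda>s. W s \<omega>)"
    using wiener \<omega> continuous_on_subset[OF _ sub] by (auto simp: wiener_process_def)
  ultimately show ?thesis using xc by (simp add: path_def)
qed

lemma W_measurable: "0 \<le> s \<Longrightarrow> W s \<in> borel_measurable M"
  using wiener by (simp add: wiener_process_def)

lemma incr_measurable [measurable]: "(\<lambda>\<omega>. incr m (\<lambda>s. W s \<omega>) q) \<in> borel_measurable M"
proof -
  obtain j i where q: "q = (j, i)" by (cases q)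
  have [measurable]: "W (real (Suc j) * (x / m)) \<in> borel_measurable M" "W (real j * (x / m)) \<in> borel_measurable M"
    using x_pos by (auto intro!: W_measurable)
  show ?thesis unfolding incr_def q case_prod_conv
    by measurable
qed

text \<open>Two layers of independence: over the components within one time step, and over disjoint
  time steps. Each turns the expectation of a product of exponentials into a product of
  one-dimensional moments.\<close>

lemma increments_exp:
  assumes m: "0 < m"
  shows "has_bochner_integral M (\<lambda>\<omega>. exp (\<Sum>q\<in>cells m. z q * complex_of_real (incr m (\<lambda>s. W s \<omega>) q)))
    (exp ((\<Sum>q\<in>cells m. (z q)\<^sup>2) / 2))"
proof -
  define h where "h = x / m"
  have h: "0 < h" using m x_pos by (simp add: h_def)
  define V where "V j \<omega> = W (real (Suc j) * h) \<omega> - W (real j * h) \<omega>" for j \<omega>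
  define Y where "Y j v = (\<Prod>i\<in>UNIV. exp (z (j, i) * complex_of_real (v $ i / sqrt h)))" for j and v :: "real^'n"
  have times: "0 \<le> real j * h \<and> real j * h < real (Suc j) * h" for j using h by simp
  have Vn: "distributed M lborel (\<lambda>\<omega>. V j \<omega> $ i / sqrt h) std_normal_density" for j i
  proof -
    have "distributed M lborel (\<lambda>\<omega>. (W (real (Suc j) * h) \<omega> - W (real j * h) \<omega>) $ i)
        (\<lambda>y. ennreal (normal_density 0 (sqrt (real (Suc j) * h - real j * h)) y))"
      using wiener times[of j] unfolding wiener_process_def by blast
    moreover have "real (Suc j) * h - real j * h = h" by (simp add: distrib_right)
    ultimately have "distributed M lborel (\<lambda>\<omega>. V j \<omega> $ i) (normal_density 0 (sqrt h))" by (simp add: V_def)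
    then show ?thesis using h by (subst (asm) normal_standard_normal_convert) auto
  qed
  have inner: "has_bochner_integral M (\<lambda>\<omega>. Y j (V j \<omega>)) (\<Prod>i\<in>UNIV. exp ((z (j, i))\<^sup>2 / 2))" for j
  proof -
    have i1: "has_bochner_integral M (\<lambda>\<omega>. exp (z (j, i) * complex_of_real (V j \<omega> $ i / sqrt h))) (exp ((z (j, i))\<^sup>2 / 2))" for i
      by (rule std_normal_exp[OF Vn])
    have "indep_vars (\<lambda>_. borel) (\<lambda>i \<omega>. (W (real (Suc j) * h) \<omega> - W (real j * h) \<omega>) $ i) UNIV"
      using wiener times[of j] unfolding wiener_process_def by blast
    then have "indep_vars (\<lambda>_. borel) (\<lambda>i \<omega>. V j \<omega> $ i) UNIV" by (simp add: V_def)
    then have iv: "indep_vars (\<lambda>_. borel) (\<lambda>i \<omega>. exp (z (j, i) * complex_of_real (V j \<omega> $ i / sqrt h))) UNIV"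
      by (rule indep_vars_compose2) measurable
    show ?thesis
      using indep_vars_lebesgue_integral[OF finite iv] indep_vars_integrable[OF finite iv] i1
      by (simp add: has_bochner_integral_iff Y_def)
  qed
  have ivV: "indep_vars (\<lambda>_. borel) V {..<m}"
  proof -
    \<comment> \<open>The \<open>m + 1\<close> partition points, from 0 to \<open>m * h\<close>,
      whose successive differences are the \<open>m\<close> increments.\<close>
    define ts where "ts = map (\<lambda>j. real j * h) [0..<Suc m]"
    have "sorted_wrt (<) ts" using h by (auto simp: ts_def sorted_wrt_iff_nth_less simp del: upt_Suc)
    moreover have "\<forall>t\<in>set ts. 0 \<le> t" using h by (auto simp: ts_def)
    ultimately have "indep_vars (\<lambda>_. borel) (\<lambda>k \<omega>. W (ts ! Suc k) \<omega> - W (ts ! k) \<omega>) {..<length ts - 1}"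
      using wiener unfolding wiener_process_def by blast
    moreover have "length ts - 1 = m" by (simp add: ts_def)
    ultimately have "indep_vars (\<lambda>_. borel) (\<lambda>k \<omega>. W (ts ! Suc k) \<omega> - W (ts ! k) \<omega>) {..<m}" by simp
    then show ?thesis
      by (subst indep_vars_cong[OF refl, of _ _ "\<lambda>k \<omega>. W (ts ! Suc k) \<omega> - W (ts ! k) \<omega>" _ "\<lambda>_. borel"])
        (auto simp: V_def ts_def fun_eq_iff nth_append simp del: upt_Suc)
  qed
  have Ym: "Y j \<in> borel_measurable borel" for j
    unfolding Y_def by measurable
  have iv: "indep_vars (\<lambda>_. borel) (\<lambda>j \<omega>. Y j (V j \<omega>)) {..<m}"
    using ivV Ym by (rule indep_vars_compose2)
  have "has_bochner_integral M (\<lambda>\<omega>. \<Prod>j<m. Y j (V j \<omega>)) (\<Prod>j<m. \<Prod>i\<in>UNIV. exp ((z (j, i))\<^sup>2 / 2))"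
    using indep_vars_lebesgue_integral[OF finite_lessThan iv] indep_vars_integrable[OF finite_lessThan iv] inner
    by (simp add: has_bochner_integral_iff)
  moreover have "(\<Prod>j<m. Y j (V j \<omega>)) = exp (\<Sum>q\<in>cells m. z q * complex_of_real (incr m (\<lambda>s. W s \<omega>) q))" for \<omega>
    unfolding Y_def cells_def by (simp add: exp_sum sum.cartesian_product[symmetric] incr_def V_def h_def split_beta' prod.cartesian_product)
  moreover have "(\<Prod>j<m. \<Prod>i\<in>UNIV. exp ((z (j, i))\<^sup>2 / 2)) = exp ((\<Sum>q\<in>cells m. (z q)\<^sup>2) / 2)"
    unfolding cells_def sum_divide_distrib by (simp add: exp_sum prod.cartesian_product split_beta')
  ultimately show ?thesis by simp
qed

definition gm :: "nat \<Rightarrow> nat \<Rightarrow> 'w \<Rightarrow> real" where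
  "gm n k \<omega> = real_ip \<mu> (e k) (stepf (Suc n) (\<lambda>s. W s \<omega>))"

text \<open>Pairing of \<open>e k\<close> with white noise, recovered from that of
  \<open>T (e k)\<close> by dividing by the eigenvalue. For \<open>l k = 0\<close> the quotient is
  0; such \<open>k\<close> are outside the Gaussian family.\<close>

definition g :: "nat \<Rightarrow> 'w \<Rightarrow> real" where "g k \<omega> = form (e k) (\<lambda>s. \<xi> s \<omega>) / l k"

text \<open>Covariance of \<open>gm n j\<close> and \<open>gm n k\<close>: the inner product of the
  projections of the two eigenfunctions onto the cells.\<close>

definition gram :: "nat \<Rightarrow> nat \<Rightarrow> nat \<Rightarrow> real" where
  "gram n j k = (\<Sum>q\<in>cells (Suc n). real_ip \<mu> (e j) (cell (Suc n) q) * real_ip \<mu> (e k) (cell (Suc n) q))"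

lemma gm_eq: "gm n k \<omega> = (\<Sum>q\<in>cells (Suc n). incr (Suc n) (\<lambda>s. W s \<omega>) q * real_ip \<mu> (e k) (cell (Suc n) q))"
  unfolding gm_def by (rule ip_stepf) simp

lemma gm_measurable [measurable]: "gm n k \<in> borel_measurable M"
  unfolding gm_eq by measurable

lemma gm_tendsto: "l k \<noteq> 0 \<Longrightarrow> \<omega> \<in> space M \<Longrightarrow> (\<lambda>n. gm n k \<omega>) \<longlonglongrightarrow> g k \<omega>"
proof -
  assume l: "l k \<noteq> 0" and \<omega>: "\<omega> \<in> space M"
  have "(\<lambda>n. real_ip \<mu> (T (e k)) (stepf (Suc n) (\<lambda>s. W s \<omega>)) / l k) \<longlonglongrightarrow> g k \<omega>"
    unfolding g_def using l by (intro tendsto_divide tendsto_const ip_T_stepf_tendsto[OF path_process[OF \<omega>]]) auto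
  then show ?thesis using l by (simp add: T_e ip_scale_left gm_def)
qed

lemma g_measurable [measurable]: "g k \<in> borel_measurable M"
proof (cases "l k = 0")
  case True
  then show ?thesis by (simp add: g_def[abs_def])
next
  case False
  show ?thesis by (rule borel_measurable_LIMSEQ_metric[OF gm_measurable gm_tendsto[OF False]])
qed

lemma gram_limit: "l j \<noteq> 0 \<Longrightarrow> l k \<noteq> 0 \<Longrightarrow> (\<lambda>n. gram n j k) \<longlonglongrightarrow> (if j = k then 1 else 0)"
  unfolding gram_def using gram_tendsto[OF e_in eigenfunction_continuous[OF e_in T_e] e_in T_e, of j k] orthonormal[of k j] by auto

lemma gram_diag_le: "gram n k k \<le> 1"
proof -
  have "gram n k k = (\<Sum>q\<in>cells (Suc n). (real_ip \<mu> (cell (Suc n) q) (e k))\<^sup>2)"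
    unfolding gram_def by (intro sum.cong refl) (simp add: power2_eq_square ip_commute)
  also have "\<dots> \<le> real_ip \<mu> (e k) (e k)" by (rule bessel) (auto simp: cell_orthonormal)
  finally show ?thesis by (simp add: orthonormal split: if_splits)
qed

lemma gm_exp:
  "has_bochner_integral M (\<lambda>\<omega>. exp (\<Sum>k\<in>F. z k * complex_of_real (gm n k \<omega>)))
    (exp ((\<Sum>j\<in>F. \<Sum>k\<in>F. z j * z k * complex_of_real (gram n j k)) / 2))"
proof -
  define Z where "Z q = (\<Sum>k\<in>F. z k * complex_of_real (real_ip \<mu> (e k) (cell (Suc n) q)))" for q
  have 1: "(\<Sum>k\<in>F. z k * complex_of_real (gm n k \<omega>)) = (\<Sum>q\<in>cells (Suc n). Z q * complex_of_real (incr (Suc n) (\<lambda>s. W s \<omega>) q))" for \<omega>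
    unfolding Z_def gm_eq of_real_sum sum_distrib_left sum_distrib_right
    by (subst sum.swap) (simp add: ac_simps)
  have "(Z q)\<^sup>2 = (\<Sum>j\<in>F. \<Sum>k\<in>F. z j * z k * complex_of_real (real_ip \<mu> (e j) (cell (Suc n) q) * real_ip \<mu> (e k) (cell (Suc n) q)))" for q
    unfolding Z_def power2_eq_square sum_product by (simp add: ac_simps)
  then have "(\<Sum>q\<in>cells (Suc n). (Z q)\<^sup>2) = (\<Sum>q\<in>cells (Suc n). \<Sum>j\<in>F. \<Sum>k\<in>F. z j * z k * complex_of_real (real_ip \<mu> (e j) (cell (Suc n) q) * real_ip \<mu> (e k) (cell (Suc n) q)))"
    by simp
  also have "\<dots> = (\<Sum>j\<in>F. \<Sum>q\<in>cells (Suc n). \<Sum>k\<in>F. z j * z k * complex_of_real (real_ip \<mu> (e j) (cell (Suc n) q) * real_ip \<mu> (e k) (cell (Suc n) q)))"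
    by (rule sum.swap)
  also have "\<dots> = (\<Sum>j\<in>F. \<Sum>k\<in>F. \<Sum>q\<in>cells (Suc n). z j * z k * complex_of_real (real_ip \<mu> (e j) (cell (Suc n) q) * real_ip \<mu> (e k) (cell (Suc n) q)))"
    by (rule sum.cong[OF refl sum.swap])
  also have "\<dots> = (\<Sum>j\<in>F. \<Sum>k\<in>F. z j * z k * complex_of_real (gram n j k))"
    by (simp add: gram_def sum_distrib_left)
  finally have 2: "(\<Sum>q\<in>cells (Suc n). (Z q)\<^sup>2) = (\<Sum>j\<in>F. \<Sum>k\<in>F. z j * z k * complex_of_real (gram n j k))" .
  show ?thesis unfolding 1 2[symmetric] by (rule increments_exp) simp
qed

text \<open>Passage to the limit in \<open>gm_exp\<close>: the exponentials converge pointwise, the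
  covariances \<open>gram\<close> tend to the identity on the nonzero eigenvalues, and a second
  moment bound justifies the exchange with the expectation.\<close>

sublocale gaussian_family M g "{k. l k \<noteq> 0}"
proof
  show "g k \<in> borel_measurable M" for k by (rule g_measurable)
  fix F :: "nat set" and z :: "nat \<Rightarrow> complex"
  assume F: "finite F" "F \<subseteq> {k. l k \<noteq> 0}"
  define Fn where "Fn n \<omega> = exp (\<Sum>k\<in>F. z k * complex_of_real (gm n k \<omega>))" for n \<omega>
  \<comment> \<open>The squared modulus of the exponential is again an exponential of the same kind,
    at the arguments \<open>2 * Re (z k)\<close>; so \<open>gm_exp\<close> itself yields the second
    moments, bounded in \<open>n\<close> because they converge.\<close>
  define y where "y k = complex_of_real (2 * Re (z k))" for k
  have gl: "(\<lambda>n. (\<Sum>j\<in>F. \<Sum>k\<in>F. w j * w k * complex_of_real (gram n j k)) / 2) \<longlonglongrightarrow> (\<Sum>k\<in>F. (w k)\<^sup>2) / 2" for w :: "nat \<Rightarrow> complex"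
  proof -
    have "(\<lambda>n. (\<Sum>j\<in>F. \<Sum>k\<in>F. w j * w k * complex_of_real (gram n j k)) / 2)
      \<longlonglongrightarrow> (\<Sum>j\<in>F. \<Sum>k\<in>F. w j * w k * complex_of_real (if j = k then 1 else 0)) / 2"
      using F by (intro tendsto_intros gram_limit) auto
    moreover have "(\<Sum>j\<in>F. \<Sum>k\<in>F. w j * w k * complex_of_real (if j = k then 1 else 0)) = (\<Sum>j\<in>F. (w j)\<^sup>2)"
      using F by (intro sum.cong refl) (simp add: power2_eq_square if_distrib cong: if_cong)
    ultimately show ?thesis by simp
  qed
  define s where "s n = Re (exp ((\<Sum>j\<in>F. \<Sum>k\<in>F. y j * y k * complex_of_real (gram n j k)) / 2))" for n
  have "(\<lambda>n. s n) \<longlonglongrightarrow> Re (exp ((\<Sum>k\<in>F. (y k)\<^sup>2) / 2))"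
    unfolding s_def by (intro tendsto_Re tendsto_exp gl)
  then have "Bseq s" by (intro convergent_imp_Bseq convergentI)
  then obtain C where C: "\<And>n. norm (s n) \<le> C" by (auto simp: Bseq_def)
  have sq: "has_bochner_integral M (\<lambda>\<omega>. (norm (Fn n \<omega>))\<^sup>2) (s n)" for n
  proof -
    have "Re (exp (\<Sum>k\<in>F. y k * complex_of_real (gm n k \<omega>))) = (norm (Fn n \<omega>))\<^sup>2" for \<omega>
    proof -
      have "(\<Sum>k\<in>F. y k * complex_of_real (gm n k \<omega>)) = complex_of_real (2 * (\<Sum>k\<in>F. Re (z k) * gm n k \<omega>))"
        by (simp add: y_def sum_distrib_left mult.assoc)
      then have "Re (exp (\<Sum>k\<in>F. y k * complex_of_real (gm n k \<omega>))) = exp (2 * (\<Sum>k\<in>F. Re (z k) * gm n k \<omega>))"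
        by (simp only: exp_of_real Re_complex_of_real)
      also have "\<dots> = (norm (Fn n \<omega>))\<^sup>2" by (simp add: Fn_def exp_double)
      finally show ?thesis .
    qed
    then show ?thesis
      using has_bochner_integral_bounded_linear[OF bounded_linear_Re gm_exp[where F = F and z = y and n = n]] by (simp add: s_def)
  qed
  have Fnm: "Fn n \<in> borel_measurable M" for n unfolding Fn_def by measurable
  have lim: "(\<lambda>n. Fn n \<omega>) \<longlonglongrightarrow> exp (\<Sum>k\<in>F. z k * complex_of_real (g k \<omega>))" if "\<omega> \<in> space M" for \<omega>
    unfolding Fn_def using F that by (intro tendsto_intros gm_tendsto) auto
  note L = L2_bounded_integral_tendsto[OF Fnm lim sq, of C]
  have Cb: "s n \<le> C" for n using C[of n] by simp
  have "(\<lambda>n. \<integral>\<omega>. Fn n \<omega> \<partial>M) \<longlonglongrightarrow> exp ((\<Sum>k\<in>F. (z k)\<^sup>2) / 2)"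
    using tendsto_exp[OF gl[of z]] gm_exp[where F = F and z = z] by (simp add: Fn_def has_bochner_integral_iff)
  then have "(\<integral>\<omega>. exp (\<Sum>k\<in>F. z k * complex_of_real (g k \<omega>)) \<partial>M) = exp ((\<Sum>k\<in>F. (z k)\<^sup>2) / 2)"
    using LIMSEQ_unique L(2)[OF _ Cb] by blast
  then show "has_bochner_integral M (\<lambda>\<omega>. exp (\<Sum>k\<in>F. z k * complex_of_real (g k \<omega>))) (exp ((\<Sum>k\<in>F. (z k)\<^sup>2) / 2))"
    using L(1)[OF _ Cb] by (simp add: has_bochner_integral_iff)
qed

end

section \<open>Series expansion of the quadratic functional\<close>

text \<open>From the quadratic Taylor bound for the exponential. It allows second moments to be
  estimated from the exponential moments at 1 and -1.\<close>

lemma square_le_exp_sum: "y\<^sup>2 \<le> 2 * (exp y + exp (- y))" for y :: real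
proof -
  have *: "z\<^sup>2 \<le> 2 * exp z" if "0 \<le> z" for z :: real
    using exp_lower_Taylor_quadratic[OF that] that by simp
  show ?thesis
  proof (cases "0 \<le> y")
    case True
    then show ?thesis using *[of y] exp_ge_zero[of "- y"] unfolding distrib_left by linarith
  next
    case False
    then have "y\<^sup>2 \<le> 2 * exp (- y)" using *[of "- y"] by simp
    then show ?thesis using exp_ge_zero[of y] unfolding distrib_left by linarith
  qed
qed

context ou_process
begin

text \<open>\<open>square_le_exp_sum\<close> costs a factor 2, and each of the two exponential
  moments is at most \<open>exp (1 / 2)\<close> because \<open>gram n k k \<le> 1\<close>.\<close>

definition C2 :: real where "C2 = 4 * exp (1 / 2)"

lemma gm_second_moment: "(\<integral>\<^sup>+\<omega>. ennreal (\<bar>l k\<bar> * (gm n k \<omega>)\<^sup>2) \<partial>M) \<le> ennreal (C2 * \<bar>l k\<bar>)"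
proof -
  have h: "has_bochner_integral M (\<lambda>\<omega>. exp (s * gm n k \<omega>)) (exp (s\<^sup>2 * gram n k k / 2))" for s
  proof (rule has_bochner_integral_of_realD)
    have "has_bochner_integral M (\<lambda>\<omega>. exp (complex_of_real s * complex_of_real (gm n k \<omega>)))
      (exp ((complex_of_real s * complex_of_real s * complex_of_real (gram n k k)) / 2))"
      using gm_exp[where F = "{k}" and z = "\<lambda>_. complex_of_real s" and n = n] by simp
    then show "has_bochner_integral M (\<lambda>\<omega>. complex_of_real (exp (s * gm n k \<omega>))) (complex_of_real (exp (s\<^sup>2 * gram n k k / 2)))"
      by (simp add: power2_eq_square exp_of_real[symmetric])
  qed
  have e1: "exp (gram n k k / 2) \<le> exp (1 / 2)" using gram_diag_le[of n k] by simp
  have "has_bochner_integral M (\<lambda>\<omega>. \<bar>l k\<bar> * (2 * (exp (gm n k \<omega>) + exp (- gm n k \<omega>)))) (\<bar>l k\<bar> * (2 * (exp (gram n k k / 2) + exp (gram n k k / 2))))"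
    using h[of 1] h[of "-1"] by (intro has_bochner_integral_mult_right has_bochner_integral_add) auto
  then have 1: "(\<integral>\<^sup>+\<omega>. ennreal (\<bar>l k\<bar> * (2 * (exp (gm n k \<omega>) + exp (- gm n k \<omega>)))) \<partial>M) = ennreal (\<bar>l k\<bar> * (2 * (exp (gram n k k / 2) + exp (gram n k k / 2))))"
    by (subst nn_integral_eq_integral) (auto simp: has_bochner_integral_iff)
  have 2: "(\<integral>\<^sup>+\<omega>. ennreal (\<bar>l k\<bar> * (gm n k \<omega>)\<^sup>2) \<partial>M) \<le> (\<integral>\<^sup>+\<omega>. ennreal (\<bar>l k\<bar> * (2 * (exp (gm n k \<omega>) + exp (- gm n k \<omega>)))) \<partial>M)"
    using square_le_exp_sum by (intro nn_integral_mono ennreal_leI mult_left_mono) auto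
  have 3: "\<bar>l k\<bar> * (2 * (exp (gram n k k / 2) + exp (gram n k k / 2))) \<le> C2 * \<bar>l k\<bar>"
    using mult_left_mono[OF e1, of "\<bar>l k\<bar>"] by (simp add: C2_def)
  show ?thesis using 2 unfolding 1 by (rule order_trans) (rule ennreal_leI[OF 3])
qed

text \<open>Fatou's lemma with varying bounds; used once with the mesh and once with the number of
  terms as the index.\<close>

lemma nn_integral_le_of_tendsto:
  fixes f :: "nat \<Rightarrow> 'w \<Rightarrow> real"
  assumes [measurable]: "\<And>n. f n \<in> borel_measurable M"
    and lim: "AE \<omega> in M. (\<lambda>n. f n \<omega>) \<longlonglongrightarrow> F \<omega>"
    and bound: "\<And>n. (\<integral>\<^sup>+\<omega>. ennreal (f n \<omega>) \<partial>M) \<le> b n" and b: "b \<longlonglongrightarrow> B"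
  shows "(\<integral>\<^sup>+\<omega>. ennreal (F \<omega>) \<partial>M) \<le> B"
proof -
  have "(\<integral>\<^sup>+\<omega>. ennreal (F \<omega>) \<partial>M) = (\<integral>\<^sup>+\<omega>. liminf (\<lambda>n. ennreal (f n \<omega>)) \<partial>M)"
  proof (rule nn_integral_cong_AE)
    show "AE \<omega> in M. ennreal (F \<omega>) = liminf (\<lambda>n. ennreal (f n \<omega>))"
      using lim by eventually_elim (rule lim_imp_Liminf[OF trivial_limit_sequentially tendsto_ennrealI, symmetric])
  qed
  also have "\<dots> \<le> liminf (\<lambda>n. \<integral>\<^sup>+\<omega>. ennreal (f n \<omega>) \<partial>M)" by (rule nn_integral_liminf) measurable
  also have "\<dots> \<le> liminf b" by (intro Liminf_mono always_eventually allI bound)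
  also have "\<dots> = B" by (rule lim_imp_Liminf[OF trivial_limit_sequentially b])
  finally show ?thesis .
qed

section \<open>Exchange of the mesh limit with the eigenvalue series\<close>

definition Qn :: "nat \<Rightarrow> 'w \<Rightarrow> real" where
  "Qn n \<omega> = real_ip \<mu> (T (stepf (Suc n) (\<lambda>s. W s \<omega>))) (stepf (Suc n) (\<lambda>s. W s \<omega>))"

definition Qv :: "'w \<Rightarrow> real" where "Qv \<omega> = quad (\<lambda>s. \<xi> s \<omega>)"

lemma Qn_sums: "(\<lambda>k. l k * (gm n k \<omega>)\<^sup>2) sums Qn n \<omega>"
  unfolding Qn_def gm_def by (rule expansion) simp

lemma Qn_measurable [measurable]: "Qn n \<in> borel_measurable M"
proof -
  have "Qn n = (\<lambda>\<omega>. \<Sum>k. l k * (gm n k \<omega>)\<^sup>2)" using Qn_sums by (simp add: sums_iff fun_eq_iff)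
  then show ?thesis by simp
qed

lemma Qn_tendsto: "\<omega> \<in> space M \<Longrightarrow> (\<lambda>n. Qn n \<omega>) \<longlonglongrightarrow> Qv \<omega>"
  unfolding Qn_def Qv_def by (rule ip_T_stepf_stepf_tendsto[OF path_process])

lemma Qv_measurable [measurable]: "Qv \<in> borel_measurable M"
  by (rule borel_measurable_LIMSEQ_metric[OF Qn_measurable Qn_tendsto])

lemma gm_abs_summable: "summable (\<lambda>k. \<bar>l k\<bar> * (gm n k \<omega>)\<^sup>2)"
proof (rule summable_comparison_test'[where N = 0])
  let ?w = "stepf (Suc n) (\<lambda>s. W s \<omega>)"
  show "summable (\<lambda>k. \<bar>l k\<bar> * real_ip \<mu> ?w ?w)" using summable_l by (rule summable_mult2)
  fix k
  have "(gm n k \<omega>)\<^sup>2 \<le> real_ip \<mu> (e k) (e k) * real_ip \<mu> ?w ?w" unfolding gm_def by (rule CS_ip) auto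
  also have "\<dots> \<le> 1 * real_ip \<mu> ?w ?w" by (intro mult_right_mono ip_nonneg) (auto simp: orthonormal)
  finally show "norm (\<bar>l k\<bar> * (gm n k \<omega>)\<^sup>2) \<le> \<bar>l k\<bar> * real_ip \<mu> ?w ?w"
    by (simp add: abs_mult mult_left_mono)
qed

text \<open>Tail bound that depends on the number of terms but not on the mesh.\<close>

definition rest :: "nat \<Rightarrow> real" where "rest N = C2 * (\<Sum>k. \<bar>l (k + N)\<bar>)"

text \<open>Termwise integration of the tail with \<open>gm_second_moment\<close>. Uniformity in
  \<open>n\<close> is the point: it survives the limit in \<open>Qv_remainder\<close>.\<close>

lemma Qn_remainder: "(\<integral>\<^sup>+\<omega>. ennreal \<bar>Qn n \<omega> - (\<Sum>k<N. l k * (gm n k \<omega>)\<^sup>2)\<bar> \<partial>M) \<le> ennreal (rest N)"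
proof -
  have sN: "summable (\<lambda>k. \<bar>l (k + N)\<bar>)" using summable_l by (subst summable_iff_shift)
  have pt: "ennreal \<bar>Qn n \<omega> - (\<Sum>k<N. l k * (gm n k \<omega>)\<^sup>2)\<bar> \<le> (\<Sum>k. ennreal (\<bar>l (k + N)\<bar> * (gm n (k + N) \<omega>)\<^sup>2))" for \<omega>
  proof -
    have s1: "summable (\<lambda>k. \<bar>l (k + N)\<bar> * (gm n (k + N) \<omega>)\<^sup>2)"
      using gm_abs_summable[of n \<omega>] summable_iff_shift[of "\<lambda>k. \<bar>l k\<bar> * (gm n k \<omega>)\<^sup>2" N] by simp
    have "Qn n \<omega> - (\<Sum>k<N. l k * (gm n k \<omega>)\<^sup>2) = (\<Sum>k. l (k + N) * (gm n (k + N) \<omega>)\<^sup>2)"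
      using Qn_sums[of n \<omega>] suminf_minus_initial_segment[of "\<lambda>k. l k * (gm n k \<omega>)\<^sup>2" N] by (simp add: sums_iff)
    also have "\<bar>\<dots>\<bar> \<le> (\<Sum>k. \<bar>l (k + N) * (gm n (k + N) \<omega>)\<^sup>2\<bar>)"
      using s1 by (intro summable_rabs) (simp add: abs_mult)
    also have "\<dots> = (\<Sum>k. \<bar>l (k + N)\<bar> * (gm n (k + N) \<omega>)\<^sup>2)" by (simp add: abs_mult)
    finally show ?thesis using s1 by (subst suminf_ennreal2) (auto intro: ennreal_leI)
  qed
  have "(\<integral>\<^sup>+\<omega>. ennreal \<bar>Qn n \<omega> - (\<Sum>k<N. l k * (gm n k \<omega>)\<^sup>2)\<bar> \<partial>M) \<le> (\<integral>\<^sup>+\<omega>. (\<Sum>k. ennreal (\<bar>l (k + N)\<bar> * (gm n (k + N) \<omega>)\<^sup>2)) \<partial>M)"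
    by (intro nn_integral_mono pt)
  also have "\<dots> = (\<Sum>k. \<integral>\<^sup>+\<omega>. ennreal (\<bar>l (k + N)\<bar> * (gm n (k + N) \<omega>)\<^sup>2) \<partial>M)"
    by (rule nn_integral_suminf) measurable
  also have "\<dots> \<le> (\<Sum>k. ennreal (C2 * \<bar>l (k + N)\<bar>))"
    by (intro suminf_le gm_second_moment) auto
  also have "\<dots> = ennreal (rest N)"
    unfolding rest_def using sN by (subst suminf_ennreal2) (auto simp: C2_def suminf_mult)
  finally show ?thesis .
qed

lemma Qv_remainder: "(\<integral>\<^sup>+\<omega>. ennreal \<bar>Qv \<omega> - (\<Sum>k<N. l k * (g k \<omega>)\<^sup>2)\<bar> \<partial>M) \<le> ennreal (rest N)"
proof (rule nn_integral_le_of_tendsto[where f = "\<lambda>n \<omega>. \<bar>Qn n \<omega> - (\<Sum>k<N. l k * (gm n k \<omega>)\<^sup>2)\<bar>" and b = "\<lambda>_. ennreal (rest N)"])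
  show "AE \<omega> in M. (\<lambda>n. \<bar>Qn n \<omega> - (\<Sum>k<N. l k * (gm n k \<omega>)\<^sup>2)\<bar>) \<longlonglongrightarrow> \<bar>Qv \<omega> - (\<Sum>k<N. l k * (g k \<omega>)\<^sup>2)\<bar>"
  proof (rule AE_I2)
    fix \<omega> assume \<omega>: "\<omega> \<in> space M"
    have "(\<lambda>n. l k * (gm n k \<omega>)\<^sup>2) \<longlonglongrightarrow> l k * (g k \<omega>)\<^sup>2" for k
      using gm_tendsto[OF _ \<omega>, of k] by (cases "l k = 0") (auto intro!: tendsto_intros)
    then show "(\<lambda>n. \<bar>Qn n \<omega> - (\<Sum>k<N. l k * (gm n k \<omega>)\<^sup>2)\<bar>) \<longlonglongrightarrow> \<bar>Qv \<omega> - (\<Sum>k<N. l k * (g k \<omega>)\<^sup>2)\<bar>"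
      by (intro tendsto_rabs tendsto_diff tendsto_sum Qn_tendsto \<omega>)
  qed
qed (use Qn_remainder in auto)

lemma g_second_moment: "(\<integral>\<^sup>+\<omega>. ennreal (\<bar>l k\<bar> * (g k \<omega>)\<^sup>2) \<partial>M) \<le> ennreal (C2 * \<bar>l k\<bar>)"
proof (rule nn_integral_le_of_tendsto[where f = "\<lambda>n \<omega>. \<bar>l k\<bar> * (gm n k \<omega>)\<^sup>2" and b = "\<lambda>_. ennreal (C2 * \<bar>l k\<bar>)"])
  show "AE \<omega> in M. (\<lambda>n. \<bar>l k\<bar> * (gm n k \<omega>)\<^sup>2) \<longlonglongrightarrow> \<bar>l k\<bar> * (g k \<omega>)\<^sup>2"
    using gm_tendsto[of k] by (cases "l k = 0") (auto intro!: tendsto_intros)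
qed (use gm_second_moment in auto)

lemma AE_summable: "AE \<omega> in M. summable (\<lambda>k. \<bar>l k\<bar> * (g k \<omega>)\<^sup>2)"
proof -
  have "(\<integral>\<^sup>+\<omega>. (\<Sum>k. ennreal (\<bar>l k\<bar> * (g k \<omega>)\<^sup>2)) \<partial>M) = (\<Sum>k. \<integral>\<^sup>+\<omega>. ennreal (\<bar>l k\<bar> * (g k \<omega>)\<^sup>2) \<partial>M)"
    by (rule nn_integral_suminf) measurable
  also have "\<dots> \<le> (\<Sum>k. ennreal (C2 * \<bar>l k\<bar>))" by (intro suminf_le g_second_moment) auto
  also have "\<dots> = ennreal (\<Sum>k. C2 * \<bar>l k\<bar>)"
    using summable_l by (intro suminf_ennreal2) (auto simp: C2_def)
  also have "\<dots> < \<infinity>" by simp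
  finally have "(\<integral>\<^sup>+\<omega>. (\<Sum>k. ennreal (\<bar>l k\<bar> * (g k \<omega>)\<^sup>2)) \<partial>M) \<noteq> \<infinity>" by simp
  then have "AE \<omega> in M. (\<Sum>k. ennreal (\<bar>l k\<bar> * (g k \<omega>)\<^sup>2)) \<noteq> \<infinity>"
    by (intro nn_integral_PInf_AE) measurable
  then show ?thesis by eventually_elim (rule summable_suminf_not_top, auto)
qed

text \<open>The series converges almost surely to some \<open>S\<close> by
  \<open>AE_summable\<close>, while its partial sums approach \<open>Qv\<close> in mean by
  \<open>Qv_remainder\<close>. Fatou's lemma identifies the two limits.\<close>

lemma Qv_series: "AE \<omega> in M. (\<lambda>k. l k * (g k \<omega>)\<^sup>2) sums Qv \<omega>"
proof -
  define S where "S \<omega> = (\<Sum>k. l k * (g k \<omega>)\<^sup>2)" for \<omega>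
  have [measurable]: "S \<in> borel_measurable M" unfolding S_def by measurable
  have sums: "AE \<omega> in M. (\<lambda>k. l k * (g k \<omega>)\<^sup>2) sums S \<omega>"
    using AE_summable
  proof eventually_elim
    case (elim \<omega>)
    then have "summable (\<lambda>k. \<bar>l k * (g k \<omega>)\<^sup>2\<bar>)" by (simp add: abs_mult)
    then have "summable (\<lambda>k. l k * (g k \<omega>)\<^sup>2)" by (rule summable_rabs_cancel)
    then show ?case unfolding S_def by (rule summable_sums)
  qed
  have "rest \<longlonglongrightarrow> C2 * 0"
    unfolding rest_def using suminf_exist_split2[OF summable_l] by (intro tendsto_mult_left) simp
  then have "(\<lambda>N. ennreal (rest N)) \<longlonglongrightarrow> ennreal 0" by (intro tendsto_ennrealI) simp
  then have "(\<integral>\<^sup>+\<omega>. ennreal \<bar>Qv \<omega> - S \<omega>\<bar> \<partial>M) \<le> ennreal 0"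
  proof (rule nn_integral_le_of_tendsto[where f = "\<lambda>N \<omega>. \<bar>Qv \<omega> - (\<Sum>k<N. l k * (g k \<omega>)\<^sup>2)\<bar>", rotated -1])
    show "AE \<omega> in M. (\<lambda>N. \<bar>Qv \<omega> - (\<Sum>k<N. l k * (g k \<omega>)\<^sup>2)\<bar>) \<longlonglongrightarrow> \<bar>Qv \<omega> - S \<omega>\<bar>"
      using sums by eventually_elim (auto simp: sums_def intro!: tendsto_intros)
  qed (use Qv_remainder in auto)
  then have "(\<integral>\<^sup>+\<omega>. ennreal \<bar>Qv \<omega> - S \<omega>\<bar> \<partial>M) = 0" by simp
  then have "AE \<omega> in M. ennreal \<bar>Qv \<omega> - S \<omega>\<bar> = 0"
    by (intro nn_integral_0_iff_AE[THEN iffD1]) measurable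
  with sums show ?thesis by eventually_elim (simp add: ennreal_eq_0_iff)
qed

theorem exp_quad_expectation:
  "(\<integral>\<^sup>+\<omega>. ennreal (exp (- quad (\<lambda>s. \<xi> s \<omega>) / 2)) \<partial>M) = ennreal (exp (- (\<Sum>k. ln (1 + l k)) / 2))"
  using exp_quadratic_series[OF refl l_gt summable_l Qv_measurable Qv_series] by (simp add: Qv_def)

end

theorem theorem2:
  fixes p c r :: "real^'n" and a x t :: real and U :: "real^'n^'n"
    and M :: "'w measure" and W \<xi> :: "real \<Rightarrow> 'w \<Rightarrow> real^'n"
  assumes "a > 0" and "x > 0" and "t \<ge> 0"
    and "inj (\<lambda>i. p $ i)"
    and "\<forall>i. c $ i > 0"
    and "orthogonal_matrix U"
    and "diag p ** diag p + a^2 *\<^sub>R (\<chi> i j. c$i * c$j) = U ** (diag r ** diag r) ** matrix_inv U"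
    and "\<forall>z\<in>{0..x}. invertible (phi_a U r p z t)"
    and "wiener_process M W"
    and "\<forall>\<omega>\<in>space M. continuous_on {0..} (\<lambda>s. \<xi> s \<omega>) \<and>
           (\<forall>s\<ge>0. \<xi> s \<omega> = W s \<omega> + integral {0..s} (\<lambda>u. diag p *v \<xi> u \<omega>))"
  shows "let B = beta U r p x t x;
             d = fredholm_det (Delta_measure x) (f2 a c p B x)
         in d \<in> \<real> \<and> Re d > 0 \<and>
            (\<integral>\<^sup>+\<omega>. ennreal (exp (- (a^2 / 2) * integral {0..x} (\<lambda>y. (c \<bullet> \<xi> y \<omega>)^2)
                   + 1/2 * (((B - diag p) *v \<xi> x \<omega>) \<bullet> \<xi> x \<omega>))) \<partial>M)
            = ennreal (Re d powr (-1/2))"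
proof -
  interpret R: riccati p c r a x t U by (rule riccati.intro) (use assms in auto)
  define B where "B = beta U r p x t x"
  have B: "B - diag p = R.G" by (simp add: B_def R.G_def R.beta_at_x)
  obtain e l where e: "\<And>k. e k \<in> real_L2 (Delta_measure x)" "\<And>k. R.K.T (e k) = l k *\<^sub>R e k"
    "\<And>j k. real_ip (Delta_measure x) (e j) (e k) = (if j = k \<and> l j \<noteq> 0 then 1 else 0)"
    and sl: "summable (\<lambda>k. \<bar>l k\<bar>)"
    and ex: "\<And>f. f \<in> real_L2 (Delta_measure x) \<Longrightarrow>
      (\<lambda>k. l k * (real_ip (Delta_measure x) (e k) f)\<^sup>2) sums real_ip (Delta_measure x) (R.K.T f) f"
    using R.K.spectral by blast
  \<comment> \<open>A padding entry has eigenvalue 0, so only the normalised eigenfunctions need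
    positivity of the form.\<close>
  have l_gt: "- 1 < l k" for k
    using R.eigenvalue_bound[OF e(1,2), of k] e(3)[of k k] by (cases "l k = 0") auto
  have kernel: "f2 a c p B x \<xi>' \<eta> = (\<integral>y. R.K.hh y \<xi>' * R.K.hh y \<eta> \<partial>R.K.\<nu>) - (\<Sum>i\<in>UNIV. \<Sum>j\<in>UNIV. R.G $ i $ j * R.K.kk i \<xi>' * R.K.kk j \<eta>)"
    if "\<xi>' \<in> space (Delta_measure x)" "\<eta> \<in> space (Delta_measure x)" for \<xi>' \<eta> :: "real \<times> 'n"
    by (rule R.K.kernel_factorization[OF that B])
  interpret S: spectral_family "Delta_measure x" R.K.T "f2 a c p B x" e l
  proof
    fix f :: "real \<times> 'n \<Rightarrow> real" and \<xi>' :: "real \<times> 'n"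
    assume f: "f \<in> real_L2 (Delta_measure x)" and \<xi>': "\<xi>' \<in> space (Delta_measure x)"
    show "integrable (Delta_measure x) (\<lambda>\<eta>. f2 a c p B x \<xi>' \<eta> * f \<eta>)"
      by (rule R.K.T_eq_integral(1)[OF f \<xi>' kernel[OF \<xi>']])
    show "(\<integral>\<eta>. f2 a c p B x \<xi>' \<eta> * f \<eta> \<partial>Delta_measure x) = R.K.T f \<xi>'"
      by (rule R.K.T_eq_integral(2)[OF f \<xi>' kernel[OF \<xi>']])
  qed (fact e sl ex)+
  \<comment> \<open>The same eigenpairs serve the determinant and the Gaussian series, so both sides
    of the claim reduce to the sum of the \<open>ln (1 + l k)\<close>.\<close>
  interpret O: ou_process p c a x R.G M W \<xi> e l
    by (intro ou_process.intro ou_process_axioms.intro R.K.ou_kernel_axioms) (use assms(9,10) e sl ex l_gt in auto)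
  define s where "s = (\<Sum>k. ln (1 + l k))"
  have d: "fredholm_det (Delta_measure x) (f2 a c p B x) = complex_of_real (exp s)"
    unfolding s_def by (rule S.fredholm_det_eq[OF l_gt])
  have integrand: "- (a^2 / 2) * integral {0..x} (\<lambda>y. (c \<bullet> \<xi> y \<omega>)^2) + 1/2 * (((B - diag p) *v \<xi> x \<omega>) \<bullet> \<xi> x \<omega>)
    = - R.K.quad (\<lambda>s. \<xi> s \<omega>) / 2" if \<omega>: "\<omega> \<in> space M" for \<omega>
  proof -
    have "continuous_on {0..x} (\<lambda>y. \<xi> y \<omega>)" using O.path_process[OF \<omega>] by (simp add: R.K.path_def)
    then have "(\<integral>y. a * (c \<bullet> \<xi> y \<omega>) * (a * (c \<bullet> \<xi> y \<omega>)) \<partial>R.K.\<nu>) = integral {0..x} (\<lambda>y. a * (c \<bullet> \<xi> y \<omega>) * (a * (c \<bullet> \<xi> y \<omega>)))"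
      by (intro integrable_restrict_IccD(2) integrable_restrict_Icc_continuous continuous_intros)
    also have "\<dots> = integral {0..x} (\<lambda>y. a\<^sup>2 * (c \<bullet> \<xi> y \<omega>)\<^sup>2)" by (simp add: power2_eq_square ac_simps)
    also have "\<dots> = a\<^sup>2 * integral {0..x} (\<lambda>y. (c \<bullet> \<xi> y \<omega>)\<^sup>2)" by simp
    finally show ?thesis unfolding B R.K.quad_def matrix_vector_inner by (simp add: ac_simps)
  qed
  have "(\<integral>\<^sup>+\<omega>. ennreal (exp (- (a^2 / 2) * integral {0..x} (\<lambda>y. (c \<bullet> \<xi> y \<omega>)^2)
       + 1/2 * (((B - diag p) *v \<xi> x \<omega>) \<bullet> \<xi> x \<omega>))) \<partial>M) = (\<integral>\<^sup>+\<omega>. ennreal (exp (- R.K.quad (\<lambda>s. \<xi> s \<omega>) / 2)) \<partial>M)"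
    by (rule nn_integral_cong) (simp only: integrand)
  also have "\<dots> = ennreal (exp (- s / 2))" unfolding s_def by (rule O.exp_quad_expectation)
  also have "exp (- s / 2) = exp s powr (-1/2)" by (simp add: powr_def)
  finally show ?thesis unfolding Let_def B_def[symmetric] d by simp
qed

end
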